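(* Fix integers $q\ge 0$, $n>0$ and $g\ge 0$ with $2g-q+n\ge 3$. For $\beta=(\beta_1,\ldots,\beta_n)$ a tuple of positive integers let $|\beta|=\beta_1+\cdots+\beta_n$ and $t=2g+n-1-q$. Then the scaled Hurwitz number $\mathsf{H}^g_{|\beta|,|\beta|-q}(\beta)/(t!\,|\beta|)$ is a polynomial in $\beta_1,\ldots,\beta_n$ whose lowest degree is at least $2g+n-2-\delta_{0,q}-q$ and whose highest degree is exactly $4g+n-3$.
   Context: For a partition $\beta=[1^{a_1},\ldots,d^{a_d}]\vdash d$ with $n$ parts (a tuple of positive integers is identified with the partition obtained by sorting it), $\mathrm{Aut}(\beta)=\prod_i a_i!$. For $g\ge 0$, $m>0$ with $t=2g-1+n+m-d\ge 0$, $\mathsf{H}^g_{d,m}(\beta)=\frac{\mathrm{Aut}(\beta)}{d!}N$, where $N$ is the number of tuples $(\sigma_0,\tau_1,\ldots,\tau_t,\sigma_{t+1})$ in $\mathfrak{S}_d$ with $\sigma_0$ a $d$-cycle, each $\tau_i$ a transposition, $\sigma_{t+1}$ of cycle type $\beta$, and $\sigma_0\tau_1\cdots\tau_t\sigma_{t+1}$ having exactly $m$ cycles. Here $d=|\beta|$ and $m=|\beta|-q$. $\delta_{0,q}$ is the Kronecker delta. The lowest (highest) degree of a polynomial is the minimal (maximal) total degree of a monomial with nonzero coefficient. *)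

theory Defs
  imports Complex_Main "HOL-Library.Multiset" "HOL-Combinatorics.Permutations"
begin

definition perm_orbit :: "(nat \<Rightarrow> nat) \<Rightarrow> nat \<Rightarrow> nat set" where
  "perm_orbit \<sigma> x = {(\<sigma> ^^ k) x | k. True}"

definition perm_cycles :: "nat \<Rightarrow> (nat \<Rightarrow> nat) \<Rightarrow> nat set set" where
  "perm_cycles d \<sigma> = perm_orbit \<sigma> ` {0..<d}"

definition num_cycles :: "nat \<Rightarrow> (nat \<Rightarrow> nat) \<Rightarrow> nat" where
  "num_cycles d \<sigma> = card (perm_cycles d \<sigma>)"

definition cycle_type :: "nat \<Rightarrow> (nat \<Rightarrow> nat) \<Rightarrow> nat multiset" where
  "cycle_type d \<sigma> = image_mset card (mset_set (perm_cycles d \<sigma>))"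

definition is_dcycle :: "nat \<Rightarrow> (nat \<Rightarrow> nat) \<Rightarrow> bool" where
  "is_dcycle d \<sigma> \<longleftrightarrow> \<sigma> permutes {0..<d} \<and> cycle_type d \<sigma> = {#d#}"

definition is_transp :: "nat \<Rightarrow> (nat \<Rightarrow> nat) \<Rightarrow> bool" where
  "is_transp d \<tau> \<longleftrightarrow> (\<exists>a b. a < d \<and> b < d \<and> a \<noteq> b \<and> \<tau> = Transposition.transpose a b)"

definition aut_partition :: "nat list \<Rightarrow> nat" where
  "aut_partition \<beta> = (\<Prod>i\<in>set \<beta>. fact (count (mset \<beta>) i))"

definition hurwitz_tuples :: "nat \<Rightarrow> nat \<Rightarrow> nat \<Rightarrow> nat list \<Rightarrow>
    ((nat \<Rightarrow> nat) \<times> (nat \<Rightarrow> nat) list \<times> (nat \<Rightarrow> nat)) set" where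
  "hurwitz_tuples d t m \<beta> =
     {(\<sigma>0, ts, \<sigma>1). is_dcycle d \<sigma>0 \<and> length ts = t \<and> (\<forall>\<tau>\<in>set ts. is_transp d \<tau>)
        \<and> \<sigma>1 permutes {0..<d} \<and> cycle_type d \<sigma>1 = mset \<beta>
        \<and> num_cycles d (\<sigma>0 \<circ> foldr (\<circ>) ts id \<circ> \<sigma>1) = m}"

(* H^g_{d,m}(beta) with d = |beta|, n = number of parts, t = 2g-1+n+m-d
   (only meaningful when m > 0 and t >= 0) *)
definition hurwitz_H :: "nat \<Rightarrow> nat \<Rightarrow> nat list \<Rightarrow> rat" where
  "hurwitz_H g m \<beta> =
     (let d = sum_list \<beta>; n = length \<beta>;
          t = nat (2 * int g - 1 + int n + int m - int d)
      in of_nat (aut_partition \<beta>) / fact d * of_nat (card (hurwitz_tuples d t m \<beta>)))"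

(* monomials are exponent vectors e :: nat \<Rightarrow> nat (support in {..<n}) *)
definition mono_deg :: "nat \<Rightarrow> (nat \<Rightarrow> nat) \<Rightarrow> nat" where
  "mono_deg n e = (\<Sum>i<n. e i)"

definition is_mpoly :: "nat \<Rightarrow> ((nat \<Rightarrow> nat) \<Rightarrow> rat) \<Rightarrow> bool" where
  "is_mpoly n c \<longleftrightarrow> finite {e. c e \<noteq> 0} \<and> (\<forall>e. c e \<noteq> 0 \<longrightarrow> (\<forall>i\<ge>n. e i = 0))"

definition mpoly_eval :: "nat \<Rightarrow> ((nat \<Rightarrow> nat) \<Rightarrow> rat) \<Rightarrow> (nat \<Rightarrow> rat) \<Rightarrow> rat" where
  "mpoly_eval n c x = (\<Sum>e\<in>{e. c e \<noteq> 0}. c e * (\<Prod>i<n. x i ^ e i))"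

end

theory Submission
  imports Defs "HOL-Combinatorics.Orbits" "HOL-Computational_Algebra.Polynomial"
    "HOL-Computational_Algebra.Formal_Power_Series"
begin

text \<open>
  Expand \<open>\<Prod>Q. (1 - y ^ card Q) / (1 - y)\<close>, the product over the orbits \<open>Q\<close> of a permutation \<open>s\<close>,
  as \<open>\<Sum>k. phi s k * y ^ k\<close>. Up to the sign \<open>(-1) ^ k\<close>, the coefficients are the values at \<open>s\<close> of the
  characters of the hook shapes, but only two elementary facts about them are needed.
  First, \<open>\<Sum>k<d. phi s k\<close> is \<open>d\<close> if \<open>s\<close> is a \<open>d\<close>-cycle and \<open>0\<close> otherwise.
  Second, multiplication by \<open>\<Sum>p. x ^ cyc p * p\<close> multiplies \<open>phi s k\<close> by \<open>\<Prod>j<d. x + j - k\<close>;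
  this follows from a sign-reversing involution on pairs of a permutation and an invariant subset.
  The number of Hurwitz tuples thus becomes a sum over \<open>k\<close> of \<open>phi\<close> at the cycle type \<open>\<beta>\<close>, times a power of
  \<open>d * c\<close>, where \<open>c = (d - 1) / 2 - k\<close>, times an elementary symmetric function of the contents \<open>j - k\<close>.

  The moments of \<open>phi\<close> in \<open>c\<close> have the exponential generating function
  \<open>(\<Prod>b\<leftarrow>\<beta>. 2 * sinh (b * u / 2)) / (2 * sinh (u / 2))\<close>, so they are \<open>\<Prod>b\<leftarrow>\<beta>. b\<close> times a polynomial
  in the parts. By Newton's identities, the \<open>q\<close>-th elementary symmetric function is
  \<open>(c * d) ^ q / fact q\<close> plus terms of smaller total degree in \<open>c\<close> and \<open>d\<close>, and it is divisible by \<open>d\<close>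
  if \<open>q > 0\<close>. The top homogeneous component of the resulting polynomial is positive at \<open>(1, \<dots>, 1)\<close>.
\<close>

section \<open>Orbits and transpositions\<close>

text \<open>On a \<open>d\<close>-cycle only hook characters are nonzero, so Frobenius' formula for
  the tuples would reduce to a sum over hooks. The two facts of the overview replace representation
  theory: the first expands the indicator of the \<open>d\<close>-cycles; the second, read
  coefficientwise in \<open>x\<close>, treats the transpositions (\<open>d - 1\<close> cycles) and
  the condition on the final product alike. The numerator \<open>\<Prod>Q. 1 - y ^ card Q\<close> is
  det(1 - y s), and its coefficients are signed sums over invariant subsets. They are not
  eigenfunctions: subsets that \<open>s\<close> moves in exactly one element survive the involution.
  A first-order differential equation in \<open>y\<close> determines this error term; it shows that
  the action is triangular and that partial summation, the division by \<open>1 - y\<close>,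
  diagonalises it. The low degrees are governed by explicit powers of \<open>d\<close>. The
  transpositions give \<open>d ^ t\<close>, while the indicator and the normalisation each divide by
  \<open>d\<close>. This leaves \<open>d ^ (t - 2)\<close>, hence the delta term at
  \<open>q = 0\<close>; for \<open>q > 0\<close> the factor \<open>d\<close> of the elementary
  symmetric function raises it to \<open>d ^ (t - 1)\<close>.\<close>

definition orbs :: "nat set \<Rightarrow> (nat \<Rightarrow> nat) \<Rightarrow> nat set set" where
  "orbs A p = perm_orbit p ` A"

definition cyc :: "nat set \<Rightarrow> (nat \<Rightarrow> nat) \<Rightarrow> nat" where
  "cyc A p = card (orbs A p)"

lemma perm_orbit_self: "x \<in> perm_orbit p x"
  unfolding perm_orbit_def by (auto intro: exI[of _ 0])

lemma perm_orbit_conv_orbit: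
  assumes "p permutes A" "finite A"
  shows "perm_orbit p x = orbit p x"
  unfolding perm_orbit_def
  using orbit_altdef_permutation[OF permutes_imp_permutation[OF assms(2,1)]] by simp

lemma perm_orbit_eq:
  assumes "p permutes A" "finite A" "y \<in> perm_orbit p x"
  shows "perm_orbit p y = perm_orbit p x"
proof -
  have c: "cyclic_on p (orbit p x)"
    using cyclic_on_orbit[OF assms(1,2)] .
  show ?thesis
    using orbit_cyclic_eq3[OF c, of y] assms(3)
    by (simp add: perm_orbit_conv_orbit[OF assms(1,2)])
qed

lemma perm_orbit_disjoint:
  assumes "p permutes A" "finite A"
  shows "perm_orbit p x = perm_orbit p y \<or> perm_orbit p x \<inter> perm_orbit p y = {}"
  using perm_orbit_eq[OF assms] by blast

lemma perm_orbit_step: "p x \<in> perm_orbit p x"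
  unfolding perm_orbit_def by (auto intro: exI[of _ 1])

lemma perm_orbit_subset:
  assumes "p ` S \<subseteq> S" "x \<in> S"
  shows "perm_orbit p x \<subseteq> S"
proof -
  have "(p ^^ k) x \<in> S" for k
    using assms by (induction k) auto
  thus ?thesis unfolding perm_orbit_def by auto
qed

lemma perm_orbit_cong:
  assumes "\<And>x. x \<in> S \<Longrightarrow> p x = r x" "p ` S \<subseteq> S" "x \<in> S"
  shows "perm_orbit p x = perm_orbit r x"
proof -
  have "(p ^^ k) x = (r ^^ k) x \<and> (p ^^ k) x \<in> S" for k
    using assms by (induction k) auto
  thus ?thesis unfolding perm_orbit_def by auto
qed

lemma orbs_cong:
  assumes "\<And>x. x \<in> S \<Longrightarrow> p x = r x" "p ` S \<subseteq> S"
  shows "orbs S p = orbs S r"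
  unfolding orbs_def using perm_orbit_cong[OF assms] by (intro image_cong) auto

lemma cyc_cong:
  assumes "\<And>x. x \<in> S \<Longrightarrow> p x = r x" "p ` S \<subseteq> S"
  shows "cyc S p = cyc S r"
  unfolding cyc_def using orbs_cong[OF assms] by simp

lemma Union_orbs:
  assumes "p ` S \<subseteq> S"
  shows "\<Union> (orbs S p) = S"
  unfolding orbs_def using perm_orbit_self perm_orbit_subset[OF assms] by blast

lemma finite_orbs: "finite A \<Longrightarrow> finite (orbs A p)"
  unfolding orbs_def by simp

lemma orbs_disjoint:
  assumes "p permutes A" "finite A" "O1 \<in> orbs S p" "O2 \<in> orbs S' p" "O1 \<noteq> O2"
  shows "O1 \<inter> O2 = {}"
  using assms perm_orbit_disjoint[OF assms(1,2)] unfolding orbs_def by blast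

lemma orbs_finite_elem:
  assumes "p permutes A" "finite A" "Q \<in> orbs A p"
  shows "finite Q" "Q \<noteq> {}" "Q \<subseteq> A"
proof -
  have "p ` A \<subseteq> A" using permutes_image[OF assms(1)] by simp
  hence "\<Union> (orbs A p) = A" by (rule Union_orbs)
  thus "Q \<subseteq> A" using assms(3) by blast
  thus "finite Q" using assms(2) finite_subset by blast
  show "Q \<noteq> {}" using assms(3) perm_orbit_self unfolding orbs_def by blast
qed

lemma sum_card_orbs:
  assumes "p permutes A" "finite A" "p ` S \<subseteq> S" "S \<subseteq> A"
  shows "(\<Sum>Q\<in>orbs S p. card Q) = card S"
proof -
  have "card (\<Union> (orbs S p)) = (\<Sum>Q\<in>orbs S p. card Q)"
  proof (rule card_Union_disjoint)
    show "pairwise disjnt (orbs S p)"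
      using orbs_disjoint[OF assms(1,2)] by (auto simp: pairwise_def disjnt_def)
    fix Q assume "Q \<in> orbs S p"
    hence "Q \<subseteq> S" using Union_orbs[OF assms(3)] by blast
    thus "finite Q" using assms by (meson finite_subset)
  qed
  thus ?thesis using Union_orbs[OF assms(3)] by simp
qed

lemma perm_orbit_image:
  assumes "p permutes A" "finite A"
  shows "p ` perm_orbit p x = perm_orbit p x"
proof -
  have f: "finite (perm_orbit p x)"
  proof (cases "x \<in> A")
    case True
    thus ?thesis using orbs_finite_elem(1)[OF assms] unfolding orbs_def by blast
  next
    case False
    hence "p x = x" using assms(1) by (simp add: permutes_not_in)
    hence "perm_orbit p x \<subseteq> {x}" by (intro perm_orbit_subset) auto
    thus ?thesis using finite_subset by blast
  qed
  have "p ` perm_orbit p x \<subseteq> perm_orbit p x"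
  proof
    fix y assume "y \<in> p ` perm_orbit p x"
    then obtain z where z: "z \<in> perm_orbit p x" "y = p z" by blast
    thus "y \<in> perm_orbit p x" using perm_orbit_eq[OF assms z(1)] perm_orbit_step[of p z] by simp
  qed
  thus ?thesis
    by (intro card_subset_eq f) (simp_all add: card_image[OF inj_on_subset[OF permutes_inj[OF assms(1)]]])
qed

lemma invariant_if_meets_orbit:
  assumes "p permutes A" "finite A" "p ` S = S" "x \<in> S" "y \<in> perm_orbit p x"
  shows "y \<in> S"
  using perm_orbit_subset[of p S x] assms by blast

lemma orbit_period:
  assumes "p permutes A" "finite A"
  obtains l where "l > 0" "(p ^^ l) x = x" "inj_on (\<lambda>i. (p ^^ i) x) {..<l}"
    "perm_orbit p x = (\<lambda>i. (p ^^ i) x) ` {..<l}" "card (perm_orbit p x) = l"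
proof
  let ?l = "funpow_dist1 p x x"
  have s: "x \<in> orbit p x"
    using perm_orbit_self[of x p] perm_orbit_conv_orbit[OF assms] by simp
  show "?l > 0" by simp
  show "(p ^^ ?l) x = x" using funpow_dist1_prop[OF s] .
  show i: "inj_on (\<lambda>i. (p ^^ i) x) {..<?l}"
    using inj_on_funpow_dist1[OF s] by (simp add: atLeast0LessThan)
  show e: "perm_orbit p x = (\<lambda>i. (p ^^ i) x) ` {..<?l}"
    using orbit_conv_funpow_dist1[OF s] perm_orbit_conv_orbit[OF assms]
    by (simp add: atLeast0LessThan)
  show "card (perm_orbit p x) = ?l" unfolding e using card_image[OF i] by simp
qed

section \<open>How a transposition cuts and joins orbits\<close>

lemma transpose_comp_funpow:
  fixes p :: "'a \<Rightarrow> 'a"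
  assumes "\<And>i. 0 < i \<Longrightarrow> i < m \<Longrightarrow> (p ^^ i) c \<noteq> a \<and> (p ^^ i) c \<noteq> b"
  shows "i < m \<Longrightarrow> ((transpose a b \<circ> p) ^^ i) c = (p ^^ i) c"
proof (induction i)
  case (Suc i)
  thus ?case using assms[of "Suc i"] by (simp add: transpose_apply_other)
qed simp

lemma transpose_comp_funpow_last:
  fixes p :: "'a \<Rightarrow> 'a"
  assumes "\<And>i. 0 < i \<Longrightarrow> i < m \<Longrightarrow> (p ^^ i) c \<noteq> a \<and> (p ^^ i) c \<noteq> b" "m > 0"
  shows "((transpose a b \<circ> p) ^^ m) c = transpose a b ((p ^^ m) c)"
proof -
  obtain k where k: "m = Suc k" using assms(2) gr0_implies_Suc by blast
  show ?thesis using transpose_comp_funpow[of m p c a b k] assms(1) k by simp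
qed

lemma perm_orbit_bounded:
  assumes "(p ^^ m) x = x" "m > 0"
  shows "perm_orbit p x = (\<lambda>i. (p ^^ i) x) ` {..<m}"
proof -
  have "(p ^^ k) x = (p ^^ (k mod m)) x" for k
    using funpow_mod_eq[OF assms(1)] by simp
  moreover have "k mod m < m" for k using assms(2) by simp
  ultimately show ?thesis unfolding perm_orbit_def by blast
qed

lemma orbit_transpose_other:
  assumes "p permutes A" "finite A" "a \<notin> perm_orbit p x" "b \<notin> perm_orbit p x"
  shows "perm_orbit (transpose a b \<circ> p) x = perm_orbit p x"
proof (rule perm_orbit_cong[symmetric, where S = "perm_orbit p x"])
  show "p ` perm_orbit p x \<subseteq> perm_orbit p x" using perm_orbit_image[OF assms(1,2)] by simp
  fix y assume "y \<in> perm_orbit p x"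
  hence "p y \<in> perm_orbit p x" using perm_orbit_image[OF assms(1,2)] by blast
  thus "p y = (transpose a b \<circ> p) y" using assms(3,4) by (auto simp: transpose_def)
qed (rule perm_orbit_self)

text \<open>The composite applies \<open>p\<close> first, so an arrival at \<open>b\<close> is
  diverted to \<open>a\<close> and an arrival at \<open>a\<close> to \<open>b\<close>. The cycle
  started at \<open>a\<close> therefore closes up at exponent \<open>j\<close>, and the exponents
  from \<open>j\<close> up to the period form the second orbit.\<close>

lemma orbit_cut:
  assumes "p permutes A" "finite A" "0 < j" "j < card (perm_orbit p a)" "b = (p ^^ j) a"
  shows "perm_orbit (transpose a b \<circ> p) a = (\<lambda>i. (p ^^ i) a) ` {..<j}"
    and "card (perm_orbit (transpose a b \<circ> p) a) = j"
    and "perm_orbit (transpose a b \<circ> p) a \<union> perm_orbit (transpose a b \<circ> p) b = perm_orbit p a"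
    and "perm_orbit (transpose a b \<circ> p) a \<inter> perm_orbit (transpose a b \<circ> p) b = {}"
proof -
  obtain l where l: "l > 0" "(p ^^ l) a = a" "inj_on (\<lambda>i. (p ^^ i) a) {..<l}"
    "perm_orbit p a = (\<lambda>i. (p ^^ i) a) ` {..<l}" "card (perm_orbit p a) = l"
    using orbit_period[OF assms(1,2)] .
  have jl: "j < l" using assms l by simp
  let ?r = "transpose a b \<circ> p"
  have ne: "(p ^^ i) a \<noteq> a \<and> (p ^^ i) a \<noteq> b" if "0 < i" "i < l" "i \<noteq> j" for i
    using inj_onD[OF l(3), of i 0] inj_onD[OF l(3), of i j] that jl assms(5) l(1) by auto
  have ra: "(?r ^^ i) a = (p ^^ i) a" if "i < j" for i
    by (rule transpose_comp_funpow[OF _ that]) (use ne jl in auto)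
  have "(?r ^^ j) a = transpose a b ((p ^^ j) a)"
    by (rule transpose_comp_funpow_last) (use ne jl assms in auto)
  hence "(?r ^^ j) a = a" using assms(5) by simp
  from perm_orbit_bounded[OF this assms(3)]
  show A: "perm_orbit ?r a = (\<lambda>i. (p ^^ i) a) ` {..<j}" using ra by auto
  show "card (perm_orbit ?r a) = j"
    unfolding A using card_image[OF inj_on_subset[OF l(3), of "{..<j}"]] jl by auto
  have pb: "(p ^^ i) b = (p ^^ (i + j)) a" for i using assms(5) by (simp add: funpow_add)
  have ne': "(p ^^ i) b \<noteq> a \<and> (p ^^ i) b \<noteq> b" if "0 < i" "i < l - j" for i
    unfolding pb using ne[of "i + j"] that by auto
  have rb: "(?r ^^ i) b = (p ^^ (i + j)) a" if "i < l - j" for i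
    unfolding pb[symmetric] by (rule transpose_comp_funpow[OF _ that]) (use ne' in auto)
  have "(?r ^^ (l - j)) b = transpose a b ((p ^^ (l - j)) b)"
    by (rule transpose_comp_funpow_last) (use ne' jl in auto)
  hence "(?r ^^ (l - j)) b = b" using l(2) jl by (simp add: pb)
  from perm_orbit_bounded[OF this] jl
  have B0: "perm_orbit ?r b = (\<lambda>i. (p ^^ (i + j)) a) ` {..<l - j}" using rb by auto
  have "(\<lambda>i. (p ^^ (i + j)) a) ` {..<l - j} = (\<lambda>i. (p ^^ i) a) ` ((\<lambda>i. i + j) ` {..<l - j})"
    by (simp add: image_image)
  also have "(\<lambda>i. i + j) ` {..<l - j} = {j..<l}"
    using jl image_add_atLeastLessThan'[of j 0 "l - j"] by (simp add: atLeast0LessThan)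
  finally have B: "perm_orbit ?r b = (\<lambda>i. (p ^^ i) a) ` {j..<l}" using B0 by simp
  have "{..<j} \<union> {j..<l} = {..<l}" using jl by auto
  thus "perm_orbit ?r a \<union> perm_orbit ?r b = perm_orbit p a"
    unfolding A B l(4) by (metis image_Un)
  show "perm_orbit ?r a \<inter> perm_orbit ?r b = {}"
  proof -
    have "{..<j} \<subseteq> {..<l}" "{j..<l} \<subseteq> {..<l}" "{..<j} \<inter> {j..<l} = {}" using jl by auto
    thus ?thesis unfolding A B using inj_on_image_Int[OF l(3)] by (metis image_empty)
  qed
qed

text \<open>Here the diversion acts on two different cycles: the return to \<open>a\<close> leads to
  \<open>b\<close> and conversely, so the two cycles are run through one after the other.\<close>

lemma orbit_join:
  assumes "p permutes A" "finite A" "perm_orbit p a \<noteq> perm_orbit p b" "a \<in> A" "b \<in> A"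
  shows "perm_orbit (transpose a b \<circ> p) a = perm_orbit p a \<union> perm_orbit p b"
    and "perm_orbit (transpose a b \<circ> p) b = perm_orbit p a \<union> perm_orbit p b"
proof -
  let ?r = "transpose a b \<circ> p"
  have rp: "?r permutes A"
    using assms by (intro permutes_compose permutes_swap_id) auto
  obtain l where l: "l > 0" "(p ^^ l) a = a" "inj_on (\<lambda>i. (p ^^ i) a) {..<l}"
    "perm_orbit p a = (\<lambda>i. (p ^^ i) a) ` {..<l}" "card (perm_orbit p a) = l"
    using orbit_period[OF assms(1,2)] .
  obtain m where m: "m > 0" "(p ^^ m) b = b" "inj_on (\<lambda>i. (p ^^ i) b) {..<m}"
    "perm_orbit p b = (\<lambda>i. (p ^^ i) b) ` {..<m}" "card (perm_orbit p b) = m"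
    using orbit_period[OF assms(1,2)] .
  have dis: "perm_orbit p a \<inter> perm_orbit p b = {}"
    using perm_orbit_disjoint[OF assms(1,2)] assms(3) by blast
  have ab: "b \<notin> perm_orbit p a" "a \<notin> perm_orbit p b"
    using dis perm_orbit_self by blast+
  have nea: "(p ^^ i) a \<noteq> a \<and> (p ^^ i) a \<noteq> b" if "0 < i" "i < l" for i
    using inj_onD[OF l(3), of i 0] that ab(1) l(1) l(4) by auto
  have neb: "(p ^^ i) b \<noteq> a \<and> (p ^^ i) b \<noteq> b" if "0 < i" "i < m" for i
    using inj_onD[OF m(3), of i 0] that ab(2) m(1) m(4) by auto
  have ra: "(?r ^^ i) a = (p ^^ i) a" if "i < l" for i
    by (rule transpose_comp_funpow[OF _ that]) (use nea in auto)
  have rb: "(?r ^^ i) b = (p ^^ i) b" if "i < m" for i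
    by (rule transpose_comp_funpow[OF _ that]) (use neb in auto)
  have "(?r ^^ l) a = transpose a b ((p ^^ l) a)"
    by (rule transpose_comp_funpow_last) (use nea l in auto)
  hence "(?r ^^ l) a = b" using l by simp
  hence "b \<in> perm_orbit ?r a" unfolding perm_orbit_def by (intro CollectI exI[of _ l]) simp
  hence eq: "perm_orbit ?r b = perm_orbit ?r a" by (rule perm_orbit_eq[OF rp assms(2)])
  have "perm_orbit p a \<subseteq> perm_orbit ?r a"
    unfolding l(4) using ra unfolding perm_orbit_def by (auto simp: image_iff) metis
  moreover have "perm_orbit p b \<subseteq> perm_orbit ?r b"
    unfolding m(4) using rb unfolding perm_orbit_def by (auto simp: image_iff) metis
  moreover have "perm_orbit ?r a \<subseteq> perm_orbit p a \<union> perm_orbit p b"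
  proof (rule perm_orbit_subset)
    have "p ` (perm_orbit p a \<union> perm_orbit p b) = perm_orbit p a \<union> perm_orbit p b"
      using perm_orbit_image[OF assms(1,2)] by (simp add: image_Un)
    moreover have "transpose a b ` (perm_orbit p a \<union> perm_orbit p b) \<subseteq> perm_orbit p a \<union> perm_orbit p b"
      using perm_orbit_self[of a p] perm_orbit_self[of b p] by (auto simp: transpose_def)
    ultimately show "?r ` (perm_orbit p a \<union> perm_orbit p b) \<subseteq> perm_orbit p a \<union> perm_orbit p b"
      by (metis image_comp)
  qed (use perm_orbit_self in blast)
  ultimately show "perm_orbit ?r a = perm_orbit p a \<union> perm_orbit p b" using eq by blast
  thus "perm_orbit ?r b = perm_orbit p a \<union> perm_orbit p b" using eq by simp
qed

lemma orbs_join: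
  assumes "p permutes A" "finite A" "perm_orbit p a \<noteq> perm_orbit p b" "a \<in> A" "b \<in> A"
  shows "orbs A (transpose a b \<circ> p) =
    insert (perm_orbit p a \<union> perm_orbit p b) (orbs A p - {perm_orbit p a, perm_orbit p b})"
proof -
  let ?r = "transpose a b \<circ> p"
  let ?U = "perm_orbit p a \<union> perm_orbit p b"
  have rp: "?r permutes A"
    using assms by (intro permutes_compose permutes_swap_id) auto
  have in_U: "perm_orbit ?r x = ?U" if "x \<in> ?U" for x
    using perm_orbit_eq[OF rp assms(2), of x a] that orbit_join[OF assms] by auto
  have out_U: "perm_orbit ?r x = perm_orbit p x" if "x \<notin> ?U" for x
  proof (rule orbit_transpose_other[OF assms(1,2)])
    show "a \<notin> perm_orbit p x" using perm_orbit_eq[OF assms(1,2), of a x] that perm_orbit_self by blast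
    show "b \<notin> perm_orbit p x" using perm_orbit_eq[OF assms(1,2), of b x] that perm_orbit_self by blast
  qed
  have "p ` A \<subseteq> A" using permutes_image[OF assms(1)] by simp
  hence UA: "?U \<subseteq> A" using perm_orbit_subset assms(4,5) by blast
  have "orbs A ?r = perm_orbit ?r ` ?U \<union> perm_orbit ?r ` (A - ?U)"
    unfolding orbs_def using UA by blast
  also have "perm_orbit ?r ` ?U = {?U}" using in_U perm_orbit_self[of a p] by blast
  also have "perm_orbit ?r ` (A - ?U) = perm_orbit p ` (A - ?U)" using out_U by auto
  also have "perm_orbit p ` (A - ?U) = orbs A p - {perm_orbit p a, perm_orbit p b}"
    unfolding orbs_def using perm_orbit_eq[OF assms(1,2)] perm_orbit_self by blast
  finally show ?thesis by blast
qed

lemma cyc_join: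
  assumes "p permutes A" "finite A" "perm_orbit p a \<noteq> perm_orbit p b" "a \<in> A" "b \<in> A"
  shows "Suc (cyc A (transpose a b \<circ> p)) = cyc A p"
proof -
  let ?U = "perm_orbit p a \<union> perm_orbit p b"
  \<comment> \<open>The union has to be a new orbit, since otherwise \<open>insert\<close> would not
    raise the cardinality.\<close>
  have nin: "?U \<notin> orbs A p"
  proof
    assume "?U \<in> orbs A p"
    then obtain x where x: "?U = perm_orbit p x" unfolding orbs_def by blast
    hence "perm_orbit p a = perm_orbit p x" "perm_orbit p b = perm_orbit p x"
      using perm_orbit_eq[OF assms(1,2)] perm_orbit_self by blast+
    thus False using assms(3) by simp
  qed
  have sub: "{perm_orbit p a, perm_orbit p b} \<subseteq> orbs A p" unfolding orbs_def using assms by blast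
  have fin: "finite (orbs A p)" using finite_orbs[OF assms(2)] .
  have "cyc A (transpose a b \<circ> p) = Suc (card (orbs A p - {perm_orbit p a, perm_orbit p b}))"
    unfolding cyc_def orbs_join[OF assms] using nin fin by simp
  also have "card (orbs A p - {perm_orbit p a, perm_orbit p b}) = cyc A p - 2"
    unfolding cyc_def using sub assms(3) card_Diff_subset[OF _ sub] by simp
  finally show ?thesis
    using card_mono[OF fin sub] assms(3) unfolding cyc_def by simp
qed

lemma same_orbit_power:
  assumes "p permutes A" "finite A" "b \<in> perm_orbit p a" "a \<noteq> b"
  obtains j where "0 < j" "j < card (perm_orbit p a)" "b = (p ^^ j) a"
proof -
  obtain l where l: "l > 0" "(p ^^ l) a = a" "inj_on (\<lambda>i. (p ^^ i) a) {..<l}"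
    "perm_orbit p a = (\<lambda>i. (p ^^ i) a) ` {..<l}" "card (perm_orbit p a) = l"
    using orbit_period[OF assms(1,2)] .
  then obtain j where j: "j < l" "b = (p ^^ j) a" using assms(3) by auto
  moreover have "j \<noteq> 0" using j assms(4) by (metis funpow_0)
  ultimately show ?thesis using that l(5) by auto
qed

lemma orbs_cut:
  assumes "p permutes A" "finite A" "b \<in> perm_orbit p a" "a \<noteq> b" "a \<in> A"
  shows "orbs A (transpose a b \<circ> p) =
    {perm_orbit (transpose a b \<circ> p) a, perm_orbit (transpose a b \<circ> p) b} \<union> (orbs A p - {perm_orbit p a})"
    and "perm_orbit (transpose a b \<circ> p) a \<noteq> perm_orbit (transpose a b \<circ> p) b"
proof -
  let ?r = "transpose a b \<circ> p"
  have pA: "p ` A \<subseteq> A" using permutes_image[OF assms(1)] by simp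
  hence oA: "perm_orbit p a \<subseteq> A" using perm_orbit_subset assms(5) by blast
  hence bA: "b \<in> A" using assms(3) by blast
  have rp: "?r permutes A"
    using assms bA by (intro permutes_compose permutes_swap_id) auto
  obtain j where j: "0 < j" "j < card (perm_orbit p a)" "b = (p ^^ j) a"
    using same_orbit_power[OF assms(1-4)] .
  note cut = orbit_cut[OF assms(1,2) j]
  show ne: "perm_orbit ?r a \<noteq> perm_orbit ?r b" using cut(4) perm_orbit_self by blast
  have inn: "perm_orbit ?r ` perm_orbit p a = {perm_orbit ?r a, perm_orbit ?r b}"
    using cut(3) perm_orbit_eq[OF rp assms(2)] perm_orbit_self by (auto simp: image_iff)
  have out: "perm_orbit ?r x = perm_orbit p x" if "x \<notin> perm_orbit p a" for x
  proof (rule orbit_transpose_other[OF assms(1,2)])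
    show "a \<notin> perm_orbit p x" using perm_orbit_eq[OF assms(1,2), of a x] that perm_orbit_self by blast
    show "b \<notin> perm_orbit p x"
      using perm_orbit_eq[OF assms(1,2), of b x] perm_orbit_eq[OF assms(1-3)] that perm_orbit_self by blast
  qed
  have "orbs A ?r = perm_orbit ?r ` perm_orbit p a \<union> perm_orbit ?r ` (A - perm_orbit p a)"
    unfolding orbs_def using oA by blast
  also have "perm_orbit ?r ` (A - perm_orbit p a) = perm_orbit p ` (A - perm_orbit p a)" using out by auto
  also have "perm_orbit p ` (A - perm_orbit p a) = orbs A p - {perm_orbit p a}"
    unfolding orbs_def using perm_orbit_eq[OF assms(1,2)] perm_orbit_self by blast
  finally show "orbs A ?r = {perm_orbit ?r a, perm_orbit ?r b} \<union> (orbs A p - {perm_orbit p a})"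
    unfolding inn .
qed

lemma cyc_cut:
  assumes "p permutes A" "finite A" "b \<in> perm_orbit p a" "a \<noteq> b" "a \<in> A"
  shows "cyc A (transpose a b \<circ> p) = Suc (cyc A p)"
proof -
  let ?r = "transpose a b \<circ> p"
  have "p ` A \<subseteq> A" using permutes_image[OF assms(1)] by simp
  hence bA: "b \<in> A" using perm_orbit_subset assms(3,5) by blast
  have rp: "?r permutes A"
    using assms bA by (intro permutes_compose permutes_swap_id) auto
  \<comment> \<open>The transposition is an involution, so joining the two pieces gives back
    \<open>p\<close>, and \<open>cyc_join\<close> applies to \<open>?r\<close>.\<close>
  have "transpose a b \<circ> ?r = p" by (simp add: fun_eq_iff)
  thus ?thesis using cyc_join[OF rp assms(2) orbs_cut(2)[OF assms] assms(5) bA] by simp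
qed

lemma cyc_transpose_parity:
  assumes "p permutes A" "finite A" "a \<noteq> b" "a \<in> A" "b \<in> A"
  shows "(-1) ^ cyc A (transpose a b \<circ> p) = - ((-1::'a::ring_1) ^ cyc A p)"
proof (cases "b \<in> perm_orbit p a")
  case True
  thus ?thesis using cyc_cut[OF assms(1,2) True assms(3,4)] by simp
next
  case False
  hence "perm_orbit p a \<noteq> perm_orbit p b" using perm_orbit_self by blast
  from cyc_join[OF assms(1,2) this assms(4,5), symmetric] show ?thesis by simp
qed

section \<open>Parity and the generating function of the cycle count\<close>

lemma orbs_id: "orbs A id = (\<lambda>x. {x}) ` A"
  unfolding orbs_def perm_orbit_def by auto

lemma cyc_id: "cyc A id = card A"
  unfolding cyc_def orbs_id by (intro card_image) auto

text \<open>Both sides change sign under a transposition and agree at the identity. This trades the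
  sign for a cycle count, which also makes sense on an invariant subset.\<close>

lemma sign_conv_cyc:
  assumes "p permutes A" "finite A"
  shows "sign p = (-1) ^ (card A + cyc A p)"
  using assms
proof (induction p rule: permutes_induct)
  case id
  show ?case by (simp only: cyc_id sign_id flip: mult_2) simp
next
  case (swap a b p)
  have "sign (transpose a b \<circ> p) = - sign p"
    using swap assms(2) by (simp add: sign_compose permutation_swap_id sign_swap_id
      permutes_imp_permutation)
  thus ?case using swap cyc_transpose_parity[of p A a b, where ?'a = int] assms(2)
    by (simp add: power_add comp_def)
qed

lemma cyc_mult_sign:
  assumes "p permutes A" "r permutes A" "finite A"
  shows "(-1) ^ cyc A (p \<circ> r) = (-1 :: int) ^ (card A + cyc A p + cyc A r)"
proof -
  have "sign (p \<circ> r) = sign p * sign r"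
    using assms by (intro sign_compose permutes_imp_permutation) auto
  hence "(-1) ^ (card A + cyc A (p \<circ> r)) = (-1::int) ^ (card A + cyc A p) * (-1) ^ (card A + cyc A r)"
    using assms by (simp only: sign_conv_cyc[OF permutes_compose[OF assms(2,1)] assms(3)] sign_conv_cyc)
  thus ?thesis by (auto simp: minus_one_power_iff split: if_splits)
qed

text \<open>The rising factorial generates the unsigned Stirling numbers of the first kind. A new
  point \<open>a\<close> either stays fixed and contributes a factor \<open>x\<close>, or is
  inserted into the cycle of one of the old points \<open>b\<close> by \<open>transpose a b\<close>,
  which leaves the cycle count unchanged.\<close>

lemma sum_power_cyc:
  fixes x :: "'a::comm_ring_1"
  assumes "finite A"
  shows "(\<Sum>p | p permutes A. x ^ cyc A p) = (\<Prod>j<card A. x + of_nat j)"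
  using assms
proof (induction A)
  case empty
  show ?case by (simp add: cyc_def orbs_def)
next
  case (insert a A)
  have cyc1: "cyc (insert a A) p = Suc (cyc A p)" if p: "p permutes A" for p
  proof -
    have pa: "p a = a" using p insert(2) by (simp add: permutes_not_in)
    have oa: "perm_orbit p a = {a}"
    proof
      show "perm_orbit p a \<subseteq> {a}" by (rule perm_orbit_subset) (use pa in auto)
    qed (use perm_orbit_self in blast)
    have "p ` A \<subseteq> A" using permutes_image[OF p] by simp
    hence "\<Union> (orbs A p) = A" by (rule Union_orbs)
    hence "{a} \<notin> orbs A p" using insert(2) by blast
    moreover have "orbs (insert a A) p = insert {a} (orbs A p)" unfolding orbs_def using oa by simp
    ultimately show ?thesis unfolding cyc_def using finite_orbs[OF insert(1)] by simp
  qed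
  have cyc2: "cyc (insert a A) (transpose a b \<circ> p) = cyc A p" if p: "p permutes A" and b: "b \<in> A" for p b
  proof -
    have pa: "p a = a" using p insert(2) by (simp add: permutes_not_in)
    have "perm_orbit p a \<subseteq> {a}" by (rule perm_orbit_subset) (use pa in auto)
    hence "perm_orbit p a \<noteq> perm_orbit p b" using perm_orbit_self b insert(2) by blast
    moreover have "p permutes insert a A" using p by (meson permutes_subset subset_insertI)
    ultimately have "Suc (cyc (insert a A) (transpose a b \<circ> p)) = cyc (insert a A) p"
      using b insert(1) by (intro cyc_join) auto
    thus ?thesis using cyc1[OF p] by simp
  qed
  have "(\<Sum>p | p permutes insert a A. x ^ cyc (insert a A) p)
     = (\<Sum>b\<in>insert a A. \<Sum>p | p permutes A. x ^ cyc (insert a A) (transpose a b \<circ> p))"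
    by (rule sum_over_permutations_insert[OF insert(1,2)])
  also have "\<dots> = (\<Sum>p | p permutes A. x ^ cyc (insert a A) p)
      + (\<Sum>b\<in>A. \<Sum>p | p permutes A. x ^ cyc (insert a A) (transpose a b \<circ> p))"
    using insert(1,2) by simp
  also have "(\<Sum>p | p permutes A. x ^ cyc (insert a A) p) = x * (\<Sum>p | p permutes A. x ^ cyc A p)"
    unfolding sum_distrib_left by (intro sum.cong) (auto simp: cyc1)
  also have "(\<Sum>b\<in>A. \<Sum>p | p permutes A. x ^ cyc (insert a A) (transpose a b \<circ> p)) =
     (\<Sum>b\<in>A. \<Sum>p | p permutes A. x ^ cyc A p)"
    by (intro sum.cong refl) (auto simp: cyc2)
  finally show ?case using insert by (simp add: algebra_simps)
qed

section \<open>Permutations preserving a subset\<close>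

lemma finite_perms: "finite A \<Longrightarrow> finite {p. p permutes A \<and> Q p}"
  by (rule finite_subset[OF _ finite_permutations]) auto

lemma invariant_Diff:
  assumes "p permutes A" "p ` S = S"
  shows "p ` (A - S) = A - S"
  using assms permutes_image[OF assms(1)] by (metis image_set_diff permutes_inj)

lemma orbs_Un: "orbs (S \<union> T) p = orbs S p \<union> orbs T p"
  unfolding orbs_def by (rule image_Un)

lemma orbs_disjoint_Diff:
  assumes "p ` S \<subseteq> S" "p ` T \<subseteq> T" "S \<inter> T = {}"
  shows "orbs S p \<inter> orbs T p = {}"
proof -
  have "Q \<subseteq> S" if "Q \<in> orbs S p" for Q using Union_orbs[OF assms(1)] that by blast
  moreover have "Q \<subseteq> T" if "Q \<in> orbs T p" for Q using Union_orbs[OF assms(2)] that by blast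
  moreover have "Q \<noteq> {}" if "Q \<in> orbs T p" for Q
    using that perm_orbit_self unfolding orbs_def by blast
  ultimately have "Q \<notin> orbs T p" if "Q \<in> orbs S p" for Q
    using assms(3) that by (metis Int_subset_iff subset_empty)
  thus ?thesis by blast
qed

lemma orbs_split:
  assumes "p permutes A" "S \<subseteq> A" "p ` S = S"
  shows "orbs A p = orbs S p \<union> orbs (A - S) p" "orbs S p \<inter> orbs (A - S) p = {}"
proof -
  have "S \<union> (A - S) = A" using assms(2) by blast
  thus "orbs A p = orbs S p \<union> orbs (A - S) p" by (metis orbs_Un)
  show "orbs S p \<inter> orbs (A - S) p = {}"
    by (rule orbs_disjoint_Diff) (use invariant_Diff[OF assms(1,3)] assms in auto)
qed

lemma cyc_split:
  assumes "p permutes A" "finite A" "S \<subseteq> A" "p ` S = S"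
  shows "cyc A p = cyc S p + cyc (A - S) p"
  unfolding cyc_def orbs_split(1)[OF assms(1,3,4)]
  using orbs_split(2)[OF assms(1,3,4)] assms finite_subset[OF assms(3)]
  by (intro card_Un_disjoint finite_orbs) auto

lemma permutes_comp_disjoint:
  assumes "p permutes S" "r permutes A - S" "S \<subseteq> A"
  shows "p \<circ> r permutes A" "(p \<circ> r) ` S = S"
    "\<And>x. x \<in> S \<Longrightarrow> (p \<circ> r) x = p x" "\<And>x. x \<in> A - S \<Longrightarrow> (p \<circ> r) x = r x"
proof -
  show "p \<circ> r permutes A"
    using assms by (meson Diff_subset permutes_compose permutes_subset)
  show 1: "(p \<circ> r) x = p x" if "x \<in> S" for x using that assms(2) by (simp add: permutes_not_in)
  show "(p \<circ> r) ` S = S" using 1 permutes_image[OF assms(1)] by auto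
  fix x assume "x \<in> A - S"
  hence "r x \<in> A - S" using permutes_in_image[OF assms(2)] by simp
  thus "(p \<circ> r) x = r x" using assms(1) by (simp add: permutes_not_in)
qed

lemma orbs_comp_disjoint:
  assumes "p permutes S" "r permutes A - S" "S \<subseteq> A"
  shows "orbs S (p \<circ> r) = orbs S p" "orbs (A - S) (p \<circ> r) = orbs (A - S) r"
proof -
  note c = permutes_comp_disjoint[OF assms]
  show "orbs S (p \<circ> r) = orbs S p" by (rule orbs_cong) (use c in auto)
  show "orbs (A - S) (p \<circ> r) = orbs (A - S) r"
    by (rule orbs_cong) (use c(4) invariant_Diff[OF c(1,2)] in auto)
qed

lemma perm_restrict_permutes:
  assumes "p permutes A" "finite A" "S \<subseteq> A" "p ` S = S"
  shows "perm_restrict p S permutes S"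
proof (rule bij_imp_permutes)
  have "inj_on p S" using permutes_inj[OF assms(1)] inj_on_subset by blast
  hence "inj_on (perm_restrict p S) S" by (simp add: inj_on_def perm_restrict_def)
  moreover have "perm_restrict p S ` S = p ` S" by (auto simp: perm_restrict_def)
  ultimately show "bij_betw (perm_restrict p S) S S" using assms(4) by (simp add: bij_betw_def)
qed (simp add: perm_restrict_def)

lemma permutes_split_bij:
  assumes "finite A" "S \<subseteq> A"
  shows "bij_betw (\<lambda>(p, r). p \<circ> r) ({p. p permutes S} \<times> {r. r permutes (A - S)})
     {p. p permutes A \<and> p ` S = S}"
proof (rule bij_betw_byWitness[where f' = "\<lambda>p. (perm_restrict p S, perm_restrict p (A - S))"])
  show "(\<lambda>(p, r). p \<circ> r) ` ({p. p permutes S} \<times> {r. r permutes A - S}) \<subseteq> {p. p permutes A \<and> p ` S = S}"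
  proof (rule image_subsetI)
    fix z assume "z \<in> {p. p permutes S} \<times> {r. r permutes A - S}"
    then obtain p r where "z = (p, r)" "p permutes S" "r permutes A - S" by auto
    thus "(\<lambda>(p, r). p \<circ> r) z \<in> {p. p permutes A \<and> p ` S = S}"
      using permutes_comp_disjoint(1,2)[OF _ _ assms(2), of p r] by simp
  qed
  show "(\<lambda>p. (perm_restrict p S, perm_restrict p (A - S))) ` {p. p permutes A \<and> p ` S = S}
      \<subseteq> {p. p permutes S} \<times> {r. r permutes A - S}"
    using perm_restrict_permutes[OF _ assms(1) assms(2)]
      perm_restrict_permutes[OF _ assms(1) Diff_subset invariant_Diff] by auto
  show "\<forall>a\<in>{p. p permutes S} \<times> {r. r permutes A - S}.
       (perm_restrict ((\<lambda>(p, r). p \<circ> r) a) S, perm_restrict ((\<lambda>(p, r). p \<circ> r) a) (A - S)) = a"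
  proof safe
    fix p r assume pr: "p permutes S" "r permutes A - S"
    note c = permutes_comp_disjoint[OF pr assms(2)]
    show "perm_restrict (p \<circ> r) S = p"
      using c(3) pr(1) by (auto simp: perm_restrict_def fun_eq_iff permutes_not_in)
    show "perm_restrict (p \<circ> r) (A - S) = r"
      using c(4) pr(2) by (auto simp: perm_restrict_def fun_eq_iff permutes_not_in)
  qed
  show "\<forall>p\<in>{p. p permutes A \<and> p ` S = S}.
       (\<lambda>(p, r). p \<circ> r) (perm_restrict p S, perm_restrict p (A - S)) = p"
  proof safe
    fix p assume p: "p permutes A" "p ` S = S"
    have "p x \<in> A - S" if "x \<in> A - S" for x using invariant_Diff[OF p] that by blast
    moreover have "p x = x" if "x \<notin> A" for x using p(1) that by (simp add: permutes_not_in)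
    ultimately show "perm_restrict p S \<circ> perm_restrict p (A - S) = p"
      using assms(2) by (auto simp: perm_restrict_def fun_eq_iff)
  qed
qed

lemma sum_permutes_split:
  assumes "finite A" "S \<subseteq> A"
  shows "(\<Sum>p | p permutes A \<and> p ` S = S. f p)
     = (\<Sum>p | p permutes S. \<Sum>r | r permutes A - S. f (p \<circ> r))"
proof -
  have "(\<Sum>p | p permutes S. \<Sum>r | r permutes A - S. f (p \<circ> r))
     = (\<Sum>z\<in>{p. p permutes S} \<times> {r. r permutes A - S}. f ((\<lambda>(p, r). p \<circ> r) z))"
    by (simp add: sum.cartesian_product case_prod_unfold)
  also have "\<dots> = (\<Sum>p | p permutes A \<and> p ` S = S. f p)"
    by (rule sum.reindex_bij_betw[OF permutes_split_bij[OF assms]])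
  finally show ?thesis by (rule sym)
qed

section \<open>Cycle types and the sizes of conjugacy classes\<close>

definition ctype :: "nat set \<Rightarrow> (nat \<Rightarrow> nat) \<Rightarrow> nat multiset" where
  "ctype A p = image_mset card (mset_set (orbs A p))"

lemma ctype_split:
  assumes "p permutes A" "finite A" "S \<subseteq> A" "p ` S = S"
  shows "ctype A p = ctype S p + ctype (A - S) p"
  unfolding ctype_def orbs_split(1)[OF assms(1,3,4)]
  using orbs_split(2)[OF assms(1,3,4)] assms finite_subset[OF assms(3)]
  by (subst mset_set_Union) (auto intro: finite_orbs)

lemma count_ctype:
  assumes "finite A"
  shows "count (ctype A p) b = card {Q \<in> orbs A p. card Q = b}"
proof -
  have "count (ctype A p) b = (\<Sum>Q\<in>card -` {b} \<inter> orbs A p. count (mset_set (orbs A p)) Q)"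
    unfolding ctype_def count_image_mset using finite_orbs[OF assms] by simp
  also have "\<dots> = (\<Sum>Q\<in>card -` {b} \<inter> orbs A p. 1)"
    using finite_orbs[OF assms] by (intro sum.cong) auto
  also have "\<dots> = card (card -` {b} \<inter> orbs A p)" by simp
  also have "card -` {b} \<inter> orbs A p = {Q \<in> orbs A p. card Q = b}" by auto
  finally show ?thesis .
qed

lemma cyc_eq_1_iff:
  assumes "p permutes A" "finite A" "Q \<subseteq> A"
  shows "Q \<in> orbs A p \<longleftrightarrow> p ` Q = Q \<and> cyc Q p = 1"
proof
  assume Q: "Q \<in> orbs A p"
  then obtain x where x: "x \<in> A" "Q = perm_orbit p x" unfolding orbs_def by blast
  have "perm_orbit p ` Q = {Q}"
    using perm_orbit_eq[OF assms(1,2)] perm_orbit_self x by blast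
  thus "p ` Q = Q \<and> cyc Q p = 1"
    using perm_orbit_image[OF assms(1,2)] x by (simp add: cyc_def orbs_def)
next
  assume *: "p ` Q = Q \<and> cyc Q p = 1"
  then obtain R where R: "orbs Q p = {R}" unfolding cyc_def by (meson card_1_singletonE)
  have "\<Union> (orbs Q p) = Q" by (rule Union_orbs) (use * in auto)
  hence "Q \<in> orbs Q p" using R by simp
  moreover have "orbs Q p \<subseteq> orbs A p" unfolding orbs_def using assms(3) by (rule image_mono)
  ultimately show "Q \<in> orbs A p" by blast
qed

text \<open>The count is the coefficient of \<open>x\<close> in the rising factorial of
  \<open>sum_power_cyc\<close>; after splitting off the factor \<open>x\<close> it is the value of
  the remaining product at 0.\<close>

lemma card_single_cycles:
  assumes "finite Q" "Q \<noteq> {}"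
  shows "card {p. p permutes Q \<and> cyc Q p = 1} = fact (card Q - 1)"
proof -
  let ?x = "[:0, 1:] :: int poly"
  obtain m where m: "card Q = Suc m" using assms by (metis card_gt_0_iff gr0_implies_Suc)
  have xm: "?x ^ n = monom 1 n" for n by (simp add: monom_altdef)
  have "coeff (\<Sum>p | p permutes Q. ?x ^ cyc Q p) 1 = (\<Sum>p | p permutes Q. if cyc Q p = 1 then 1 else 0)"
    unfolding coeff_sum xm by (simp add: coeff_monom)
  also have "\<dots> = int (card {p. p permutes Q \<and> cyc Q p = 1})"
    using finite_permutations[OF assms(1)] by (simp add: sum.If_cases Int_def)
  finally have 1: "int (card {p. p permutes Q \<and> cyc Q p = 1}) = coeff (\<Prod>j<Suc m. ?x + of_nat j) 1"
    using sum_power_cyc[OF assms(1), of ?x] m by simp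
  also have "(\<Prod>j<Suc m. ?x + of_nat j) = ?x * (\<Prod>j<m. ?x + of_nat (Suc j))"
    by (simp only: prod.lessThan_Suc_shift) simp
  also have "coeff \<dots> 1 = poly (\<Prod>j<m. ?x + of_nat (Suc j)) 0"
    by (simp add: poly_0_coeff_0)
  also have "\<dots> = (\<Prod>j<m. 1 + int j)" by (simp add: poly_prod)
  also have "\<dots> = fact m"
    by (induction m) (auto simp: algebra_simps)
  finally have "int (card {p. p permutes Q \<and> cyc Q p = 1}) = int (fact m)"
    by (simp only: of_nat_fact)
  thus ?thesis unfolding m diff_Suc_1 of_nat_eq_iff .
qed

lemma ctype_single: "finite Q \<Longrightarrow> p ` Q \<subseteq> Q \<Longrightarrow> cyc Q p = 1 \<Longrightarrow> ctype Q p = {#card Q#}"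
proof -
  assume *: "finite Q" "p ` Q \<subseteq> Q" "cyc Q p = 1"
  then obtain R where R: "orbs Q p = {R}" unfolding cyc_def by (meson card_1_singletonE)
  have "\<Union> (orbs Q p) = Q" by (rule Union_orbs) (use * in auto)
  thus ?thesis unfolding ctype_def R using R by simp
qed

text \<open>Double counting of pairs of a permutation and one of its orbits \<open>Q\<close> of size
  \<open>b\<close>. Each permutation has \<open>count (mset (b # \<beta>)) b\<close> such orbits;
  each \<open>Q\<close> admits \<open>fact (b - 1)\<close> cycles, combined with a permutation of
  type \<open>\<beta>\<close> on the complement. The multiplicative form avoids division of natural
  numbers.\<close>

lemma card_cycle_type:
  assumes "finite A" "card A = sum_list \<beta>" "\<forall>b\<in>set \<beta>. b > 0"
  shows "card {p. p permutes A \<and> ctype A p = mset \<beta>} * (aut_partition \<beta> * prod_list \<beta>) = fact (card A)"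
  using assms
proof (induction \<beta> arbitrary: A)
  case Nil
  hence A: "A = {}" by simp
  have "ctype {} p = {#}" for p by (simp add: ctype_def orbs_def)
  hence "{p. p permutes A \<and> ctype A p = mset []} = {id}" unfolding A by auto
  thus ?case using A by (simp add: aut_partition_def)
next
  case (Cons b \<beta>)
  let ?C = "{p. p permutes A \<and> ctype A p = mset (b # \<beta>)}"
  let ?f = "\<lambda>A. card {p. p permutes A \<and> ctype A p = mset \<beta>}"
  let ?B = "{Q. Q \<subseteq> A \<and> card Q = b}"
  have b: "b > 0" "b \<le> card A" using Cons by auto
  have finC: "finite ?C" using finite_perms[OF Cons(2)] .
  have finB: "finite ?B" using Cons(2) by simp
  have "card ?C * count (mset (b # \<beta>)) b = (\<Sum>p\<in>?C. card {Q \<in> ?B. Q \<in> orbs A p})"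
  proof -
    have "card {Q \<in> ?B. Q \<in> orbs A p} = count (mset (b # \<beta>)) b" if "p \<in> ?C" for p
    proof -
      have "{Q \<in> ?B. Q \<in> orbs A p} = {Q \<in> orbs A p. card Q = b}"
        using orbs_finite_elem(3)[of p A] that Cons(2) by blast
      thus ?thesis using count_ctype[OF Cons(2), of p b] that by simp
    qed
    thus ?thesis by simp
  qed
  also have "\<dots> = (\<Sum>Q\<in>?B. card {p \<in> ?C. Q \<in> orbs A p})"
    unfolding card_eq_sum[of "{Q \<in> ?B. Q \<in> orbs A p}" for p]
      card_eq_sum[of "{p \<in> ?C. Q \<in> orbs A p}" for Q]
    by (rule sum.swap_restrict[OF finC finB])
  also have "\<dots> = (\<Sum>Q\<in>?B. fact (b - 1) * ?f (A - Q))"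
  proof (rule sum.cong[OF refl])
    fix Q assume Q: "Q \<in> ?B"
    hence QA: "Q \<subseteq> A" and fQ: "finite Q" and cQ: "card Q = b" using Cons(2) finite_subset by auto
    have ne: "Q \<noteq> {}" using cQ b(1) by auto
    have "bij_betw (\<lambda>(p, r). p \<circ> r)
       ({p. p permutes Q \<and> cyc Q p = 1} \<times> {p. p permutes A - Q \<and> ctype (A - Q) p = mset \<beta>})
       {p \<in> ?C. Q \<in> orbs A p}"
    proof (rule bij_betw_subset[OF permutes_split_bij[OF Cons(2) QA]])
      let ?P = "{p. p permutes Q} \<times> {r. r permutes A - Q}"
      let ?P' = "{p. p permutes Q \<and> cyc Q p = 1} \<times> {p. p permutes A - Q \<and> ctype (A - Q) p = mset \<beta>}"
      show "?P' \<subseteq> ?P" by auto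
      have key: "p \<circ> r \<in> {p \<in> ?C. Q \<in> orbs A p} \<longleftrightarrow> (p, r) \<in> ?P'" if "(p, r) \<in> ?P" for p r
      proof -
        have pr: "p permutes Q" "r permutes A - Q" using that by auto
        note c = permutes_comp_disjoint[OF pr QA] orbs_comp_disjoint[OF pr QA]
        have e: "cyc Q (p \<circ> r) = cyc Q p" "ctype (A - Q) (p \<circ> r) = ctype (A - Q) r"
          using c by (simp_all add: cyc_def ctype_def)
        have "ctype A (p \<circ> r) = mset (b # \<beta>) \<longleftrightarrow> ctype (A - Q) r = mset \<beta>" if "cyc Q p = 1"
          using ctype_split[OF c(1) Cons(2) QA c(2)] ctype_single[of Q "p \<circ> r"] fQ c(2) e that cQ
          by simp
        thus ?thesis using cyc_eq_1_iff[OF c(1) Cons(2) QA] c(1,2) e pr by auto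
      qed
      show "(\<lambda>(p, r). p \<circ> r) ` ?P' = {p \<in> ?C. Q \<in> orbs A p}"
      proof safe
        fix p assume p: "p permutes A" "ctype A p = mset (b # \<beta>)" "Q \<in> orbs A p"
        hence "p \<in> {p. p permutes A \<and> p ` Q = Q}" using cyc_eq_1_iff[OF p(1) Cons(2) QA] by auto
        hence "p \<in> (\<lambda>(p, r). p \<circ> r) ` ?P"
          by (simp only: bij_betw_imp_surj_on[OF permutes_split_bij[OF Cons(2) QA]])
        then obtain s r where sr: "(s, r) \<in> ?P" "p = s \<circ> r" by auto
        hence "(s, r) \<in> ?P'" using key[OF sr(1)] p by simp
        thus "p \<in> (\<lambda>(p, r). p \<circ> r) ` ?P'" using sr(2) by (auto simp: image_iff)
      qed (use key in auto)
    qed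
    from bij_betw_same_card[OF this] show "card {p \<in> ?C. Q \<in> orbs A p} = fact (b - 1) * ?f (A - Q)"
      using card_single_cycles[OF fQ ne] cQ by (simp add: card_cartesian_product)
  qed
  finally have "card ?C * count (mset (b # \<beta>)) b = fact (b - 1) * (\<Sum>Q\<in>?B. ?f (A - Q))"
    by (simp add: sum_distrib_left)
  hence "card ?C * count (mset (b # \<beta>)) b * (aut_partition \<beta> * prod_list \<beta>)
     = fact (b - 1) * (\<Sum>Q\<in>?B. ?f (A - Q) * (aut_partition \<beta> * prod_list \<beta>))"
    by (simp add: sum_distrib_right)
  also have "(\<Sum>Q\<in>?B. ?f (A - Q) * (aut_partition \<beta> * prod_list \<beta>)) = (\<Sum>Q\<in>?B. fact (card A - b))"
  proof (rule sum.cong[OF refl])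
    fix Q assume Q: "Q \<in> ?B"
    hence c: "card (A - Q) = card A - b" using Cons(2) by (auto simp: card_Diff_subset finite_subset)
    show "?f (A - Q) * (aut_partition \<beta> * prod_list \<beta>) = fact (card A - b)"
      using Cons(1)[of "A - Q"] Cons(2-4) c by simp
  qed
  also have "\<dots> = (card A choose b) * fact (card A - b)"
    using n_subsets[OF Cons(2), of b] by simp
  finally have main: "card ?C * (count (mset (b # \<beta>)) b * aut_partition \<beta> * prod_list \<beta>)
     = fact (b - 1) * fact (card A - b) * (card A choose b)"
    by (simp only: mult_ac)
  \<comment> \<open>The multiplicity from the double count is exactly the factor by which
    \<open>aut_partition\<close> grows.\<close>
  have aut: "aut_partition (b # \<beta>) = count (mset (b # \<beta>)) b * aut_partition \<beta>"
  proof -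
    have "aut_partition (b # \<beta>) = fact (Suc (count (mset \<beta>) b)) * (\<Prod>i\<in>set \<beta> - {b}. fact (count (mset \<beta>) i))"
      unfolding aut_partition_def
      by (simp only: list.set prod.insert_remove finite_set) (auto intro!: prod.cong)
    moreover have "aut_partition \<beta> = fact (count (mset \<beta>) b) * (\<Prod>i\<in>set \<beta> - {b}. fact (count (mset \<beta>) i))"
    proof (cases "b \<in> set \<beta>")
      case False
      hence "fact (count (mset \<beta>) b) = (1 :: nat)" by (metis count_inI set_mset_mset fact_0)
      thus ?thesis unfolding aut_partition_def using False by simp
    qed (simp add: aut_partition_def prod.remove)
    ultimately show ?thesis by (simp add: algebra_simps)
  qed
  have "card ?C * (aut_partition (b # \<beta>) * prod_list (b # \<beta>))
     = b * (card ?C * (count (mset (b # \<beta>)) b * aut_partition \<beta> * prod_list \<beta>))"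
    unfolding aut by (simp only: prod_list.Cons mult_ac)
  also have "\<dots> = b * fact (b - 1) * fact (card A - b) * (card A choose b)"
    unfolding main by (simp only: mult_ac)
  also have "b * fact (b - 1) = (fact b :: nat)" using b by (simp add: fact_reduce)
  also have "fact b * fact (card A - b) * (card A choose b) = fact (card A)"
    using b(2) by (rule binomial_fact_lemma)
  finally show ?case .
qed

text \<open>Invariant sets are the unions of orbits, so expanding the product decides for each orbit
  whether it lies in \<open>S\<close> (factor \<open>F\<close>) or in the complement (factor
  \<open>G\<close>).\<close>

lemma sum_over_invariant_sets:
  fixes F G :: "nat set \<Rightarrow> 'a::comm_ring_1"
  assumes "p permutes A" "finite A"
  shows "(\<Sum>S | S \<subseteq> A \<and> p ` S = S. (\<Prod>Q\<in>orbs S p. F Q) * (\<Prod>Q\<in>orbs (A - S) p. G Q))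
     = (\<Prod>Q\<in>orbs A p. F Q + G Q)"
proof -
  have U: "\<Union> (orbs S p) = S" if "p ` S = S" for S
    using Union_orbs[of p S] that by simp
  have pU: "p ` \<Union> X = \<Union> X" if "X \<subseteq> orbs A p" for X
  proof -
    have "p ` Q = Q" if "Q \<in> X" for Q
      using that \<open>X \<subseteq> orbs A p\<close> perm_orbit_image[OF assms] unfolding orbs_def by auto
    thus ?thesis by (simp add: image_Union)
  qed
  have oU: "orbs (\<Union> X) p = X" if X: "X \<subseteq> orbs A p" for X
  proof -
    have "perm_orbit p ` Q = {Q}" if Q: "Q \<in> X" for Q
    proof -
      obtain x where "Q = perm_orbit p x" using Q X unfolding orbs_def by blast
      thus ?thesis using perm_orbit_eq[OF assms] perm_orbit_self by blast
    qed
    thus ?thesis unfolding orbs_def image_Union by auto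
  qed
  have sub: "\<Union> X \<subseteq> A" if "X \<subseteq> orbs A p" for X
    using that orbs_finite_elem(3)[OF assms] by blast
  have bij: "bij_betw (\<lambda>S. orbs S p) {S. S \<subseteq> A \<and> p ` S = S} (Pow (orbs A p))"
  proof (rule bij_betw_byWitness[where f' = Union])
    show "\<forall>S\<in>{S. S \<subseteq> A \<and> p ` S = S}. \<Union> (orbs S p) = S" using U by simp
    show "\<forall>X\<in>Pow (orbs A p). orbs (\<Union> X) p = X" using oU by simp
    show "(\<lambda>S. orbs S p) ` {S. S \<subseteq> A \<and> p ` S = S} \<subseteq> Pow (orbs A p)"
      unfolding orbs_def by blast
    show "Union ` Pow (orbs A p) \<subseteq> {S. S \<subseteq> A \<and> p ` S = S}"
      by (intro image_subsetI CollectI conjI pU sub) simp_all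
  qed
  have "(\<Prod>Q\<in>orbs A p. F Q + G Q) = (\<Sum>X\<in>Pow (orbs A p). prod F X * prod G (orbs A p - X))"
    by (rule prod_add[OF finite_orbs[OF assms(2)]])
  also have "\<dots> = (\<Sum>S | S \<subseteq> A \<and> p ` S = S. prod F (orbs S p) * prod G (orbs A p - orbs S p))"
    using sum.reindex_bij_betw[OF bij, symmetric] by simp
  also have "\<dots> = (\<Sum>S | S \<subseteq> A \<and> p ` S = S. prod F (orbs S p) * prod G (orbs (A - S) p))"
  proof (rule sum.cong[OF refl])
    fix S assume "S \<in> {S. S \<subseteq> A \<and> p ` S = S}"
    hence "orbs A p - orbs S p = orbs (A - S) p"
      using orbs_split[OF assms(1), of S] by blast
    thus "prod F (orbs S p) * prod G (orbs A p - orbs S p) = prod F (orbs S p) * prod G (orbs (A - S) p)"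
      by simp
  qed
  finally show ?thesis by simp
qed

section \<open>Weighted sums over permutations with a prescribed image\<close>

lemma funpow_comp_shift:
  fixes p :: "'b \<Rightarrow> 'c" and r :: "'c \<Rightarrow> 'b"
  shows "((p \<circ> r) ^^ k) (p x) = p (((r \<circ> p) ^^ k) x)"
  by (induction k) auto

lemma orbs_comp_commute:
  assumes "p permutes A"
  shows "orbs A (p \<circ> r) = (`) p ` orbs A (r \<circ> p)"
proof -
  have *: "perm_orbit (p \<circ> r) (p x) = p ` perm_orbit (r \<circ> p) x" for x
    unfolding perm_orbit_def funpow_comp_shift by auto
  have "orbs A (p \<circ> r) = perm_orbit (p \<circ> r) ` (p ` A)"
    unfolding orbs_def permutes_image[OF assms] ..
  also have "\<dots> = (`) p ` orbs A (r \<circ> p)"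
    unfolding orbs_def image_image * ..
  finally show ?thesis .
qed

lemma inj_image_permutes: "p permutes A \<Longrightarrow> inj_on ((`) p) X"
  using permutes_inj[of p A] by (simp add: inj_on_def inj_image_eq_iff)

text \<open>The two products are conjugate by \<open>p\<close>, which carries the orbits of one to
  those of the other.\<close>

lemma cyc_comp_commute:
  assumes "p permutes A"
  shows "cyc A (p \<circ> r) = cyc A (r \<circ> p)"
  unfolding cyc_def orbs_comp_commute[OF assms]
  by (rule card_image[OF inj_image_permutes[OF assms]])

lemma cyc_mult_sign_invariant:
  assumes "p permutes A" "r permutes A" "finite A" "S \<subseteq> A" "p ` S = S" "r ` S = S"
  shows "(-1) ^ cyc S (p \<circ> r) = (-1 :: int) ^ (card S + cyc S p + cyc S r)"
proof -
  let ?p = "perm_restrict p S" and ?r = "perm_restrict r S"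
  have "finite S" using assms finite_subset by blast
  have "cyc S (p \<circ> r) = cyc S (?p \<circ> ?r)"
    by (rule cyc_cong) (use assms(5,6) in \<open>auto simp: perm_restrict_def\<close>)
  moreover have "cyc S p = cyc S ?p" "cyc S r = cyc S ?r"
    by (rule cyc_cong; use assms(5,6) in \<open>auto simp: perm_restrict_def\<close>)+
  ultimately show ?thesis
    using cyc_mult_sign[OF perm_restrict_permutes[OF assms(1,3,4,5)] perm_restrict_permutes[OF assms(2,3,4,6)] \<open>finite S\<close>]
    by simp
qed

lemma cyc_transpose_parity_invariant:
  assumes "p permutes A" "finite A" "S \<subseteq> A" "p ` S = S" "a \<in> S" "b \<in> S" "a \<noteq> b"
  shows "(-1) ^ cyc S (transpose a b \<circ> p) = - ((-1 :: int) ^ cyc S p)"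
proof -
  let ?p = "perm_restrict p S"
  have "finite S" using assms finite_subset by blast
  have t: "transpose a b ` S = S" using assms(5,6) permutes_image[OF permutes_swap_id] by metis
  have "cyc S (transpose a b \<circ> p) = cyc S (transpose a b \<circ> ?p)"
  proof (rule cyc_cong)
    show "(transpose a b \<circ> p) ` S \<subseteq> S" using t assms(4) by (metis image_comp order_refl)
  qed (auto simp: perm_restrict_def)
  moreover have "cyc S p = cyc S ?p"
    by (rule cyc_cong; use assms(4) in \<open>auto simp: perm_restrict_def\<close>)
  ultimately show ?thesis
    using cyc_transpose_parity[OF perm_restrict_permutes[OF assms(1-4)] \<open>finite S\<close> assms(7,5,6), where ?'a = int]
    by simp
qed

text \<open>The cycle generating function of the permutations preserving a \<open>k\<close>-subset,
  signed on that subset. The sign replaces \<open>x\<close> by \<open>- x\<close> there, which turns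
  the rising factorial into a falling one; the complement keeps the rising factorial.\<close>

definition qprod :: "nat \<Rightarrow> nat \<Rightarrow> 'a::comm_ring_1 \<Rightarrow> 'a" where
  "qprod d k x = (\<Prod>j<k. x - of_nat j) * (\<Prod>j<d - k. x + of_nat j)"

text \<open>The eigenvalue of \<open>\<Sum>p. x ^ cyc p * p\<close> at the \<open>k\<close>-th hook.\<close>

definition rprod :: "nat \<Rightarrow> nat \<Rightarrow> 'a::comm_ring_1 \<Rightarrow> 'a" where
  "rprod d k x = (\<Prod>j<d. x + of_nat j - of_nat k)"

lemma rprod_split:
  assumes "k \<le> d"
  shows "rprod d k x = (\<Prod>i<k. x - of_nat (Suc i)) * (\<Prod>j<d - k. x + of_nat j)"
proof -
  have "rprod d k x = (\<Prod>j<k. x + of_nat j - of_nat k) * (\<Prod>j=k..<d. x + of_nat j - of_nat k)"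
    unfolding rprod_def using assms
    by (subst prod.union_disjoint[symmetric]) (auto intro: prod.cong)
  also have "(\<Prod>j=k..<d. x + of_nat j - of_nat k) = (\<Prod>j<d - k. x + of_nat j)"
    by (rule prod.reindex_bij_witness[of _ "\<lambda>j. j + k" "\<lambda>j. j - k"]) (auto simp: of_nat_diff)
  also have "(\<Prod>j<k. x + of_nat j - of_nat k) = (\<Prod>j<k. x - of_nat (Suc (k - Suc j)))"
    by (intro prod.cong refl) (auto simp: of_nat_diff Suc_diff_Suc)
  also have "\<dots> = (\<Prod>i<k. x - of_nat (Suc i))"
    by (rule prod.nat_diff_reindex)
  finally show ?thesis .
qed

lemma mult_prod_shift:
  fixes x :: "'a::comm_ring_1"
  shows "x * (\<Prod>i<k. x - of_nat (Suc i)) = (\<Prod>i<k. x - of_nat i) * (x - of_nat k)"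
proof -
  have "x * (\<Prod>i<k. x - of_nat (Suc i)) = (\<Prod>i<Suc k. x - of_nat i)"
    by (simp only: prod.lessThan_Suc_shift) simp
  thus ?thesis by simp
qed

text \<open>Together with \<open>rprod_conv_qprod_Suc\<close> this relates \<open>qprod\<close> at
  one index to \<open>rprod\<close> at that index and at the preceding one, which is what an
  induction over partial sums requires. Multiplying by \<open>x\<close> keeps the identity inside
  the ring.\<close>

lemma rprod_conv_qprod:
  assumes "k \<le> d"
  shows "x * rprod d k x = (x - of_nat k) * qprod d k x"
  unfolding rprod_split[OF assms] mult.assoc[symmetric] mult_prod_shift qprod_def
  by (simp only: mult_ac)

lemma rprod_conv_qprod_Suc:
  assumes "Suc k \<le> d"
  shows "x * rprod d k x = (x + of_nat d - of_nat (Suc k)) * qprod d (Suc k) x"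
proof -
  have d: "d - k = Suc (d - Suc k)" using assms by simp
  have "x * rprod d k x = (\<Prod>i<k. x - of_nat i) * (x - of_nat k) * (\<Prod>j<d - k. x + of_nat j)"
    using assms by (simp only: rprod_split[of k d] Suc_leD mult.assoc[symmetric] mult_prod_shift)
  also have "\<dots> = (\<Prod>i<Suc k. x - of_nat i) * ((\<Prod>j<d - Suc k. x + of_nat j) * (x + of_nat (d - Suc k)))"
    unfolding d by simp
  also have "of_nat (d - Suc k) = of_nat d - (of_nat (Suc k) :: 'a)" using assms by (simp add: of_nat_diff)
  finally show ?thesis unfolding qprod_def by (simp add: algebra_simps)
qed

text \<open>On \<open>S\<close> the sign of \<open>p \<circ> s\<close> is the product of the two
  signs. The part of \<open>s\<close> factors out, and the remaining sum splits into independent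
  sums over \<open>S\<close> and \<open>A - S\<close>.\<close>

lemma sum_invariant_perms:
  fixes x :: "'a::comm_ring_1"
  assumes "s permutes A" "finite A" "S \<subseteq> A" "s ` S = S"
  shows "(\<Sum>p | p permutes A \<and> p ` S = S. x ^ cyc A p * of_int ((-1) ^ cyc S (p \<circ> s)))
     = qprod (card A) (card S) x * of_int ((-1) ^ cyc S s)"
proof -
  have fS: "finite S" using assms finite_subset by blast
  have "(\<Sum>p | p permutes A \<and> p ` S = S. x ^ cyc A p * of_int ((-1) ^ cyc S (p \<circ> s)))
    = (\<Sum>p | p permutes S. \<Sum>r | r permutes A - S.
        x ^ cyc A (p \<circ> r) * of_int ((-1) ^ cyc S (p \<circ> r \<circ> s)))"
    by (rule sum_permutes_split[OF assms(2,3)])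
  also have "\<dots> = (\<Sum>p | p permutes S. \<Sum>r | r permutes A - S.
        (-1) ^ (card S + cyc S s) * ((- x) ^ cyc S p * x ^ cyc (A - S) r))"
  proof (intro sum.cong refl)
    fix p r assume "p \<in> {p. p permutes S}" "r \<in> {r. r permutes A - S}"
    hence pr: "p permutes S" "r permutes A - S" by auto
    note c = permutes_comp_disjoint[OF pr assms(3)] orbs_comp_disjoint[OF pr assms(3)]
    have e: "cyc S (p \<circ> r) = cyc S p" "cyc (A - S) (p \<circ> r) = cyc (A - S) r"
      using c(5,6) by (simp_all add: cyc_def)
    have 1: "cyc A (p \<circ> r) = cyc S p + cyc (A - S) r"
      using cyc_split[OF c(1) assms(2,3) c(2)] e by simp
    have 2: "(-1) ^ cyc S (p \<circ> r \<circ> s) = (-1 :: int) ^ (card S + cyc S p + cyc S s)"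
      using cyc_mult_sign_invariant[OF c(1) assms(1,2,3) c(2) assms(4)] e by simp
    show "x ^ cyc A (p \<circ> r) * of_int ((-1) ^ cyc S (p \<circ> r \<circ> s)) =
      (-1) ^ (card S + cyc S s) * ((- x) ^ cyc S p * x ^ cyc (A - S) r)"
      unfolding 1 2 by (simp add: power_add power_minus[of x] mult_ac)
  qed
  also have "\<dots> = (-1) ^ (card S + cyc S s) * ((\<Sum>p | p permutes S. (- x) ^ cyc S p) * (\<Sum>r | r permutes A - S. x ^ cyc (A - S) r))"
    by (subst sum_product) (simp only: sum_distrib_left)
  also have "(\<Sum>p | p permutes S. (- x) ^ cyc S p) = (\<Prod>j<card S. - (x - of_nat j))"
    by (subst sum_power_cyc[OF fS]) (simp add: algebra_simps)
  also have "\<dots> = (-1) ^ card S * (\<Prod>j<card S. x - of_nat j)"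
    by (simp only: prod_uminus card_lessThan)
  also have "(\<Sum>r | r permutes A - S. x ^ cyc (A - S) r) = (\<Prod>j<card A - card S. x + of_nat j)"
    using assms by (subst sum_power_cyc) (simp_all add: card_Diff_subset fS)
  also have "(-1) ^ (card S + cyc S s) * ((-1) ^ card S * (\<Prod>j<card S. x - of_nat j) * (\<Prod>j<card A - card S. x + of_nat j))
     = ((-1) ^ card S * (-1) ^ card S) * ((-1) ^ cyc S s * qprod (card A) (card S) x)"
    unfolding qprod_def by (simp only: power_add mult_ac)
  also have "((-1) ^ card S * (-1) ^ card S) = (1 :: 'a)" by (simp flip: power_mult_distrib)
  finally show ?thesis by (simp add: mult_ac comp_def)
qed

text \<open>Substituting \<open>p \<circ> transpose a b\<close> for \<open>p\<close> replaces
  \<open>s\<close> by \<open>transpose a b \<circ> s\<close>, which preserves \<open>S\<close>, and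
  so reduces to \<open>sum_invariant_perms\<close>.\<close>

lemma sum_moved_perms:
  fixes x :: "'a::comm_ring_1"
  assumes "s permutes A" "finite A" "S \<subseteq> A" "a \<in> S" "b \<in> A - S" "(transpose a b \<circ> s) ` S = S"
  shows "x * (\<Sum>p | p permutes A \<and> p ` s ` S = S. x ^ cyc A p * of_int ((-1) ^ cyc S (p \<circ> s)))
     = qprod (card A) (card S) x * of_int ((-1) ^ cyc S (transpose a b \<circ> s))"
proof -
  let ?t = "transpose a b"
  have tA: "?t permutes A" using assms by (intro permutes_swap_id) auto
  have sS: "?t ` S = s ` S"
  proof -
    have "?t ` S = ?t ` (?t \<circ> s) ` S" using assms(6) by simp
    also have "\<dots> = s ` S" by (simp add: image_comp o_assoc)
    finally show ?thesis .
  qed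
  have tp: "?t \<circ> s permutes A" using assms(1) tA by (rule permutes_compose)
  have "(\<Sum>p | p permutes A \<and> p ` s ` S = S. x ^ cyc A p * of_int ((-1) ^ cyc S (p \<circ> s)))
    = (\<Sum>p | p permutes A \<and> p ` S = S. x ^ cyc A (p \<circ> ?t) * of_int ((-1) ^ cyc S (p \<circ> (?t \<circ> s))))"
  proof (rule sum.reindex_bij_witness[of _ "\<lambda>p. p \<circ> ?t" "\<lambda>p. p \<circ> ?t"])
    fix p assume p: "p \<in> {p. p permutes A \<and> p ` s ` S = S}"
    show "(p \<circ> ?t) \<circ> ?t = p" by (simp add: fun_eq_iff)
    have "(p \<circ> ?t) ` S = p ` ?t ` S" by (simp only: image_comp)
    thus "p \<circ> ?t \<in> {p. p permutes A \<and> p ` S = S}"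
      using p permutes_compose[OF tA, of p] sS by simp
    show "x ^ cyc A ((p \<circ> ?t) \<circ> ?t) * of_int ((-1) ^ cyc S ((p \<circ> ?t) \<circ> (?t \<circ> s))) =
       x ^ cyc A p * of_int ((-1) ^ cyc S (p \<circ> s))"
      by (simp add: comp_def)
  next
    fix p assume p: "p \<in> {p. p permutes A \<and> p ` S = S}"
    show "(p \<circ> ?t) \<circ> ?t = p" by (simp add: fun_eq_iff)
    have "(p \<circ> ?t) ` s ` S = p ` ?t ` ?t ` S" unfolding sS by (simp add: image_comp)
    also have "\<dots> = p ` S" by (simp add: image_comp)
    finally show "p \<circ> ?t \<in> {p. p permutes A \<and> p ` s ` S = S}"
      using p permutes_compose[OF tA, of p] by auto
  qed
  hence "x * (\<Sum>p | p permutes A \<and> p ` s ` S = S. x ^ cyc A p * of_int ((-1) ^ cyc S (p \<circ> s)))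
     = (\<Sum>p | p permutes A \<and> p ` S = S. x ^ Suc (cyc A (p \<circ> ?t)) * of_int ((-1) ^ cyc S (p \<circ> (?t \<circ> s))))"
    by (simp add: sum_distrib_left mult.assoc)
  also have "\<dots> = (\<Sum>p | p permutes A \<and> p ` S = S. x ^ cyc A p * of_int ((-1) ^ cyc S (p \<circ> (?t \<circ> s))))"
  proof (rule sum.cong[OF refl])
    fix p assume "p \<in> {p. p permutes A \<and> p ` S = S}"
    hence p: "p permutes A" "p ` S = S" by auto
    \<comment> \<open>The \<open>p\<close>-invariant set \<open>S\<close> separates \<open>a\<close>
      from \<open>b\<close>, so the transposition joins two orbits of \<open>p\<close>. The cycle
      lost in this way is paid for by the extra factor \<open>x\<close>.\<close>
    have "b \<notin> perm_orbit p a" using invariant_if_meets_orbit[OF p(1) assms(2) p(2) assms(4)] assms(5) by blast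
    hence "perm_orbit p a \<noteq> perm_orbit p b" using perm_orbit_self[of b p] by blast
    hence "Suc (cyc A (?t \<circ> p)) = cyc A p" using assms by (intro cyc_join[OF p(1)]) auto
    hence "Suc (cyc A (p \<circ> ?t)) = cyc A p" using cyc_comp_commute[OF p(1), of ?t] by simp
    thus "x ^ Suc (cyc A (p \<circ> ?t)) * of_int ((-1) ^ cyc S (p \<circ> (?t \<circ> s)))
      = x ^ cyc A p * of_int ((-1) ^ cyc S (p \<circ> (?t \<circ> s)))" by simp
  qed
  also have "\<dots> = qprod (card A) (card S) x * of_int ((-1) ^ cyc S (?t \<circ> s))"
    by (rule sum_invariant_perms[OF tp assms(2,3,6)])
  finally show ?thesis .
qed

text \<open>Conjugation by \<open>transpose a b\<close> is a sign-reversing involution.\<close>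

lemma sum_far_perms:
  fixes x :: "'a::{idom,ring_char_0}"
  assumes "s permutes A" "finite A" "S \<subseteq> A" "a \<in> S - s ` S" "b \<in> S - s ` S" "a \<noteq> b"
  shows "(\<Sum>p | p permutes A \<and> p ` s ` S = S. x ^ cyc A p * of_int ((-1) ^ cyc S (p \<circ> s))) = 0"
    (is "sum ?f ?X = 0")
proof -
  let ?t = "transpose a b"
  have tA: "?t permutes A" using assms by (intro permutes_swap_id) auto
  have tS: "?t ` S = S" using assms(4,5) permutes_image[OF permutes_swap_id] by (metis DiffD1)
  have tT: "?t y = y" if "y \<in> s ` S" for y
    using that assms(4,5) by (intro transpose_apply_other) auto
  hence tT': "?t ` s ` S = s ` S" by simp
  have t2: "?t \<circ> (?t \<circ> p \<circ> ?t) \<circ> ?t = p" for p :: "nat \<Rightarrow> nat" by (simp add: fun_eq_iff)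
  have mem: "?t \<circ> p \<circ> ?t \<in> ?X" if "p \<in> ?X" for p
  proof -
    have p: "p permutes A" "p ` s ` S = S" using that by auto
    have "?t \<circ> p \<circ> ?t permutes A" by (intro permutes_compose tA p)
    moreover have "(?t \<circ> p \<circ> ?t) ` s ` S = ?t ` p ` ?t ` s ` S" by (simp only: image_comp o_assoc)
    ultimately show ?thesis using tT' tS p(2) by simp
  qed
  have "sum ?f ?X = (\<Sum>p\<in>?X. - ?f p)"
  proof (rule sum.reindex_bij_witness[of _ "\<lambda>p. ?t \<circ> p \<circ> ?t" "\<lambda>p. ?t \<circ> p \<circ> ?t"])
    fix p assume p: "p \<in> ?X"
    hence pp: "p permutes A" "p ` s ` S = S" by auto
    have "cyc A (?t \<circ> p \<circ> ?t) = cyc A (?t \<circ> (?t \<circ> p))"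
      using cyc_comp_commute[OF tA, of "?t \<circ> p"] by (simp only:)
    also have "?t \<circ> (?t \<circ> p) = p" by (simp add: fun_eq_iff)
    finally have 1: "cyc A (?t \<circ> p \<circ> ?t) = cyc A p" .
    have psS: "(p \<circ> s) ` S = S" using pp(2) by (simp add: image_comp)
    have "cyc S (?t \<circ> p \<circ> ?t \<circ> s) = cyc S (?t \<circ> (p \<circ> s))"
    proof (rule cyc_cong)
      fix y assume "y \<in> S"
      hence "?t (s y) = s y" using tT by blast
      thus "(?t \<circ> p \<circ> ?t \<circ> s) y = (?t \<circ> (p \<circ> s)) y" by simp
    next
      have "(?t \<circ> p \<circ> ?t \<circ> s) ` S = (?t \<circ> p \<circ> ?t) ` s ` S" by (simp only: image_comp)
      thus "(?t \<circ> p \<circ> ?t \<circ> s) ` S \<subseteq> S" using mem[OF p] by simp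
    qed
    hence "(-1 :: int) ^ cyc S (?t \<circ> p \<circ> ?t \<circ> s) = - ((-1) ^ cyc S (p \<circ> s))"
      using cyc_transpose_parity_invariant[OF permutes_compose[OF assms(1) pp(1)] assms(2,3) psS] assms(4-6)
      by simp
    thus "- ?f (?t \<circ> p \<circ> ?t) = ?f p" unfolding 1 by simp
  qed (use mem t2 in auto)
  hence "sum ?f ?X = - sum ?f ?X" by (simp only: sum_negf)
  hence "2 * sum ?f ?X = 0" by (simp add: eq_neg_iff_add_eq_0)
  thus ?thesis by simp
qed

text \<open>Up to the factor \<open>(-1) ^ k\<close> this is the trace of \<open>s\<close> on the
  \<open>k\<close>-th exterior power of the permutation representation: the sign of \<open>s\<close>
  on an invariant \<open>S\<close> is \<open>(-1) ^ (card S + cyc S s)\<close>.\<close>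

definition pcoef :: "nat set \<Rightarrow> (nat \<Rightarrow> nat) \<Rightarrow> nat \<Rightarrow> int" where
  "pcoef A s k = (\<Sum>S | S \<subseteq> A \<and> s ` S = S \<and> card S = k. (-1) ^ cyc S s)"

text \<open>These are the subsets \<open>S\<close> with \<open>s ` S = insert b (S - {a})\<close>, the only ones besides the invariant
  subsets whose contribution does not cancel.\<close>

definition wcoef :: "nat set \<Rightarrow> (nat \<Rightarrow> nat) \<Rightarrow> nat \<Rightarrow> int" where
  "wcoef A s k = (\<Sum>a\<in>A. \<Sum>b\<in>A. \<Sum>S | S \<subseteq> A \<and> (a \<in> S \<and> b \<notin> S \<and> (transpose a b \<circ> s) ` S = S) \<and> card S = k.
     (-1) ^ cyc S (transpose a b \<circ> s))"

lemma transpose_image_eq: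
  assumes "a \<in> S" "b \<notin> S"
  shows "transpose a b ` S = insert b (S - {a})"
  using assms by (auto simp: transpose_def image_iff)

lemma sum_perms_fixed_image:
  fixes x :: "'a::{idom,ring_char_0}"
  assumes "s permutes A" "finite A" "S \<subseteq> A"
  shows "x * (\<Sum>p | p permutes A \<and> p ` s ` S = S. x ^ cyc A p * of_int ((-1) ^ cyc S (p \<circ> s)))
    = qprod (card A) (card S) x * (x * of_int (if s ` S = S then (-1) ^ cyc S s else 0)
       + of_int (\<Sum>a\<in>A. \<Sum>b\<in>A. if a \<in> S \<and> b \<notin> S \<and> (transpose a b \<circ> s) ` S = S
           then (-1) ^ cyc S (transpose a b \<circ> s) else 0))"
    (is "x * ?Z = _ * (_ + of_int (\<Sum>a\<in>A. \<Sum>b\<in>A. if ?C a b then ?e a b else 0))")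
proof -
  have fS: "finite S" using assms finite_subset by blast
  have sA: "s ` S \<subseteq> A" using permutes_image[OF assms(1)] assms(3) by blast
  have im: "s ` S = insert b (S - {a})" if "?C a b" for a b
  proof -
    have "s ` S = transpose a b ` (transpose a b \<circ> s) ` S" by (simp add: image_comp o_assoc)
    also have "\<dots> = insert b (S - {a})" using transpose_image_eq[of a S b] that by simp
    finally show ?thesis .
  qed
  consider (same) "s ` S = S" | (one) a b where "a \<in> A" "b \<in> A" "?C a b" |
    (far) "s ` S \<noteq> S" "\<forall>a\<in>A. \<forall>b\<in>A. \<not> ?C a b" by blast
  thus ?thesis
  proof cases
    case same
    have nC: "\<not> ?C a b" for a b
    proof
      assume C: "?C a b"
      hence "b \<in> s ` S" using im[OF C] by simp
      thus False using C same by simp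
    qed
    have e: "(\<Sum>c\<in>A. \<Sum>d\<in>A. if ?C c d then ?e c d else 0) = 0"
      by (simp only: nC if_False sum.neutral_const)
    show ?thesis unfolding e using sum_invariant_perms[OF assms same, of x] same
      by (simp add: mult_ac)
  next
    case one
    \<comment> \<open>\<open>a\<close> and \<open>b\<close> can be recovered as the only elements of
      \<open>S - s\<close> S\<open>and\<close>s \<open>S - S\<close>, so the double sum has a single
      nonzero term.\<close>
    have uniq: "?C c d \<longleftrightarrow> c = a \<and> d = b" for c d
    proof
      assume C: "?C c d"
      have "S - s ` S = {a}" "s ` S - S = {b}" using im[OF one(3)] one(3) by auto
      moreover have "S - s ` S = {c}" "s ` S - S = {d}" using im[OF C] C by auto
      ultimately show "c = a \<and> d = b" by simp
    qed (use one in simp)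
    have "b \<in> s ` S" "b \<notin> S" using im[OF one(3)] one(3) by auto
    hence ns: "s ` S \<noteq> S" by metis
    have "(\<Sum>c\<in>A. \<Sum>d\<in>A. if ?C c d then ?e c d else 0) = (\<Sum>c\<in>A. if c = a then (\<Sum>d\<in>A. if d = b then ?e a b else 0) else 0)"
      unfolding uniq by (intro sum.cong refl) (auto intro!: sum.cong)
    also have "\<dots> = ?e a b" using one(1,2) assms(2) by simp
    finally have e: "(\<Sum>c\<in>A. \<Sum>d\<in>A. if ?C c d then ?e c d else 0) = ?e a b" .
    show ?thesis unfolding e
      using sum_moved_perms[OF assms, of a b x] one ns by simp
  next
    case far
    have cc: "card (s ` S) = card S"
      using card_image[OF inj_on_subset[OF permutes_inj[OF assms(1)]]] by simp
    have cd: "card (S - s ` S) = card (s ` S - S)"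
      using card_le_sym_Diff[of S "s ` S"] card_le_sym_Diff[of "s ` S" S] fS cc by simp
    have "card (S - s ` S) \<noteq> 0"
    proof
      assume "card (S - s ` S) = 0"
      hence "S \<subseteq> s ` S" using fS by simp
      thus False using card_subset_eq[of "s ` S" S] fS cc far(1) by simp
    qed
    moreover have "card (S - s ` S) \<noteq> 1"
    proof
      assume c1: "card (S - s ` S) = 1"
      then obtain a where a: "S - s ` S = {a}" by (meson card_1_singletonE)
      from c1 obtain b where b: "s ` S - S = {b}" using cd by (metis card_1_singletonE)
      have ab: "a \<in> S" "b \<notin> S" "a \<in> A" "b \<in> A" using a b assms(3) sA by blast+
      have "s ` S = insert b (S - {a})" using a b by blast
      also have "\<dots> = transpose a b ` S" using transpose_image_eq[OF ab(1,2)] by simp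
      finally have "(transpose a b \<circ> s) ` S = transpose a b ` transpose a b ` S"
        by (metis image_comp)
      hence "(transpose a b \<circ> s) ` S = S" by (simp add: image_comp)
      thus False using far(2) ab by blast
    qed
    ultimately have "card (S - s ` S) \<ge> 2" by simp
    then obtain a b where ab: "a \<in> S - s ` S" "b \<in> S - s ` S" "a \<noteq> b"
      by (metis card_le_Suc0_iff_eq fS finite_Diff not_less_eq_eq numeral_2_eq_2)
    have e: "(\<Sum>c\<in>A. \<Sum>d\<in>A. if ?C c d then ?e c d else 0) = 0"
      by (intro sum.neutral ballI) (use far(2) in auto)
    show ?thesis unfolding e sum_far_perms[OF assms ab] using far(1) by simp
  qed
qed

lemma sum_perms_pcoef:
  fixes x :: "'a::{idom,ring_char_0}"
  assumes "s permutes A" "finite A"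
  shows "x * (\<Sum>p | p permutes A. x ^ cyc A p * of_int (pcoef A (p \<circ> s) k))
    = qprod (card A) k x * (x * of_int (pcoef A s k) + of_int (wcoef A s k))"
proof -
  let ?B = "{S. S \<subseteq> A \<and> card S = k}"
  let ?P = "{p. p permutes A}"
  let ?C = "\<lambda>S a b. a \<in> S \<and> b \<notin> S \<and> (transpose a b \<circ> s) ` S = S"
  have fB: "finite ?B" using assms(2) by simp
  have fP: "finite ?P" using finite_permutations[OF assms(2)] .
  have "(\<Sum>p\<in>?P. x ^ cyc A p * of_int (pcoef A (p \<circ> s) k))
     = (\<Sum>p\<in>?P. \<Sum>S | S \<in> ?B \<and> (p \<circ> s) ` S = S. x ^ cyc A p * of_int ((-1) ^ cyc S (p \<circ> s)))"
    unfolding pcoef_def of_int_sum sum_distrib_left by (intro sum.cong) auto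
  also have "\<dots> = (\<Sum>S\<in>?B. \<Sum>p | p \<in> ?P \<and> (p \<circ> s) ` S = S. x ^ cyc A p * of_int ((-1) ^ cyc S (p \<circ> s)))"
    by (rule sum.swap_restrict[OF fP fB])
  also have "\<dots> = (\<Sum>S\<in>?B. \<Sum>p | p permutes A \<and> p ` s ` S = S. x ^ cyc A p * of_int ((-1) ^ cyc S (p \<circ> s)))"
    by (simp only: image_comp mem_Collect_eq)
  finally have "x * (\<Sum>p\<in>?P. x ^ cyc A p * of_int (pcoef A (p \<circ> s) k)) =
     (\<Sum>S\<in>?B. x * (\<Sum>p | p permutes A \<and> p ` s ` S = S. x ^ cyc A p * of_int ((-1) ^ cyc S (p \<circ> s))))"
    by (simp only: sum_distrib_left)
  also have "\<dots> = (\<Sum>S\<in>?B. qprod (card A) k x * (x * of_int (if s ` S = S then (-1) ^ cyc S s else 0)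
       + of_int (\<Sum>a\<in>A. \<Sum>b\<in>A. if ?C S a b then (-1) ^ cyc S (transpose a b \<circ> s) else 0)))"
  proof (rule sum.cong[OF refl])
    fix S assume "S \<in> ?B"
    hence S: "S \<subseteq> A" "card S = k" by auto
    show "x * (\<Sum>p | p permutes A \<and> p ` s ` S = S. x ^ cyc A p * of_int ((-1) ^ cyc S (p \<circ> s)))
      = qprod (card A) k x * (x * of_int (if s ` S = S then (-1) ^ cyc S s else 0)
       + of_int (\<Sum>a\<in>A. \<Sum>b\<in>A. if ?C S a b then (-1) ^ cyc S (transpose a b \<circ> s) else 0))"
      using sum_perms_fixed_image[OF assms S(1), of x] unfolding S(2) .
  qed
  also have "\<dots> = qprod (card A) k x * (x * of_int (\<Sum>S\<in>?B. if s ` S = S then (-1) ^ cyc S s else 0)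
       + of_int (\<Sum>S\<in>?B. \<Sum>a\<in>A. \<Sum>b\<in>A. if ?C S a b then (-1) ^ cyc S (transpose a b \<circ> s) else 0))"
    by (simp only: sum_distrib_left sum.distrib of_int_sum distrib_left)
  also have "(\<Sum>S\<in>?B. if s ` S = S then (-1) ^ cyc S s else 0) = pcoef A s k"
    unfolding pcoef_def using fB by (subst sum.inter_filter[symmetric]) (auto intro!: sum.cong)
  also have "(\<Sum>S\<in>?B. \<Sum>a\<in>A. \<Sum>b\<in>A. if ?C S a b then (-1) ^ cyc S (transpose a b \<circ> s) else 0)
     = (\<Sum>a\<in>A. \<Sum>b\<in>A. \<Sum>S\<in>?B. if ?C S a b then (-1 :: int) ^ cyc S (transpose a b \<circ> s) else 0)"
    by (subst sum.swap, rule sum.cong[OF refl], rule sum.swap)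
  also have "\<dots> = wcoef A s k"
    unfolding wcoef_def
  proof (rule sum.cong[OF refl], rule sum.cong[OF refl])
    fix a b
    show "(\<Sum>S\<in>?B. if ?C S a b then (-1 :: int) ^ cyc S (transpose a b \<circ> s) else 0)
     = (\<Sum>S | S \<subseteq> A \<and> ?C S a b \<and> card S = k. (-1) ^ cyc S (transpose a b \<circ> s))"
      using fB by (subst sum.inter_filter[symmetric]) (auto intro!: sum.cong)
  qed
  finally show ?thesis .
qed

section \<open>Eigenfunctions of the cycle-counting class sums\<close>

definition cyc_poly :: "nat set \<Rightarrow> (nat \<Rightarrow> nat) \<Rightarrow> int poly" where
  "cyc_poly A s = (\<Prod>Q\<in>orbs A s. 1 - monom 1 (card Q))"

lemma prod_monom_one: "(\<Prod>i\<in>I. monom (1::'b::comm_ring_1) (f i)) = monom 1 (\<Sum>i\<in>I. f i)"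
  by (induction I rule: infinite_finite_induct) (auto simp: mult_monom)

lemma prod_orbs_monom:
  assumes "s permutes A" "finite A" "S \<subseteq> A" "s ` S = S"
  shows "(\<Prod>Q\<in>orbs S s. - monom 1 (card Q)) = monom ((-1 :: int) ^ cyc S s) (card S)"
proof -
  have "(\<Prod>Q\<in>orbs S s. - monom 1 (card Q)) = (-1) ^ cyc S s * monom (1 :: int) (card S)"
    unfolding prod_uminus prod_monom_one cyc_def using sum_card_orbs[OF assms(1,2) _ assms(3)] assms(4) by simp
  also have "(-1 :: int poly) ^ cyc S s = monom ((-1) ^ cyc S s) 0"
    by (simp only: minus_one_power_iff) (simp add: monom_0 one_pCons)
  finally show ?thesis by (simp add: mult_monom)
qed

lemma cyc_poly_conv_sum:
  assumes "s permutes A" "finite A"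
  shows "cyc_poly A s = (\<Sum>S | S \<subseteq> A \<and> s ` S = S. monom ((-1) ^ cyc S s) (card S))"
proof -
  have "cyc_poly A s = (\<Prod>Q\<in>orbs A s. - monom 1 (card Q) + 1)" by (simp add: cyc_poly_def)
  also have "\<dots> = (\<Sum>S | S \<subseteq> A \<and> s ` S = S. (\<Prod>Q\<in>orbs S s. - monom 1 (card Q)) * (\<Prod>Q\<in>orbs (A - S) s. 1))"
    by (rule sum_over_invariant_sets[OF assms, symmetric])
  also have "\<dots> = (\<Sum>S | S \<subseteq> A \<and> s ` S = S. monom ((-1) ^ cyc S s) (card S))"
    by (intro sum.cong refl) (simp add: prod_orbs_monom[OF assms])
  finally show ?thesis .
qed

lemma coeff_sum_monom_card:
  assumes "finite A"
  shows "coeff (\<Sum>S | S \<subseteq> A \<and> R S. monom (f S) (card S)) k = (\<Sum>S | S \<subseteq> A \<and> R S \<and> card S = k. f S)"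
proof -
  have fin: "finite {S. S \<subseteq> A \<and> R S}" using assms by (rule finite_subset[rotated, OF finite_Pow_iff[THEN iffD2]]) auto
  have "coeff (\<Sum>S | S \<subseteq> A \<and> R S. monom (f S) (card S)) k = (\<Sum>S | S \<subseteq> A \<and> R S. if card S = k then f S else 0)"
    by (simp add: coeff_sum coeff_monom)
  also have "\<dots> = (\<Sum>S\<in>{S \<in> {S. S \<subseteq> A \<and> R S}. card S = k}. f S)"
    by (rule sum.inter_filter[OF fin, symmetric])
  also have "{S \<in> {S. S \<subseteq> A \<and> R S}. card S = k} = {S. S \<subseteq> A \<and> R S \<and> card S = k}" by auto
  finally show ?thesis .
qed

lemma coeff_cyc_poly:
  assumes "s permutes A" "finite A"
  shows "coeff (cyc_poly A s) k = pcoef A s k"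
  unfolding cyc_poly_conv_sum[OF assms] pcoef_def by (rule coeff_sum_monom_card[OF assms(2)])

section \<open>The error term as a polynomial in \<open>y\<close>\<close>

definition w_poly :: "nat set \<Rightarrow> (nat \<Rightarrow> nat) \<Rightarrow> int poly" where
  "w_poly A s = (\<Sum>a\<in>A. \<Sum>b\<in>A. \<Sum>S | S \<subseteq> A \<and> (a \<in> S \<and> b \<notin> S \<and> (transpose a b \<circ> s) ` S = S).
     monom ((-1) ^ cyc S (transpose a b \<circ> s)) (card S))"

lemma coeff_w_poly:
  assumes "finite A"
  shows "coeff (w_poly A s) k = wcoef A s k"
  unfolding w_poly_def wcoef_def by (simp only: coeff_sum[where A = A] coeff_sum_monom_card[OF assms])

text \<open>The membership conditions become zero weights: an orbit through \<open>b\<close> may not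
  be chosen for \<open>S\<close>, and an orbit through \<open>a\<close> may not be left out. This
  brings the sum under \<open>sum_over_invariant_sets\<close>.\<close>

lemma separated_sum:
  assumes "r permutes A" "finite A" "a \<in> A" "b \<in> A"
  shows "(\<Sum>S | S \<subseteq> A \<and> (a \<in> S \<and> b \<notin> S \<and> r ` S = S). monom ((-1) ^ cyc S r) (card S))
    = (\<Prod>Q\<in>orbs A r. (if b \<in> Q then 0 else - monom (1::int) (card Q)) + (if a \<in> Q then 0 else 1))"
proof -
  let ?F = "\<lambda>Q. if b \<in> Q then 0 else - monom (1::int) (card Q)"
  let ?G = "\<lambda>Q. if a \<in> Q then 0 else 1 :: int poly"
  have fin: "finite {S. S \<subseteq> A \<and> r ` S = S}" using assms(2) by (rule finite_subset[rotated, OF finite_Pow_iff[THEN iffD2]]) auto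
  have "(\<Prod>Q\<in>orbs A r. ?F Q + ?G Q) = (\<Sum>S | S \<subseteq> A \<and> r ` S = S. (\<Prod>Q\<in>orbs S r. ?F Q) * (\<Prod>Q\<in>orbs (A - S) r. ?G Q))"
    by (rule sum_over_invariant_sets[OF assms(1,2), symmetric])
  also have "\<dots> = (\<Sum>S | S \<subseteq> A \<and> r ` S = S. if a \<in> S \<and> b \<notin> S then monom ((-1) ^ cyc S r) (card S) else 0)"
  proof (rule sum.cong[OF refl])
    fix S assume "S \<in> {S. S \<subseteq> A \<and> r ` S = S}"
    hence S: "S \<subseteq> A" "r ` S = S" by auto
    have fS: "finite S" using S assms(2) finite_subset by blast
    have U: "\<Union> (orbs S r) = S" "\<Union> (orbs (A - S) r) = A - S"
      using Union_orbs[of r S] Union_orbs[of r "A - S"] invariant_Diff[OF assms(1) S(2)] S(2) by simp_all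
    have "(\<Prod>Q\<in>orbs S r. ?F Q) = (if b \<in> S then 0 else monom ((-1) ^ cyc S r) (card S))"
    proof (cases "b \<in> S")
      case True
      then obtain Q where Q: "Q \<in> orbs S r" "b \<in> Q" using U(1) by blast
      have "(\<Prod>Q\<in>orbs S r. ?F Q) = 0"
        by (rule prod_zero[OF finite_orbs[OF fS]]) (use Q in auto)
      thus ?thesis using True by simp
    next
      case False
      hence "\<forall>Q\<in>orbs S r. b \<notin> Q" using U(1) by blast
      hence "(\<Prod>Q\<in>orbs S r. ?F Q) = (\<Prod>Q\<in>orbs S r. - monom 1 (card Q))" by (intro prod.cong) auto
      thus ?thesis using prod_orbs_monom[OF assms(1,2) S] False by simp
    qed
    moreover have "(\<Prod>Q\<in>orbs (A - S) r. ?G Q) = (if a \<in> S then 1 else 0)"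
    proof (cases "a \<in> S")
      case False
      then obtain Q where Q: "Q \<in> orbs (A - S) r" "a \<in> Q" using U(2) assms(3) by blast
      have "(\<Prod>Q\<in>orbs (A - S) r. ?G Q) = 0"
        by (rule prod_zero) (use Q assms(2) finite_orbs in auto)
      thus ?thesis using False by simp
    next
      case True
      hence "\<forall>Q\<in>orbs (A - S) r. a \<notin> Q" using U(2) by blast
      thus ?thesis using True by simp
    qed
    ultimately show "(\<Prod>Q\<in>orbs S r. ?F Q) * (\<Prod>Q\<in>orbs (A - S) r. ?G Q)
      = (if a \<in> S \<and> b \<notin> S then monom ((-1) ^ cyc S r) (card S) else 0)" by simp
  qed
  also have "\<dots> = (\<Sum>S\<in>{S \<in> {S. S \<subseteq> A \<and> r ` S = S}. a \<in> S \<and> b \<notin> S}. monom ((-1) ^ cyc S r) (card S))"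
    by (rule sum.inter_filter[OF fin, symmetric])
  also have "{S \<in> {S. S \<subseteq> A \<and> r ` S = S}. a \<in> S \<and> b \<notin> S} = {S. S \<subseteq> A \<and> (a \<in> S \<and> b \<notin> S \<and> r ` S = S)}"
    by auto
  finally show ?thesis by simp
qed

lemma separated_sum_joined:
  assumes "s permutes A" "finite A" "a \<in> A" "b \<in> A" "b \<notin> perm_orbit s a"
  shows "(\<Sum>S | S \<subseteq> A \<and> (a \<in> S \<and> b \<notin> S \<and> (transpose a b \<circ> s) ` S = S).
     monom ((-1::int) ^ cyc S (transpose a b \<circ> s)) (card S)) = 0"
proof -
  let ?r = "transpose a b \<circ> s"
  have rp: "?r permutes A" using assms by (intro permutes_compose permutes_swap_id) auto
  have ne: "perm_orbit s a \<noteq> perm_orbit s b" using assms(5) perm_orbit_self[of b s] by blast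
  have b: "b \<in> perm_orbit ?r a"
    unfolding orbit_join(1)[OF assms(1,2) ne assms(3,4)] using perm_orbit_self by blast
  have "b \<in> S" if "a \<in> S" "?r ` S = S" for S
    by (rule invariant_if_meets_orbit[OF rp assms(2) that(2,1) b])
  hence "{S. S \<subseteq> A \<and> (a \<in> S \<and> b \<notin> S \<and> ?r ` S = S)} = {}" by auto
  thus ?thesis by (simp only: sum.empty)
qed

text \<open>The orbit of \<open>a\<close> is cut into a piece of size \<open>j\<close> containing
  \<open>a\<close>, which must lie in \<open>S\<close>, and a piece containing \<open>b\<close>,
  which must not. All other orbits are free and keep their factor of
  \<open>cyc_poly\<close>.\<close>

lemma separated_sum_cut:
  assumes "s permutes A" "finite A" "a \<in> A" "0 < j" "j < card (perm_orbit s a)" "b = (s ^^ j) a"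
  shows "(\<Sum>S | S \<subseteq> A \<and> (a \<in> S \<and> b \<notin> S \<and> (transpose a b \<circ> s) ` S = S).
     monom ((-1::int) ^ cyc S (transpose a b \<circ> s)) (card S))
    = - monom 1 j * (\<Prod>Q\<in>orbs A s - {perm_orbit s a}. 1 - monom 1 (card Q))"
proof -
  let ?r = "transpose a b \<circ> s"
  let ?h = "\<lambda>Q. (if b \<in> Q then 0 else - monom (1::int) (card Q)) + (if a \<in> Q then 0 else 1)"
  have bo: "b \<in> perm_orbit s a" unfolding assms(6) perm_orbit_def by blast
  have ab: "a \<noteq> b"
  proof
    assume "a = b"
    hence "perm_orbit s a = (\<lambda>i. (s ^^ i) a) ` {..<j}" using perm_orbit_bounded[of j s a] assms by simp
    hence "card (perm_orbit s a) \<le> j" using card_image_le[of "{..<j}" "\<lambda>i. (s ^^ i) a"] by simp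
    thus False using assms(5) by simp
  qed
  have bA: "b \<in> A" using bo perm_orbit_subset[of s A a] permutes_image[OF assms(1)] assms(3) by blast
  have rp: "?r permutes A" using assms(1,3) bA by (intro permutes_compose permutes_swap_id) auto
  note cut = orbit_cut[OF assms(1,2,4-6)]
  note oc = orbs_cut[OF assms(1,2) bo ab assms(3)]
  have rest: "a \<notin> Q \<and> b \<notin> Q" if Q: "Q \<in> orbs A s - {perm_orbit s a}" for Q
  proof -
    obtain y where y: "Q = perm_orbit s y" using Q unfolding orbs_def by blast
    have "Q \<inter> perm_orbit s a = {}" using that perm_orbit_disjoint[OF assms(1,2), of y a] y by auto
    thus ?thesis using bo perm_orbit_self[of a s] by blast
  qed
  have nina: "perm_orbit ?r a \<notin> insert (perm_orbit ?r b) (orbs A s - {perm_orbit s a})"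
    using oc(2) rest perm_orbit_self[of a ?r] by blast
  have ninb: "perm_orbit ?r b \<notin> orbs A s - {perm_orbit s a}"
    using rest perm_orbit_self[of b ?r] by blast
  have ha: "?h (perm_orbit ?r a) = - monom 1 j"
    using cut(2,4) perm_orbit_self[of a ?r] perm_orbit_self[of b ?r] by auto
  have hb: "?h (perm_orbit ?r b) = 1"
    using cut(4) perm_orbit_self[of a ?r] perm_orbit_self[of b ?r] by auto
  have "(\<Prod>Q\<in>orbs A ?r. ?h Q) = ?h (perm_orbit ?r a) * (?h (perm_orbit ?r b) * (\<Prod>Q\<in>orbs A s - {perm_orbit s a}. ?h Q))"
    unfolding oc(1) using nina ninb finite_orbs[OF assms(2), of s]
    by (simp only: insert_is_Un[symmetric] Un_insert_left Un_empty_left prod.insert finite_insert finite_Diff not_False_eq_True if_True)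
  also have "(\<Prod>Q\<in>orbs A s - {perm_orbit s a}. ?h Q) = (\<Prod>Q\<in>orbs A s - {perm_orbit s a}. 1 - monom 1 (card Q))"
    by (rule prod.cong[OF refl]) (use rest in auto)
  finally show ?thesis unfolding separated_sum[OF rp assms(2) assms(3) bA] ha hb by (simp add: comp_def)
qed

lemma geometric_monom:
  "(1 - monom 1 1) * (\<Sum>j=1..<l. monom 1 j) = (monom 1 1 - monom 1 l :: int poly)" if "l > 0"
  using that
proof (induction l rule: nat_induct_non_zero)
  case (Suc n)
  have "(\<Sum>j=1..<Suc n. monom 1 j) = (\<Sum>j=1..<n. monom 1 j) + (monom 1 n :: int poly)"
    using Suc(1) by simp
  thus ?case using Suc(2) by (simp only: distrib_left) (simp add: left_diff_distrib mult_monom)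
qed simp

text \<open>Only points \<open>b\<close> on the orbit of \<open>a\<close> contribute. Listing them
  as \<open>(s ^^ j) a\<close> gives a geometric series in \<open>y\<close>, which the factor
  \<open>1 - y\<close> sums without division.\<close>

lemma separated_sum_row:
  assumes "s permutes A" "finite A" "a \<in> A"
  shows "(1 - monom 1 1) * (\<Sum>b\<in>A. \<Sum>S | S \<subseteq> A \<and> (a \<in> S \<and> b \<notin> S \<and> (transpose a b \<circ> s) ` S = S).
     monom ((-1::int) ^ cyc S (transpose a b \<circ> s)) (card S))
    = (monom 1 (card (perm_orbit s a)) - monom 1 1) * (\<Prod>Q\<in>orbs A s - {perm_orbit s a}. 1 - monom 1 (card Q))"
proof -
  let ?V = "\<lambda>b. \<Sum>S | S \<subseteq> A \<and> (a \<in> S \<and> b \<notin> S \<and> (transpose a b \<circ> s) ` S = S).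
     monom ((-1::int) ^ cyc S (transpose a b \<circ> s)) (card S)"
  let ?R = "\<Prod>Q\<in>orbs A s - {perm_orbit s a}. 1 - monom (1::int) (card Q)"
  obtain l where l: "l > 0" "(s ^^ l) a = a" "inj_on (\<lambda>i. (s ^^ i) a) {..<l}"
    "perm_orbit s a = (\<lambda>i. (s ^^ i) a) ` {..<l}" "card (perm_orbit s a) = l"
    using orbit_period[OF assms(1,2)] .
  have oA: "perm_orbit s a \<subseteq> A" using perm_orbit_subset[of s A a] permutes_image[OF assms(1)] assms(3) by blast
  have Va: "?V a = 0"
  proof -
    have "{S. S \<subseteq> A \<and> (a \<in> S \<and> a \<notin> S \<and> (transpose a a \<circ> s) ` S = S)} = {}" by blast
    thus ?thesis by (simp only: sum.empty)
  qed
  have "(\<Sum>b\<in>A. ?V b) = (\<Sum>b\<in>perm_orbit s a. ?V b)"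
    by (rule sum.mono_neutral_right[OF assms(2) oA]) (use separated_sum_joined[OF assms] in blast)
  also have "\<dots> = (\<Sum>j<l. ?V ((s ^^ j) a))"
    unfolding l(4) by (rule sum.reindex[OF l(3), unfolded o_def])
  also have "{..<l} = insert 0 {1..<l}" using l(1) by auto
  also have "(\<Sum>j\<in>insert 0 {1..<l}. ?V ((s ^^ j) a)) = (\<Sum>j=1..<l. ?V ((s ^^ j) a))"
    using Va by (subst sum.insert) auto
  also have "\<dots> = (\<Sum>j=1..<l. - monom 1 j * ?R)"
    by (rule sum.cong[OF refl], rule separated_sum_cut[OF assms]) (use l(5) in auto)
  also have "\<dots> = - ((\<Sum>j=1..<l. monom 1 j) * ?R)"
    by (simp only: sum_distrib_right mult_minus_left sum_negf)
  finally have "(1 - monom 1 1) * (\<Sum>b\<in>A. ?V b) = - (((1 - monom 1 1) * (\<Sum>j=1..<l. monom 1 j)) * ?R)"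
    by (simp only: mult_minus_right mult.assoc)
  thus ?thesis unfolding geometric_monom[OF l(1)] l(5) by (simp only: minus_mult_left minus_diff_eq)
qed

lemma sum_group_orbs:
  fixes h :: "nat set \<Rightarrow> 'b::comm_ring_1"
  assumes "s permutes A" "finite A"
  shows "(\<Sum>a\<in>A. h (perm_orbit s a)) = (\<Sum>Q\<in>orbs A s. of_nat (card Q) * h Q)"
proof -
  have "(\<Sum>a\<in>A. h (perm_orbit s a)) = (\<Sum>Q\<in>perm_orbit s ` A. \<Sum>a\<in>{a \<in> A. perm_orbit s a = Q}. h (perm_orbit s a))"
    by (rule sum.image_gen[OF assms(2)])
  also have "\<dots> = (\<Sum>Q\<in>perm_orbit s ` A. of_nat (card Q) * h Q)"
  proof (rule sum.cong[OF refl])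
    fix Q assume Q: "Q \<in> perm_orbit s ` A"
    hence "Q \<subseteq> A" using orbs_finite_elem(3)[OF assms] unfolding orbs_def by blast
    obtain y where y: "Q = perm_orbit s y" using Q by blast
    have "perm_orbit s a = Q \<longleftrightarrow> a \<in> Q" for a
      using perm_orbit_self[of a s] perm_orbit_eq[OF assms, of a y] y by metis
    hence "{a \<in> A. perm_orbit s a = Q} = Q" using \<open>Q \<subseteq> A\<close> by auto
    thus "(\<Sum>a\<in>{a \<in> A. perm_orbit s a = Q}. h (perm_orbit s a)) = of_nat (card Q) * h Q"
      by (metis (mono_tags, lifting) mem_Collect_eq sum.cong sum_constant)
  qed
  finally show ?thesis unfolding orbs_def .
qed

lemma y_pderiv_cyc_poly:
  assumes "s permutes A" "finite A"
  shows "monom 1 1 * pderiv (cyc_poly A s) =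
    - (\<Sum>Q\<in>orbs A s. of_nat (card Q) * (monom 1 (card Q) * (\<Prod>R\<in>orbs A s - {Q}. 1 - monom 1 (card R))))"
proof -
  have "monom 1 1 * pderiv (cyc_poly A s)
     = (\<Sum>Q\<in>orbs A s. monom 1 1 * ((\<Prod>R\<in>orbs A s - {Q}. 1 - monom 1 (card R)) * pderiv (1 - monom 1 (card Q))))"
    unfolding cyc_poly_def pderiv_prod sum_distrib_left ..
  also have "\<dots> = (\<Sum>Q\<in>orbs A s. - (of_nat (card Q) * (monom 1 (card Q) * (\<Prod>R\<in>orbs A s - {Q}. 1 - monom 1 (card R)))))"
  proof (rule sum.cong[OF refl])
    fix Q assume "Q \<in> orbs A s"
    hence "card Q > 0" using orbs_finite_elem[OF assms] by (simp add: card_gt_0_iff)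
    hence "monom 1 1 * pderiv (1 - monom (1::int) (card Q)) = - (of_nat (card Q) * monom 1 (card Q))"
      by (simp add: pderiv_diff pderiv_monom mult_monom of_nat_poly smult_monom)
    thus "monom 1 1 * ((\<Prod>R\<in>orbs A s - {Q}. 1 - monom 1 (card R)) * pderiv (1 - monom 1 (card Q)))
      = - (of_nat (card Q) * (monom (1::int) (card Q) * (\<Prod>R\<in>orbs A s - {Q}. 1 - monom 1 (card R))))"
      by (metis (no_types, lifting) mult.commute mult.left_commute mult_minus_right)
  qed
  finally show ?thesis by (simp only: sum_negf)
qed

text \<open>Each orbit of length \<open>l\<close> enters with weight \<open>l\<close>, and
  \<open>(y ^ l - y) - (1 - y) * y ^ l = - y * (1 - y ^ l)\<close> restores the factor missing from
  the product. The weights then add up to \<open>card A\<close>.\<close>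

lemma w_poly_eq:
  assumes "s permutes A" "finite A"
  shows "(1 - monom 1 1) * (w_poly A s + monom 1 1 * pderiv (cyc_poly A s)) =
    - (of_nat (card A) * (monom 1 1 * cyc_poly A s))"
proof -
  let ?y = "monom 1 1 :: int poly"
  let ?R = "\<lambda>Q. \<Prod>R\<in>orbs A s - {Q}. 1 - monom (1::int) (card R)"
  have "(1 - ?y) * w_poly A s = (\<Sum>a\<in>A. (monom 1 (card (perm_orbit s a)) - ?y) * ?R (perm_orbit s a))"
    unfolding w_poly_def sum_distrib_left[of _ _ A]
    by (rule sum.cong[OF refl], unfold sum_distrib_left[symmetric, of _ _ A], rule separated_sum_row[OF assms])
  also have "\<dots> = (\<Sum>Q\<in>orbs A s. of_nat (card Q) * ((monom 1 (card Q) - ?y) * ?R Q))"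
    by (rule sum_group_orbs[OF assms])
  finally have W: "(1 - ?y) * w_poly A s = (\<Sum>Q\<in>orbs A s. of_nat (card Q) * ((monom 1 (card Q) - ?y) * ?R Q))" .
  have P: "of_nat (card A) * (?y * cyc_poly A s) = (\<Sum>Q\<in>orbs A s. of_nat (card Q) * (?y * ((1 - monom 1 (card Q)) * ?R Q)))"
  proof -
    have "card A = (\<Sum>Q\<in>orbs A s. card Q)"
      using sum_card_orbs[OF assms, of A] permutes_image[OF assms(1)] by simp
    moreover have "cyc_poly A s = (1 - monom 1 (card Q)) * ?R Q" if "Q \<in> orbs A s" for Q
      unfolding cyc_poly_def by (rule prod.remove[OF finite_orbs[OF assms(2)] that])
    ultimately show ?thesis by (simp add: sum_distrib_right)
  qed
  have "(1 - ?y) * (w_poly A s + ?y * pderiv (cyc_poly A s)) =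
     (\<Sum>Q\<in>orbs A s. of_nat (card Q) * ((monom 1 (card Q) - ?y) * ?R Q)
        - (1 - ?y) * (of_nat (card Q) * (monom 1 (card Q) * ?R Q)))"
    unfolding distrib_left W y_pderiv_cyc_poly[OF assms]
    by (simp only: sum_subtractf sum_distrib_left mult_minus_right add_uminus_conv_diff)
  also have "\<dots> = (\<Sum>Q\<in>orbs A s. - (of_nat (card Q) * (?y * ((1 - monom 1 (card Q)) * ?R Q))))"
    by (intro sum.cong refl) (simp only: algebra_simps)
  finally show ?thesis unfolding P by (simp only: sum_negf)
qed

section \<open>Diagonalisation by partial sums\<close>

definition phi :: "nat set \<Rightarrow> (nat \<Rightarrow> nat) \<Rightarrow> nat \<Rightarrow> int" where
  "phi A s k = (\<Sum>i\<le>k. pcoef A s i)"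

text \<open>Comparing coefficients in the differential equation \<open>w_poly_eq\<close> gives a
  first-order recursion, which sums up to a partial sum of \<open>pcoef\<close>. Only indices up to
  \<open>k\<close> occur, so the action on \<open>pcoef\<close> is triangular.\<close>

lemma wcoef_eq:
  assumes "s permutes A" "finite A"
  shows "wcoef A s k = - int (card A) * (\<Sum>i<k. pcoef A s i) - int k * pcoef A s k"
proof -
  let ?w = "w_poly A s + monom 1 1 * pderiv (cyc_poly A s)"
  have eq: "(1 - monom 1 1) * ?w = - (of_nat (card A) * (monom 1 1 * cyc_poly A s))"
    by (rule w_poly_eq[OF assms])
  have y: "coeff (monom 1 1 * r) k = (if k = 0 then 0 else coeff r (k - 1))" for r :: "int poly" and k
    by (cases k) (simp_all add: coeff_monom_mult)
  have n: "coeff (of_nat m * r) k = int m * coeff r k" for r :: "int poly" and k m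
    by (simp add: of_nat_poly)
  have rec: "coeff ?w k - (if k = 0 then 0 else coeff ?w (k - 1))
      = - (int (card A) * (if k = 0 then 0 else coeff (cyc_poly A s) (k - 1)))" for k
  proof -
    have "(1 - monom 1 1) * ?w = ?w - monom 1 1 * ?w" by (simp only: left_diff_distrib mult_1)
    hence "coeff ?w k - coeff (monom 1 1 * ?w) k = coeff (- (of_nat (card A) * (monom 1 1 * cyc_poly A s))) k"
      using eq by (metis coeff_diff)
    thus ?thesis unfolding coeff_minus n y .
  qed
  have w: "coeff ?w k = - int (card A) * (\<Sum>i<k. pcoef A s i)" for k
  proof (induction k)
    case 0
    show ?case using rec[of 0] by simp
  next
    case (Suc k)
    thus ?case using rec[of "Suc k"] coeff_cyc_poly[OF assms, of k] by (simp add: algebra_simps)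
  qed
  have "coeff (monom 1 1 * pderiv (cyc_poly A s)) k = int k * pcoef A s k"
    unfolding y by (cases k) (simp_all add: coeff_pderiv coeff_cyc_poly[OF assms])
  thus ?thesis using w[of k] coeff_w_poly[OF assms(2), of s k] by simp
qed

text \<open>In the step from \<open>k\<close> to \<open>Suc k\<close>, everything is written in
  terms of \<open>phi\<close> at these two indices with common factor \<open>qprod\<close> at
  \<open>Suc k\<close>. The coefficient of \<open>phi A s k\<close> is then
  \<open>(x + d - Suc k) - x - d + Suc k = 0\<close>, where \<open>d = card A\<close>, so only the
  diagonal term remains.\<close>

lemma sum_perms_phi:
  fixes x :: "'a::{idom,ring_char_0}"
  assumes "s permutes A" "finite A" "k \<le> card A" "x \<noteq> 0"
  shows "(\<Sum>p | p permutes A. x ^ cyc A p * of_int (phi A (p \<circ> s) k))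
    = rprod (card A) k x * of_int (phi A s k)"
  using assms(3)
proof (induction k)
  case 0
  have "wcoef A s 0 = 0" using wcoef_eq[OF assms(1,2), of 0] by simp
  hence "x * (\<Sum>p | p permutes A. x ^ cyc A p * of_int (pcoef A (p \<circ> s) 0))
    = qprod (card A) 0 x * (x * of_int (pcoef A s 0))"
    using sum_perms_pcoef[OF assms(1,2), of x 0] by simp
  also have "\<dots> = x * (rprod (card A) 0 x * of_int (pcoef A s 0))"
    by (simp add: qprod_def rprod_def)
  finally show ?case using assms(4) by (simp add: phi_def comp_def)
next
  case (Suc k)
  let ?d = "card A"
  have sp: "of_int (phi A r (Suc k)) = of_int (phi A r k) + (of_int (pcoef A r (Suc k)) :: 'a)" for r
    by (simp add: phi_def)
  have w: "wcoef A s (Suc k) = - int ?d * phi A s k - int (Suc k) * (phi A s (Suc k) - phi A s k)"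
    using wcoef_eq[OF assms(1,2), of "Suc k"] by (simp add: phi_def lessThan_Suc_atMost)
  have "x * (\<Sum>p | p permutes A. x ^ cyc A p * of_int (phi A (p \<circ> s) (Suc k)))
     = x * (\<Sum>p | p permutes A. x ^ cyc A p * of_int (phi A (p \<circ> s) k))
      + x * (\<Sum>p | p permutes A. x ^ cyc A p * of_int (pcoef A (p \<circ> s) (Suc k)))"
    unfolding sp by (simp only: distrib_left sum.distrib)
  also have "\<dots> = x * (rprod ?d k x * of_int (phi A s k))
     + qprod ?d (Suc k) x * (x * (of_int (phi A s (Suc k)) - of_int (phi A s k)) + of_int (wcoef A s (Suc k)))"
    unfolding sum_perms_pcoef[OF assms(1,2)] using Suc by (simp add: sp comp_def)
  also have "x * (rprod ?d k x * of_int (phi A s k)) = (x * rprod ?d k x) * of_int (phi A s k)" by simp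
  also have "x * rprod ?d k x = (x + of_nat ?d - of_nat (Suc k)) * qprod ?d (Suc k) x"
    using Suc by (intro rprod_conv_qprod_Suc) auto
  also have "(x + of_nat ?d - of_nat (Suc k)) * qprod ?d (Suc k) x * of_int (phi A s k)
     + qprod ?d (Suc k) x * (x * (of_int (phi A s (Suc k)) - of_int (phi A s k)) + of_int (wcoef A s (Suc k)))
     = (x - of_nat (Suc k)) * qprod ?d (Suc k) x * of_int (phi A s (Suc k))"
    unfolding w by (simp add: algebra_simps)
  also have "(x - of_nat (Suc k)) * qprod ?d (Suc k) x = x * rprod ?d (Suc k) x"
    using Suc by (intro rprod_conv_qprod[symmetric]) auto
  finally show ?case using assms(4) by simp
qed

section \<open>Counting Hurwitz tuples\<close>

lemma pcoef_eq_0: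
  assumes "finite A" "k > card A"
  shows "pcoef A s k = 0"
proof -
  have "card S \<noteq> k" if "S \<subseteq> A" for S
    using card_mono[OF assms(1) that] assms(2) by simp
  hence "{S. S \<subseteq> A \<and> s ` S = S \<and> card S = k} = {}" by auto
  thus ?thesis unfolding pcoef_def by (simp only: sum.empty)
qed

lemma cyc_poly_expand:
  assumes "s permutes A" "finite A"
  shows "cyc_poly A s = (\<Sum>i\<le>card A. monom (pcoef A s i) i)"
proof (rule poly_eqI)
  fix k
  show "coeff (cyc_poly A s) k = coeff (\<Sum>i\<le>card A. monom (pcoef A s i) i) k"
    using pcoef_eq_0[OF assms(2), of k s]
    by (simp add: coeff_cyc_poly[OF assms] coeff_sum coeff_monom not_le[symmetric])
qed

lemma sum_partial_sums:
  fixes c :: "nat \<Rightarrow> int"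
  shows "(\<Sum>k<d. \<Sum>i\<le>k. c i) = (\<Sum>i\<le>d. (int d - int i) * c i)"
proof (induction d)
  case (Suc d)
  have "(\<Sum>i\<le>Suc d. (int (Suc d) - int i) * c i) = (\<Sum>i\<le>d. (int d - int i) * c i + c i)"
    by (simp add: algebra_simps)
  thus ?case using Suc by (simp add: sum.distrib)
qed simp

text \<open>With \<open>P = cyc_poly A s\<close>, the sum is the value of \<open>P / (1 - y)\<close>
  at \<open>y = 1\<close>, that is \<open>- P'(1)\<close>, because \<open>P(1) = 0\<close>. If there
  are at least two orbits, \<open>1\<close> is a multiple root of \<open>P\<close>.\<close>

lemma sum_phi_eq_indicator:
  assumes "s permutes A" "finite A" "A \<noteq> {}"
  shows "(\<Sum>k<card A. phi A s k) = (if cyc A s = 1 then int (card A) else 0)"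
proof -
  let ?P = "cyc_poly A s"
  have ne: "orbs A s \<noteq> {}" using assms(3) unfolding orbs_def by simp
  have fin: "finite (orbs A s)" using finite_orbs[OF assms(2)] .
  have P1: "poly ?P 1 = 0"
    unfolding cyc_poly_def poly_prod using ne fin by (simp add: poly_monom card_gt_0_iff)
  have P1': "poly ?P 1 = (\<Sum>i\<le>card A. pcoef A s i)"
    unfolding cyc_poly_expand[OF assms(1,2)] by (simp add: poly_sum poly_monom)
  have D: "poly (pderiv ?P) 1 = (\<Sum>i\<le>card A. int i * pcoef A s i)"
    unfolding cyc_poly_expand[OF assms(1,2)]
    by (simp add: poly_sum poly_monom higher_pderiv_sum[where n = 1, simplified] pderiv_monom)
  have "(\<Sum>k<card A. phi A s k) = int (card A) * poly ?P 1 - poly (pderiv ?P) 1"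
    unfolding phi_def sum_partial_sums P1' D
    by (simp add: sum_distrib_left sum_subtractf left_diff_distrib)
  also have "\<dots> = - poly (monom 1 1 * pderiv ?P) 1" using P1 by (simp add: poly_monom)
  \<comment> \<open>A product of zeros is 1 over the empty set and 0 otherwise, so it records
    whether \<open>Q\<close> is the only orbit.\<close>
  also have "\<dots> = (\<Sum>Q\<in>orbs A s. int (card Q) * (\<Prod>R\<in>orbs A s - {Q}. 0))"
    unfolding y_pderiv_cyc_poly[OF assms(1,2)]
    by (simp add: poly_sum poly_prod poly_monom)
  also have "\<dots> = (if cyc A s = 1 then int (card A) else 0)"
  proof (cases "cyc A s = 1")
    case True
    then obtain Q where Q: "orbs A s = {Q}" unfolding cyc_def by (meson card_1_singletonE)
    have "\<Union> (orbs A s) = A" using Union_orbs[of s A] permutes_image[OF assms(1)] by simp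
    thus ?thesis using True Q by simp
  next
    case False
    have "(\<Prod>R\<in>orbs A s - {Q}. 0) = (0::int)" if "Q \<in> orbs A s" for Q
    proof -
      have "orbs A s - {Q} \<noteq> {}"
      proof
        assume "orbs A s - {Q} = {}"
        hence "orbs A s = {Q}" using that by blast
        thus False using False by (simp add: cyc_def)
      qed
      thus ?thesis using fin by (simp add: card_gt_0_iff)
    qed
    hence "(\<Sum>Q\<in>orbs A s. int (card Q) * (\<Prod>R\<in>orbs A s - {Q}. 0)) = 0"
      by (intro sum.neutral ballI) (simp only: mult_zero_right)
    thus ?thesis using False by (simp only: if_False)
  qed
  finally show ?thesis .
qed

text \<open>For \<open>m = d - q\<close> this is the \<open>q\<close>-th elementary symmetric function of the contents \<open>j - k\<close>, \<open>j < d\<close>,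
  of a hook.\<close>

definition ecoef :: "nat \<Rightarrow> nat \<Rightarrow> nat \<Rightarrow> int" where
  "ecoef d k m = coeff (rprod d k [:0, 1:]) m"

text \<open>With a polynomial variable for \<open>x\<close>, the coefficient of index
  \<open>m\<close> isolates the permutations with \<open>m\<close> cycles.\<close>

lemma sum_perms_phi_coeff:
  assumes "s permutes A" "finite A" "k \<le> card A"
  shows "(\<Sum>p | p permutes A \<and> cyc A p = m. phi A (p \<circ> s) k) = ecoef (card A) k m * phi A s k"
proof -
  let ?x = "[:0, 1:] :: int poly"
  have "(\<Sum>p | p permutes A. ?x ^ cyc A p * of_int (phi A (p \<circ> s) k)) = rprod (card A) k ?x * of_int (phi A s k)"
    by (rule sum_perms_phi[OF assms]) simp
  from arg_cong[OF this, of "\<lambda>r. coeff r m"]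
  have "(\<Sum>p | p permutes A. coeff (?x ^ cyc A p * of_int (phi A (p \<circ> s) k)) m)
     = coeff (rprod (card A) k ?x * of_int (phi A s k)) m"
    by (simp only: coeff_sum)
  also have "\<dots> = ecoef (card A) k m * phi A s k"
    unfolding ecoef_def by (simp add: of_int_poly mult.commute)
  also have "(\<Sum>p | p permutes A. coeff (?x ^ cyc A p * of_int (phi A (p \<circ> s) k)) m)
     = (\<Sum>p | p permutes A. if cyc A p = m then phi A (p \<circ> s) k else 0)"
  proof (rule sum.cong[OF refl])
    fix p
    have "?x ^ cyc A p * of_int (phi A (p \<circ> s) k) = monom (phi A (p \<circ> s) k) (cyc A p)"
      by (simp add: of_int_poly monom_altdef)
    thus "coeff (?x ^ cyc A p * of_int (phi A (p \<circ> s) k)) m = (if cyc A p = m then phi A (p \<circ> s) k else 0)"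
      by (simp add: coeff_monom)
  qed
  also have "\<dots> = (\<Sum>p\<in>{p \<in> {p. p permutes A}. cyc A p = m}. phi A (p \<circ> s) k)"
    by (rule sum.inter_filter[OF finite_permutations[OF assms(2)], symmetric])
  also have "{p \<in> {p. p permutes A}. cyc A p = m} = {p. p permutes A \<and> cyc A p = m}" by auto
  finally show ?thesis .
qed

lemma cyc_eq_card_imp_id:
  assumes "p permutes A" "finite A" "cyc A p = card A"
  shows "p = id"
proof
  fix x
  have inj: "inj_on (perm_orbit p) A"
    using assms(2,3) unfolding cyc_def orbs_def by (rule eq_card_imp_inj_on)
  show "p x = id x"
  proof (cases "x \<in> A")
    case True
    have "perm_orbit p (p x) = perm_orbit p x"
      by (rule perm_orbit_eq[OF assms(1,2) perm_orbit_step])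
    thus ?thesis using inj_onD[OF inj, of "p x" x] True permutes_in_image[OF assms(1)] by simp
  qed (use assms(1) in \<open>simp add: permutes_not_in\<close>)
qed

text \<open>This form makes multiplication by transpositions an instance of
  \<open>sum_perms_phi_coeff\<close>. Conversely, cutting a moved point \<open>a\<close> away from
  \<open>p a\<close> raises the count to \<open>d\<close>, which forces the identity.\<close>

lemma transp_conv_cyc:
  assumes "d > 0"
  shows "{t. is_transp d t} = {p. p permutes {0..<d} \<and> cyc {0..<d} p = d - 1}"
proof (intro set_eqI iffI)
  fix t assume "t \<in> {t. is_transp d t}"
  then obtain a b where ab: "a < d" "b < d" "a \<noteq> b" "t = transpose a b" unfolding is_transp_def by auto
  have "perm_orbit id a \<noteq> perm_orbit id b" using ab(3) unfolding perm_orbit_def by auto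
  from cyc_join[OF permutes_id _ this, of "{0..<d}"] have "Suc (cyc {0..<d} t) = d"
    using ab by (simp add: cyc_id[unfolded id_def] comp_def id_def)
  moreover have "t permutes {0..<d}" unfolding ab(4) using ab(1,2) by (intro permutes_swap_id) auto
  ultimately show "t \<in> {p. p permutes {0..<d} \<and> cyc {0..<d} p = d - 1}" by auto
next
  fix p assume "p \<in> {p. p permutes {0..<d} \<and> cyc {0..<d} p = d - 1}"
  hence p: "p permutes {0..<d}" "cyc {0..<d} p = d - 1" by auto
  have "p \<noteq> id"
  proof
    assume "p = id"
    thus False using p(2) assms by (simp only: cyc_id) simp
  qed
  then obtain a where a: "p a \<noteq> a" by (auto simp: fun_eq_iff)
  have ad: "a \<in> {0..<d}" using a p(1) permutes_not_in by metis
  hence pa: "p a \<in> {0..<d}" using permutes_in_image[OF p(1)] by blast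
  let ?t = "transpose a (p a)"
  have "cyc {0..<d} (?t \<circ> p) = Suc (d - 1)"
    using cyc_cut[OF p(1) _ perm_orbit_step a[symmetric] ad] p(2) by simp
  hence "?t \<circ> p = id"
    using assms a ad pa p(1)
    by (intro cyc_eq_card_imp_id[of _ "{0..<d}"] permutes_compose permutes_swap_id) auto
  hence "?t \<circ> (?t \<circ> p) = ?t" by simp
  moreover have "?t \<circ> (?t \<circ> p) = p" by (simp add: fun_eq_iff)
  ultimately have "p = ?t" by simp
  moreover have "a < d" "p a < d" "a \<noteq> p a" using ad pa a by auto
  ultimately show "p \<in> {t. is_transp d t}" unfolding is_transp_def by blast
qed

section \<open>Class functions and their values at a cycle type\<close>

lemma cyc_poly_inv:
  assumes "p permutes A" "finite A"
  shows "cyc_poly A (inv p) = cyc_poly A p"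
proof -
  have "perm_orbit (inv p) x = perm_orbit p x" for x
    unfolding perm_orbit_conv_orbit[OF assms] perm_orbit_conv_orbit[OF permutes_inv[OF assms(1)] assms(2)]
    by (rule orbit_inv_eq[OF permutes_imp_permutation[OF assms(2,1)]])
  thus ?thesis by (simp add: cyc_poly_def orbs_def)
qed

lemma phi_conv_coeff:
  assumes "p permutes A" "finite A"
  shows "phi A p k = (\<Sum>i\<le>k. coeff (cyc_poly A p) i)"
  unfolding phi_def coeff_cyc_poly[OF assms] ..

lemma phi_inv:
  assumes "p permutes A" "finite A"
  shows "phi A (inv p) k = phi A p k"
  using assms by (simp add: phi_conv_coeff permutes_inv cyc_poly_inv)

definition beta_poly :: "nat list \<Rightarrow> int poly" where
  "beta_poly \<beta> = (\<Prod>b\<leftarrow>\<beta>. 1 - monom 1 b)"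

definition phi_beta :: "nat list \<Rightarrow> nat \<Rightarrow> int" where
  "phi_beta \<beta> k = (\<Sum>i\<le>k. coeff (beta_poly \<beta>) i)"

lemma phi_cycle_type:
  assumes "p permutes A" "finite A" "ctype A p = mset \<beta>"
  shows "phi A p k = phi_beta \<beta> k"
proof -
  have "cyc_poly A p = prod_mset (image_mset (\<lambda>b. 1 - monom 1 b) (ctype A p))"
    unfolding cyc_poly_def ctype_def prod_unfold_prod_mset by (simp add: image_mset.compositionality comp_def)
  also have "\<dots> = beta_poly \<beta>"
    unfolding assms(3) beta_poly_def by (simp flip: prod_mset_prod_list mset_map)
  finally show ?thesis unfolding phi_conv_coeff[OF assms(1,2)] phi_beta_def by simp
qed

lemma num_cycles_conv_cyc: "num_cycles d p = cyc {0..<d} p"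
  by (simp add: num_cycles_def perm_cycles_def cyc_def orbs_def)

lemma cycle_type_conv_ctype: "cycle_type d p = ctype {0..<d} p"
  by (simp add: cycle_type_def perm_cycles_def ctype_def orbs_def)

lemma size_ctype: "size (ctype A p) = cyc A p"
  by (simp add: ctype_def cyc_def)

lemma is_dcycle_conv_cyc: "is_dcycle d p \<longleftrightarrow> p permutes {0..<d} \<and> cyc {0..<d} p = 1"
proof -
  have "cyc {0..<d} p = 1" if "ctype {0..<d} p = {#d#}"
    using size_ctype[of "{0..<d}" p] that by simp
  moreover have "ctype {0..<d} p = {#d#}" if "p permutes {0..<d}" "cyc {0..<d} p = 1"
    using ctype_single[of "{0..<d}" p] that permutes_image[OF that(1)] by simp
  ultimately show ?thesis unfolding is_dcycle_def cycle_type_conv_ctype by blast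
qed

section \<open>Lists of transpositions and the number of tuples\<close>

definition transp_lists :: "nat \<Rightarrow> nat \<Rightarrow> (nat \<Rightarrow> nat) list set" where
  "transp_lists d t = {ts. length ts = t \<and> (\<forall>\<tau>\<in>set ts. is_transp d \<tau>)}"

lemma finite_transp: "finite {t. is_transp d t}"
proof (cases "d > 0")
  case True
  thus ?thesis unfolding transp_conv_cyc[OF True] by (intro finite_perms) simp
qed (auto simp: is_transp_def)

lemma finite_transp_lists: "finite (transp_lists d t)"
proof -
  have "transp_lists d t = {ts. set ts \<subseteq> {t. is_transp d t} \<and> length ts = t}"
    unfolding transp_lists_def by auto
  thus ?thesis using finite_lists_length_eq[OF finite_transp] by simp
qed

lemma transp_permutes: "is_transp d t \<Longrightarrow> t permutes {0..<d}"
  unfolding is_transp_def by (auto intro: permutes_swap_id)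

lemma transp_list_permutes:
  "\<forall>\<tau>\<in>set ts. is_transp d \<tau> \<Longrightarrow> foldr (\<circ>) ts id permutes {0..<d}"
  by (induction ts) (auto intro: permutes_compose transp_permutes permutes_id)

lemma sum_transp_lists:
  assumes "s permutes {0..<d}" "d > 0" "k \<le> d"
  shows "(\<Sum>ts\<in>transp_lists d t. phi {0..<d} (foldr (\<circ>) ts id \<circ> s) k) = ecoef d k (d - 1) ^ t * phi {0..<d} s k"
proof (induction t)
  case 0
  have "transp_lists d 0 = {[]}" by (auto simp: transp_lists_def)
  thus ?case by simp
next
  case (Suc t)
  have "bij_betw (\<lambda>(ts, \<tau>). \<tau> # ts) (transp_lists d t \<times> {t. is_transp d t}) (transp_lists d (Suc t))"
    by (rule bij_betw_byWitness[where f' = "\<lambda>ts. (tl ts, hd ts)"])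
       (auto simp: transp_lists_def length_Suc_conv)
  hence "(\<Sum>ts\<in>transp_lists d (Suc t). phi {0..<d} (foldr (\<circ>) ts id \<circ> s) k)
     = (\<Sum>z\<in>transp_lists d t \<times> {t. is_transp d t}. phi {0..<d} (foldr (\<circ>) ((\<lambda>(ts, \<tau>). \<tau> # ts) z) id \<circ> s) k)"
    by (rule sum.reindex_bij_betw[symmetric])
  also have "\<dots> = (\<Sum>ts\<in>transp_lists d t. \<Sum>\<tau> | is_transp d \<tau>. phi {0..<d} (\<tau> \<circ> (foldr (\<circ>) ts id \<circ> s)) k)"
    by (simp add: sum.cartesian_product case_prod_unfold o_assoc)
  also have "\<dots> = (\<Sum>ts\<in>transp_lists d t. ecoef d k (d - 1) * phi {0..<d} (foldr (\<circ>) ts id \<circ> s) k)"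
  proof (rule sum.cong[OF refl])
    fix ts assume "ts \<in> transp_lists d t"
    hence "foldr (\<circ>) ts id \<circ> s permutes {0..<d}"
      using assms(1) transp_list_permutes by (auto simp: transp_lists_def intro: permutes_compose)
    from sum_perms_phi_coeff[OF this, of k "d - 1"] assms(3)
    show "(\<Sum>\<tau> | is_transp d \<tau>. phi {0..<d} (\<tau> \<circ> (foldr (\<circ>) ts id \<circ> s)) k)
      = ecoef d k (d - 1) * phi {0..<d} (foldr (\<circ>) ts id \<circ> s) k"
      unfolding transp_conv_cyc[OF assms(2)] by simp
  qed
  also have "\<dots> = ecoef d k (d - 1) ^ Suc t * phi {0..<d} s k"
    by (simp only: sum_distrib_left[symmetric] Suc power_Suc mult.assoc)
  finally show ?case .
qed

text \<open>With \<open>p = s \<circ> v\<close> the condition on \<open>m\<close> concerns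
  \<open>p\<close> alone, and being a \<open>d\<close>-cycle becomes a condition on
  \<open>p \<circ> inv v\<close>. The latter is expanded by \<open>sum_phi_eq_indicator\<close>,
  after which \<open>sum_perms_phi_coeff\<close> applies to the sum over \<open>p\<close>.\<close>

lemma card_dcycles_mult:
  assumes "v permutes {0..<d}" "d > 0"
  shows "int d * int (card {s. is_dcycle d s \<and> num_cycles d (s \<circ> v) = m})
     = (\<Sum>k<d. ecoef d k m * phi {0..<d} v k)"
proof -
  let ?A = "{0..<d}"
  have vi: "inv v permutes ?A" using permutes_inv[OF assms(1)] .
  have "bij_betw (\<lambda>p. p \<circ> inv v) {p \<in> {p. p permutes ?A \<and> cyc ?A p = m}. cyc ?A (p \<circ> inv v) = 1}
     {s. is_dcycle d s \<and> num_cycles d (s \<circ> v) = m}"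
  proof (rule bij_betw_byWitness[where f' = "\<lambda>s. s \<circ> v"])
    have 1: "p \<circ> inv v \<circ> v = p" "p \<circ> v \<circ> inv v = p" for p :: "nat \<Rightarrow> nat"
      using permutes_inv_o[OF assms(1)] by (simp_all add: comp_assoc)
    show "\<forall>a\<in>{p \<in> {p. p permutes ?A \<and> cyc ?A p = m}. cyc ?A (p \<circ> inv v) = 1}. a \<circ> inv v \<circ> v = a"
      "\<forall>a\<in>{s. is_dcycle d s \<and> num_cycles d (s \<circ> v) = m}. a \<circ> v \<circ> inv v = a" using 1 by simp_all
    show "(\<lambda>p. p \<circ> inv v) ` {p \<in> {p. p permutes ?A \<and> cyc ?A p = m}. cyc ?A (p \<circ> inv v) = 1}
      \<subseteq> {s. is_dcycle d s \<and> num_cycles d (s \<circ> v) = m}"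
      using 1 permutes_compose[OF vi] by (auto simp only: is_dcycle_conv_cyc num_cycles_conv_cyc)
    show "(\<lambda>s. s \<circ> v) ` {s. is_dcycle d s \<and> num_cycles d (s \<circ> v) = m}
      \<subseteq> {p \<in> {p. p permutes ?A \<and> cyc ?A p = m}. cyc ?A (p \<circ> inv v) = 1}"
      using 1 permutes_compose[OF assms(1)] by (auto simp only: is_dcycle_conv_cyc num_cycles_conv_cyc)
  qed
  hence c: "card {s. is_dcycle d s \<and> num_cycles d (s \<circ> v) = m}
    = card {p \<in> {p. p permutes ?A \<and> cyc ?A p = m}. cyc ?A (p \<circ> inv v) = 1}"
    by (rule bij_betw_same_card[symmetric])
  have "int d * int (card {s. is_dcycle d s \<and> num_cycles d (s \<circ> v) = m})
     = (\<Sum>p | p permutes ?A \<and> cyc ?A p = m. if cyc ?A (p \<circ> inv v) = 1 then int d else 0)"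
    unfolding c by (subst sum.inter_filter[symmetric]) (simp_all add: finite_perms)
  also have "\<dots> = (\<Sum>p | p permutes ?A \<and> cyc ?A p = m. \<Sum>k<d. phi ?A (p \<circ> inv v) k)"
  proof (rule sum.cong[OF refl])
    fix p assume "p \<in> {p. p permutes ?A \<and> cyc ?A p = m}"
    hence "p \<circ> inv v permutes ?A" using permutes_compose[OF vi] by blast
    from sum_phi_eq_indicator[OF this] assms(2)
    show "(if cyc ?A (p \<circ> inv v) = 1 then int d else 0) = (\<Sum>k<d. phi ?A (p \<circ> inv v) k)" by simp
  qed
  also have "\<dots> = (\<Sum>k<d. \<Sum>p | p permutes ?A \<and> cyc ?A p = m. phi ?A (p \<circ> inv v) k)"
    by (rule sum.swap)
  also have "\<dots> = (\<Sum>k<d. ecoef d k m * phi ?A v k)"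
    using sum_perms_phi_coeff[OF vi] phi_inv[OF assms(1)] by (intro sum.cong refl) simp
  finally show ?thesis .
qed

text \<open>The \<open>d\<close>-cycle is eliminated first, then the transpositions, each at the
  price of one eigenvalue. What remains depends only on the cycle type of the last permutation, so
  summing over it gives the class size.\<close>

lemma card_hurwitz_tuples:
  assumes "d > 0"
  shows "int d * int (card (hurwitz_tuples d t m \<beta>)) =
    int (card {p. p permutes {0..<d} \<and> ctype {0..<d} p = mset \<beta>}) *
      (\<Sum>k<d. ecoef d k m * (ecoef d k (d - 1) ^ t * phi_beta \<beta> k))"
proof -
  let ?A = "{0..<d}"
  let ?C = "{p. p permutes ?A \<and> ctype ?A p = mset \<beta>}"
  let ?D = "\<lambda>v. {s. is_dcycle d s \<and> num_cycles d (s \<circ> v) = m}"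
  have fC: "finite ?C" by (intro finite_perms) simp
  have fD: "finite (?D v)" for v
    by (rule finite_subset[OF _ finite_permutations[of ?A]]) (auto simp: is_dcycle_def)
  have "bij_betw (\<lambda>(s1, ts, s0). (s0, ts, s1))
     (Sigma ?C (\<lambda>s1. Sigma (transp_lists d t) (\<lambda>ts. ?D (foldr (\<circ>) ts id \<circ> s1)))) (hurwitz_tuples d t m \<beta>)"
    by (rule bij_betw_byWitness[where f' = "\<lambda>(s0, ts, s1). (s1, ts, s0)"])
       (auto simp: hurwitz_tuples_def transp_lists_def cycle_type_conv_ctype o_assoc)
  hence "card (hurwitz_tuples d t m \<beta>)
     = card (Sigma ?C (\<lambda>s1. Sigma (transp_lists d t) (\<lambda>ts. ?D (foldr (\<circ>) ts id \<circ> s1))))"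
    by (rule bij_betw_same_card[symmetric])
  also have "\<dots> = (\<Sum>s1\<in>?C. \<Sum>ts\<in>transp_lists d t. card (?D (foldr (\<circ>) ts id \<circ> s1)))"
    using fC fD finite_transp_lists by (subst card_SigmaI) (auto intro!: sum.cong card_SigmaI)
  finally have "int d * int (card (hurwitz_tuples d t m \<beta>)) =
     (\<Sum>s1\<in>?C. \<Sum>ts\<in>transp_lists d t. int d * int (card (?D (foldr (\<circ>) ts id \<circ> s1))))"
    by (simp add: sum_distrib_left)
  also have "\<dots> = (\<Sum>s1\<in>?C. \<Sum>ts\<in>transp_lists d t. \<Sum>k<d. ecoef d k m * phi ?A (foldr (\<circ>) ts id \<circ> s1) k)"
  proof (intro sum.cong refl)
    fix s1 ts assume "s1 \<in> ?C" "ts \<in> transp_lists d t"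
    hence "foldr (\<circ>) ts id \<circ> s1 permutes ?A"
      using transp_list_permutes by (auto simp: transp_lists_def intro: permutes_compose)
    from card_dcycles_mult[OF this assms]
    show "int d * int (card (?D (foldr (\<circ>) ts id \<circ> s1))) = (\<Sum>k<d. ecoef d k m * phi ?A (foldr (\<circ>) ts id \<circ> s1) k)" .
  qed
  also have "\<dots> = (\<Sum>s1\<in>?C. \<Sum>k<d. ecoef d k m * (\<Sum>ts\<in>transp_lists d t. phi ?A (foldr (\<circ>) ts id \<circ> s1) k))"
    by (intro sum.cong refl) (simp only: sum_distrib_left sum.swap[of _ "{..<d}"])
  also have "\<dots> = (\<Sum>s1\<in>?C. \<Sum>k<d. ecoef d k m * (ecoef d k (d - 1) ^ t * phi_beta \<beta> k))"
  proof (intro sum.cong refl)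
    fix s1 k assume "s1 \<in> ?C" "k \<in> {..<d}"
    thus "ecoef d k m * (\<Sum>ts\<in>transp_lists d t. phi ?A (foldr (\<circ>) ts id \<circ> s1) k)
      = ecoef d k m * (ecoef d k (d - 1) ^ t * phi_beta \<beta> k)"
      using sum_transp_lists[of s1 d k t] assms phi_cycle_type[of s1 ?A \<beta> k] by simp
  qed
  finally show ?thesis by simp
qed

section \<open>Polynomial functions with degree bounds\<close>

text \<open>The degree bounds are integers so that \<open>hi = -1\<close> is available and leaves only the zero function.\<close>

inductive polyfun :: "nat \<Rightarrow> int \<Rightarrow> int \<Rightarrow> ((nat \<Rightarrow> rat) \<Rightarrow> rat) \<Rightarrow> bool" for n lo hi where
  zero: "polyfun n lo hi (\<lambda>x. 0)"
| add_monom: "polyfun n lo hi f \<Longrightarrow> (\<And>i. i \<ge> n \<Longrightarrow> e i = 0) \<Longrightarrow> lo \<le> int (mono_deg n e) \<Longrightarrow>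
    int (mono_deg n e) \<le> hi \<Longrightarrow> polyfun n lo hi (\<lambda>x. a * (\<Prod>i<n. x i ^ e i) + f x)"

lemma polyfun_mono:
  assumes "polyfun n lo hi f" "lo' \<le> lo" "hi \<le> hi'"
  shows "polyfun n lo' hi' f"
  using assms by (induction rule: polyfun.induct) (auto intro!: polyfun.intros)

lemma polyfun_add:
  assumes "polyfun n lo hi f" "polyfun n lo hi h"
  shows "polyfun n lo hi (\<lambda>x. f x + h x)"
  using assms(1)
proof (induction rule: polyfun.induct)
  case (add_monom f e a)
  from polyfun.add_monom[OF add_monom(5,2,3,4), of a] show ?case by (simp add: add.assoc)
qed (use assms(2) in simp)

lemma polyfun_monom:
  assumes "\<And>i. i \<ge> n \<Longrightarrow> e i = 0" "lo \<le> int (mono_deg n e)" "int (mono_deg n e) \<le> hi"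
  shows "polyfun n lo hi (\<lambda>x. a * (\<Prod>i<n. x i ^ e i))"
  using polyfun.add_monom[OF polyfun.zero assms, of a] by simp

lemma polyfun_monom_mult:
  assumes "polyfun n lo hi f" "\<And>i. i \<ge> n \<Longrightarrow> e i = 0" "lo' \<le> int (mono_deg n e)" "int (mono_deg n e) \<le> hi'"
  shows "polyfun n (lo' + lo) (hi' + hi) (\<lambda>x. a * (\<Prod>i<n. x i ^ e i) * f x)"
  using assms(1)
proof (induction rule: polyfun.induct)
  case zero
  show ?case using polyfun.zero by simp
next
  case (add_monom f e' b)
  have deg: "mono_deg n (\<lambda>i. e i + e' i) = mono_deg n e + mono_deg n e'"
    by (simp add: mono_deg_def sum.distrib)
  have "polyfun n (lo' + lo) (hi' + hi)
     (\<lambda>x. (a * b) * (\<Prod>i<n. x i ^ (e i + e' i)) + a * (\<Prod>i<n. x i ^ e i) * f x)"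
    by (rule polyfun.add_monom[OF add_monom(5)]) (use assms add_monom deg in auto)
  moreover have "(\<lambda>x. (a * b) * (\<Prod>i<n. x i ^ (e i + e' i)) + a * (\<Prod>i<n. x i ^ e i) * f x)
     = (\<lambda>x. a * (\<Prod>i<n. x i ^ e i) * (b * (\<Prod>i<n. x i ^ e' i) + f x))"
    by (simp add: power_add prod.distrib algebra_simps)
  ultimately show ?case by simp
qed

lemma polyfun_mult:
  assumes "polyfun n lo hi f" "polyfun n lo' hi' h"
  shows "polyfun n (lo + lo') (hi + hi') (\<lambda>x. f x * h x)"
  using assms(1)
proof (induction rule: polyfun.induct)
  case zero
  show ?case using polyfun.zero by simp
next
  case (add_monom f e a)
  have "polyfun n (lo + lo') (hi + hi') (\<lambda>x. a * (\<Prod>i<n. x i ^ e i) * h x + f x * h x)"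
    by (intro polyfun_add add_monom(5) polyfun_monom_mult[OF assms(2)] add_monom)
  thus ?case by (simp add: distrib_right)
qed

lemma polyfun_const: "0 \<le> hi \<Longrightarrow> lo \<le> 0 \<Longrightarrow> polyfun n lo hi (\<lambda>x. c)"
  using polyfun_monom[of n "\<lambda>_. 0" lo hi c] by (simp add: mono_deg_def)

lemma polyfun_cmult: "polyfun n lo hi f \<Longrightarrow> polyfun n lo hi (\<lambda>x. c * f x)"
  using polyfun_mult[OF polyfun_const[of 0 0 n c], of lo hi f] by simp

lemma polyfun_var:
  assumes "i < n"
  shows "polyfun n 1 1 (\<lambda>x. x i)"
proof -
  let ?e = "\<lambda>j. if j = i then 1 else 0 :: nat"
  have deg: "mono_deg n ?e = 1" using assms by (simp add: mono_deg_def)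
  have "polyfun n 1 1 (\<lambda>x. 1 * (\<Prod>j<n. x j ^ ?e j))"
    by (rule polyfun_monom) (use assms deg in auto)
  moreover have "(\<Prod>j<n. x j ^ ?e j) = x i" for x :: "nat \<Rightarrow> rat"
    using assms by (simp add: if_distrib prod.delta cong: if_cong)
  ultimately show ?thesis by simp
qed

lemma polyfun_power: "polyfun n lo hi f \<Longrightarrow> polyfun n (int k * lo) (int k * hi) (\<lambda>x. f x ^ k)"
proof (induction k)
  case 0
  show ?case using polyfun_const[of 0 0 n 1] by simp
next
  case (Suc k)
  from polyfun_mult[OF Suc(2) Suc(1)[OF Suc(2)]] show ?case by (simp add: algebra_simps)
qed

lemma polyfun_sum:
  assumes "\<And>i. i \<in> I \<Longrightarrow> polyfun n lo hi (f i)"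
  shows "polyfun n lo hi (\<lambda>x. \<Sum>i\<in>I. f i x)"
  using assms by (induction I rule: infinite_finite_induct) (auto intro: polyfun.zero polyfun_add)

section \<open>Passage from functions to coefficient families\<close>

lemma mpoly_eval_superset:
  assumes "finite E" "{e. c e \<noteq> 0} \<subseteq> E"
  shows "mpoly_eval n c x = (\<Sum>e\<in>E. c e * (\<Prod>i<n. x i ^ e i))"
  unfolding mpoly_eval_def by (rule sum.mono_neutral_left) (use assms in auto)

lemma mpoly_eval_add:
  assumes "finite {e. c e \<noteq> 0}" "finite {e. c' e \<noteq> 0}"
  shows "mpoly_eval n (\<lambda>e. c e + c' e) x = mpoly_eval n c x + mpoly_eval n c' x"
proof -
  let ?E = "{e. c e \<noteq> 0} \<union> {e. c' e \<noteq> 0}"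
  have "mpoly_eval n (\<lambda>e. c e + c' e) x = (\<Sum>e\<in>?E. (c e + c' e) * (\<Prod>i<n. x i ^ e i))"
    "mpoly_eval n c x = (\<Sum>e\<in>?E. c e * (\<Prod>i<n. x i ^ e i))"
    "mpoly_eval n c' x = (\<Sum>e\<in>?E. c' e * (\<Prod>i<n. x i ^ e i))"
    using assms by (intro mpoly_eval_superset; auto)+
  thus ?thesis by (simp add: distrib_right sum.distrib)
qed

lemma is_mpoly_add:
  assumes "is_mpoly n c" "is_mpoly n c'"
  shows "is_mpoly n (\<lambda>e. c e + c' e)"
proof -
  have "finite {e. c e + c' e \<noteq> 0}"
    by (rule finite_subset[of _ "{e. c e \<noteq> 0} \<union> {e. c' e \<noteq> 0}"])
       (use assms in \<open>auto simp: is_mpoly_def\<close>)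
  thus ?thesis using assms unfolding is_mpoly_def by (metis add.right_neutral add_0)
qed

lemma polyfun_coeffs:
  assumes "polyfun n lo hi f"
  shows "\<exists>c. is_mpoly n c \<and> (\<forall>x. mpoly_eval n c x = f x) \<and>
    (\<forall>e. c e \<noteq> 0 \<longrightarrow> lo \<le> int (mono_deg n e) \<and> int (mono_deg n e) \<le> hi)"
  using assms
proof (induction rule: polyfun.induct)
  case zero
  show ?case by (rule exI[of _ "\<lambda>_. 0"]) (simp add: is_mpoly_def mpoly_eval_def)
next
  case (add_monom f e a)
  then obtain c where c: "is_mpoly n c" "\<And>x. mpoly_eval n c x = f x"
    "\<And>e. c e \<noteq> 0 \<Longrightarrow> lo \<le> int (mono_deg n e) \<and> int (mono_deg n e) \<le> hi" by blast
  let ?m = "\<lambda>e'. if e' = e then a else 0"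
  have sub: "{e'. ?m e' \<noteq> 0} \<subseteq> {e}" by auto
  have m: "is_mpoly n ?m"
    unfolding is_mpoly_def using finite_subset[OF sub] add_monom(2) by auto
  have mev: "mpoly_eval n ?m x = a * (\<Prod>i<n. x i ^ e i)" for x
    by (subst mpoly_eval_superset[OF _ sub]) auto
  have "mpoly_eval n (\<lambda>e'. ?m e' + c e') x = a * (\<Prod>i<n. x i ^ e i) + f x" for x
    using mpoly_eval_add[of ?m c n x] m c mev by (simp add: is_mpoly_def)
  moreover have "lo \<le> int (mono_deg n e') \<and> int (mono_deg n e') \<le> hi" if "?m e' + c e' \<noteq> 0" for e'
    using that c(3)[of e'] add_monom(3,4) by (cases "e' = e") auto
  ultimately show ?case
    using is_mpoly_add[OF m c(1)] by (intro exI[of _ "\<lambda>e'. ?m e' + c e'"]) simp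
qed

text \<open>\<open>T\<close> is homogeneous, so a nonzero value at one point yields a monomial of
  degree \<open>D\<close>, and \<open>L\<close> has no monomial of that degree to cancel it.\<close>

lemma polyfun_top_degree:
  assumes "polyfun n D D T" "polyfun n lo (D - 1) L" "lo \<le> D" "T y \<noteq> 0"
  shows "\<exists>c. is_mpoly n c \<and> (\<forall>x. mpoly_eval n c x = T x + L x) \<and>
    (\<forall>e. c e \<noteq> 0 \<longrightarrow> lo \<le> int (mono_deg n e) \<and> int (mono_deg n e) \<le> D) \<and>
    (\<exists>e. c e \<noteq> 0 \<and> int (mono_deg n e) = D)"
proof -
  obtain c where c: "is_mpoly n c" "\<And>x. mpoly_eval n c x = T x"
    "\<And>e. c e \<noteq> 0 \<Longrightarrow> D \<le> int (mono_deg n e) \<and> int (mono_deg n e) \<le> D"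
    using polyfun_coeffs[OF assms(1)] by blast
  obtain c' where c': "is_mpoly n c'" "\<And>x. mpoly_eval n c' x = L x"
    "\<And>e. c' e \<noteq> 0 \<Longrightarrow> lo \<le> int (mono_deg n e) \<and> int (mono_deg n e) \<le> D - 1"
    using polyfun_coeffs[OF assms(2)] by blast
  have "\<exists>e. c e \<noteq> 0"
  proof (rule ccontr)
    assume "\<not> (\<exists>e. c e \<noteq> 0)"
    hence "mpoly_eval n c y = 0" by (simp add: mpoly_eval_def)
    thus False using c(2) assms(4) by simp
  qed
  then obtain e where e: "c e \<noteq> 0" by blast
  hence de: "int (mono_deg n e) = D" using c(3) by force
  hence "c' e = 0" using c'(3)[of e] by auto
  hence "c e + c' e \<noteq> 0" using e by simp
  moreover have "lo \<le> int (mono_deg n e) \<and> int (mono_deg n e) \<le> D" if "c e + c' e \<noteq> 0" for e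
    using that c(3)[of e] c'(3)[of e] assms(3) by (cases "c e = 0") auto
  ultimately show ?thesis
    using is_mpoly_add[OF c(1) c'(1)] mpoly_eval_add[of c c' n] c c' de
    by (intro exI[of _ "\<lambda>e. c e + c' e"]) (auto simp: is_mpoly_def)
qed

section \<open>Moments of the character values\<close>

unbundle fps_syntax

text \<open>The series of \<open>sinh (c * u / 2) / (c * u / 2)\<close>. Its constant term 1 makes
  it invertible, and its \<open>j\<close>-th coefficient is homogeneous of degree \<open>j\<close>
  in \<open>c\<close>.\<close>

definition sinc_fps :: "rat \<Rightarrow> rat fps" where
  "sinc_fps c = Abs_fps (\<lambda>j. if even j then c ^ j / (2 ^ j * fact (j + 1)) else 0)"

lemma exp_diff_sinc: "fps_exp (c / 2) - fps_exp (- c / 2) = fps_const c * fps_X * sinc_fps c"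
proof (rule fps_ext)
  fix j
  show "(fps_exp (c / 2) - fps_exp (- c / 2)) $ j = (fps_const c * fps_X * sinc_fps c) $ j"
  proof (cases j)
    case (Suc i)
    have "(- c / 2) ^ Suc i = (-1) ^ Suc i * (c / 2) ^ Suc i" by (simp add: power_minus[of "c / 2"] power_divide flip: power_mult_distrib)
    thus ?thesis unfolding Suc mult.assoc
      by (cases "even i") (simp_all add: sinc_fps_def power_divide field_simps del: fact_Suc)
  qed (simp add: mult.assoc)
qed

definition sinc_inv :: "rat fps" where
  "sinc_inv = inverse (sinc_fps 1)"

lemma sinc_fps_0 [simp]: "sinc_fps c $ 0 = 1"
  by (simp add: sinc_fps_def)

lemma sinc_fps_mult_inv: "sinc_fps 1 * sinc_inv = 1"
  unfolding sinc_inv_def by (rule inverse_mult_eq_1') simp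

lemma sinc_inv_0 [simp]: "sinc_inv $ 0 = 1"
  by (simp add: sinc_inv_def)

text \<open>Because of this zero, the first power sum of the contents has no correction term; see
  \<open>phat_1\<close>.\<close>

lemma sinc_inv_1: "sinc_inv $ 1 = 0"
proof -
  have "(sinc_fps 1 * sinc_inv) $ 1 = 0" by (simp add: sinc_fps_mult_inv)
  thus ?thesis by (simp add: fps_mult_nth sinc_fps_def)
qed

lemma polyfun_sinc_nth:
  assumes "i < n"
  shows "polyfun n (int j) (int j) (\<lambda>x. sinc_fps (x i) $ j)"
proof (cases "even j")
  case True
  have "polyfun n (int j * 1) (int j * 1) (\<lambda>x. 1 / (2 ^ j * fact (j + 1)) * x i ^ j)"
    by (intro polyfun_cmult polyfun_power polyfun_var assms)
  thus ?thesis using True by (simp add: sinc_fps_def del: fact_Suc)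
qed (simp add: sinc_fps_def polyfun.zero)

lemma polyfun_prod_sinc_nth:
  assumes "m \<le> n"
  shows "polyfun n (int j) (int j) (\<lambda>x. (\<Prod>i<m. sinc_fps (x i)) $ j)"
  using assms
proof (induction m arbitrary: j)
  case 0
  show ?case by (cases j) (auto intro: polyfun_const polyfun.zero)
next
  case (Suc m)
  have "polyfun n (int j) (int j) (\<lambda>x. \<Sum>i=0..j. (\<Prod>i<m. sinc_fps (x i)) $ i * sinc_fps (x m) $ (j - i))"
  proof (rule polyfun_sum)
    fix i assume "i \<in> {0..j}"
    hence "int i + int (j - i) = int j" by simp
    thus "polyfun n (int j) (int j) (\<lambda>x. (\<Prod>i<m. sinc_fps (x i)) $ i * sinc_fps (x m) $ (j - i))"
      using polyfun_mult[OF Suc(1)[of i] polyfun_sinc_nth[of m n "j - i"]] Suc(2) by simp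
  qed
  thus ?case by (simp add: fps_mult_nth)
qed

text \<open>The generating function of the moments after removal of the product of the parts and of
  the power \<open>u ^ (n - 1)\<close>.\<close>

definition gcoef :: "nat \<Rightarrow> (nat \<Rightarrow> rat) \<Rightarrow> nat \<Rightarrow> rat" where
  "gcoef n x j = ((\<Prod>i<n. sinc_fps (x i)) * sinc_inv) $ j"

text \<open>As \<open>sinc_inv\<close> has constant term 1, the first summand is the component of
  degree \<open>j\<close>; all other terms have smaller degree in \<open>x\<close>.\<close>

lemma gcoef_split:
  "gcoef n x j = (\<Prod>i<n. sinc_fps (x i)) $ j + (\<Sum>i<j. (\<Prod>i<n. sinc_fps (x i)) $ i * sinc_inv $ (j - i))"
  unfolding gcoef_def fps_mult_nth atLeast0AtMost lessThan_Suc_atMost[symmetric] by simp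

lemma polyfun_gcoef_low:
  "polyfun n 0 (int j - 1) (\<lambda>x. \<Sum>i<j. (\<Prod>i<n. sinc_fps (x i)) $ i * sinc_inv $ (j - i))"
proof (rule polyfun_sum)
  fix i assume i: "i \<in> {..<j}"
  have "polyfun n 0 (int j - 1) (\<lambda>x. sinc_inv $ (j - i) * (\<Prod>i<n. sinc_fps (x i)) $ i)"
    by (rule polyfun_cmult, rule polyfun_mono[OF polyfun_prod_sinc_nth]) (use i in auto)
  thus "polyfun n 0 (int j - 1) (\<lambda>x. (\<Prod>i<n. sinc_fps (x i)) $ i * sinc_inv $ (j - i))"
    by (simp only: mult.commute)
qed

lemma polyfun_gcoef: "polyfun n 0 (int j) (\<lambda>x. gcoef n x j)"
  unfolding gcoef_split
  by (intro polyfun_add polyfun_mono[OF polyfun_gcoef_low] polyfun_mono[OF polyfun_prod_sinc_nth]) auto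

text \<open>All coefficients are nonnegative, and the term that takes the whole exponent from the
  last factor is positive. This will show that the top degree is attained.\<close>

lemma prod_sinc_one_pos:
  fixes n j :: nat
  assumes "even j" "n > 0"
  shows "(\<Prod>i<n. sinc_fps 1) $ j > 0"
proof -
  have sn: "sinc_fps 1 $ i \<ge> 0" for i by (simp add: sinc_fps_def del: fact_Suc)
  have nn: "(\<Prod>i<m. sinc_fps 1) $ i \<ge> 0" for m :: nat and i
  proof (induction m arbitrary: i)
    case (Suc m)
    show ?case unfolding prod.lessThan_Suc fps_mult_nth by (intro sum_nonneg mult_nonneg_nonneg Suc sn)
  qed simp
  obtain m where m: "n = Suc m" using assms(2) gr0_implies_Suc by blast
  have c0: "(\<Prod>i<m. sinc_fps 1) $ 0 = 1" for m :: nat by (induction m) auto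
  have "0 < (\<Prod>i<m. sinc_fps 1) $ 0 * sinc_fps 1 $ (j - 0)"
    unfolding c0 using assms(1) by (simp add: sinc_fps_def del: fact_Suc)
  also have "\<dots> \<le> (\<Sum>i=0..j. (\<Prod>i<m. sinc_fps 1) $ i * sinc_fps 1 $ (j - i))"
    by (rule member_le_sum) (use nn sn in \<open>auto intro!: mult_nonneg_nonneg simp del: prod_constant\<close>)
  finally show ?thesis unfolding m prod.lessThan_Suc fps_mult_nth .
qed

text \<open>Homogenising allows \<open>a\<close> and \<open>b\<close> to be exponentials with
  opposite exponents, so that each factor becomes a hyperbolic sine. The vanishing of the higher
  coefficients is carried along because the induction step extends the range of summation.\<close>

lemma beta_poly_homogeneous:
  fixes a b :: "'a::comm_ring_1"
  shows "(\<Sum>k\<le>sum_list \<beta>. of_int (coeff (beta_poly \<beta>) k) * (a ^ (sum_list \<beta> - k) * b ^ k)) = (\<Prod>c\<leftarrow>\<beta>. a ^ c - b ^ c)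
    \<and> (\<forall>k>sum_list \<beta>. coeff (beta_poly \<beta>) k = 0)"
proof (induction \<beta>)
  case Nil
  show ?case by (simp add: beta_poly_def)
next
  case (Cons c \<beta>)
  let ?P = "beta_poly \<beta>" and ?D = "sum_list \<beta>"
  have co: "coeff (beta_poly (c # \<beta>)) k = coeff ?P k - (if c \<le> k then coeff ?P (k - c) else 0)" for k
    by (simp add: beta_poly_def left_diff_distrib coeff_monom_mult)
  have z: "coeff ?P k = 0" if "k > ?D" for k using Cons that by blast
  have "(\<Sum>k\<le>c + ?D. of_int (coeff ?P k) * (a ^ (c + ?D - k) * b ^ k)) = (\<Sum>k\<le>?D. of_int (coeff ?P k) * (a ^ (c + ?D - k) * b ^ k))"
    by (rule sum.mono_neutral_right) (auto simp: z)
  also have "\<dots> = a ^ c * (\<Sum>k\<le>?D. of_int (coeff ?P k) * (a ^ (?D - k) * b ^ k))"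
    unfolding sum_distrib_left
  proof (rule sum.cong[OF refl])
    fix k assume "k \<in> {..?D}"
    hence "c + ?D - k = c + (?D - k)" by simp
    thus "of_int (coeff ?P k) * (a ^ (c + ?D - k) * b ^ k) = a ^ c * (of_int (coeff ?P k) * (a ^ (?D - k) * b ^ k))"
      by (simp add: power_add mult_ac)
  qed
  finally have 1: "(\<Sum>k\<le>c + ?D. of_int (coeff ?P k) * (a ^ (c + ?D - k) * b ^ k))
     = a ^ c * (\<Sum>k\<le>?D. of_int (coeff ?P k) * (a ^ (?D - k) * b ^ k))" .
  have "(\<Sum>k\<le>c + ?D. of_int (if c \<le> k then coeff ?P (k - c) else 0) * (a ^ (c + ?D - k) * b ^ k))
     = (\<Sum>k\<in>{c..c + ?D}. of_int (coeff ?P (k - c)) * (a ^ (c + ?D - k) * b ^ k))"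
    by (rule sum.mono_neutral_cong_right) auto
  also have "\<dots> = (\<Sum>k\<le>?D. of_int (coeff ?P k) * (a ^ (?D - k) * b ^ (k + c)))"
    by (rule sum.reindex_bij_witness[of _ "\<lambda>k. k + c" "\<lambda>k. k - c"]) (auto simp: add.commute)
  also have "\<dots> = b ^ c * (\<Sum>k\<le>?D. of_int (coeff ?P k) * (a ^ (?D - k) * b ^ k))"
    unfolding sum_distrib_left
    by (intro sum.cong refl) (simp add: power_add mult_ac)
  finally have 2: "(\<Sum>k\<le>c + ?D. of_int (if c \<le> k then coeff ?P (k - c) else 0) * (a ^ (c + ?D - k) * b ^ k))
     = b ^ c * (\<Sum>k\<le>?D. of_int (coeff ?P k) * (a ^ (?D - k) * b ^ k))" .
  have "(\<Sum>k\<le>sum_list (c # \<beta>). of_int (coeff (beta_poly (c # \<beta>)) k) * (a ^ (sum_list (c # \<beta>) - k) * b ^ k))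
     = (a ^ c - b ^ c) * (\<Sum>k\<le>?D. of_int (coeff ?P k) * (a ^ (?D - k) * b ^ k))"
    unfolding co sum_list.Cons of_int_diff left_diff_distrib sum_subtractf 1 2 ..
  moreover have "coeff (beta_poly (c # \<beta>)) k = 0" if "k > sum_list (c # \<beta>)" for k
    unfolding co using that by (auto simp: z)
  ultimately show ?case using Cons by simp
qed

lemma summation_by_parts:
  fixes p E :: "nat \<Rightarrow> 'a::comm_ring_1"
  shows "(\<Sum>k<D. (\<Sum>i\<le>k. p i) * (E k - E (Suc k))) + (\<Sum>i\<le>D. p i) * E D = (\<Sum>k\<le>D. p k * E k)"
  by (induction D) (simp_all add: algebra_simps)

text \<open>The mean of the contents \<open>j - k\<close>, \<open>j < d\<close>. Centring at it
  makes the exponentials below symmetric.\<close>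

definition center :: "nat \<Rightarrow> nat \<Rightarrow> rat" where
  "center d k = (of_nat d - 1) / 2 - of_nat k"

text \<open>Multiplication by \<open>fps_exp (1/2) - fps_exp (- 1/2)\<close> turns consecutive
  exponentials into differences. Summation by parts then undoes the partial sums in
  \<open>phi_beta\<close> and leaves the homogenised \<open>beta_poly\<close>.\<close>

lemma phi_generating_function:
  assumes "\<forall>b\<in>set \<beta>. b > 0" "\<beta> \<noteq> []"
  shows "(\<Sum>k<sum_list \<beta>. fps_const (of_int (phi_beta \<beta> k)) * fps_exp (center (sum_list \<beta>) k))
     * (fps_exp (1/2) - fps_exp (- 1/2)) = (\<Prod>b\<leftarrow>\<beta>. fps_exp (of_nat b / 2) - fps_exp (- of_nat b / 2))"
proof -
  let ?d = "sum_list \<beta>"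
  let ?p = "\<lambda>k. of_int (coeff (beta_poly \<beta>) k) :: rat fps"
  let ?E = "\<lambda>k. fps_exp (of_nat ?d / 2 - of_nat k) :: rat fps"
  have phi: "fps_const (of_int (phi_beta \<beta> k)) = (\<Sum>i\<le>k. ?p i)" for k
    by (subst fps_of_int) (simp only: phi_beta_def of_int_sum)
  have e: "fps_exp (center ?d k) * (fps_exp (1/2) - fps_exp (- 1/2)) = ?E k - ?E (Suc k)" for k
    unfolding right_diff_distrib fps_exp_add_mult[symmetric] center_def by (simp add: field_simps)
  have AB: "fps_exp (1/2) ^ (?d - k) * fps_exp (-1/2) ^ k = ?E k" if "k \<le> ?d" for k
    unfolding fps_exp_power_mult fps_exp_add_mult[symmetric] using that by (simp add: of_nat_diff field_simps)
  \<comment> \<open>The boundary term of the summation by parts vanishes: it is the value of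
    \<open>beta_poly\<close> at 1, and \<open>\<beta>\<close> is nonempty.\<close>
  have phid: "(\<Sum>i\<le>?d. ?p i) = 0"
  proof -
    have "(\<Sum>i\<le>?d. ?p i) = (\<Prod>c\<leftarrow>\<beta>. 0)"
      using beta_poly_homogeneous[of \<beta> "1 :: rat fps" 1] by simp
    thus ?thesis using assms(2) by (cases \<beta>) simp_all
  qed
  have "(\<Sum>k<?d. fps_const (of_int (phi_beta \<beta> k)) * fps_exp (center ?d k)) * (fps_exp (1/2) - fps_exp (- 1/2))
     = (\<Sum>k<?d. (\<Sum>i\<le>k. ?p i) * (?E k - ?E (Suc k)))"
    unfolding sum_distrib_right phi mult.assoc e ..
  also have "\<dots> = (\<Sum>k\<le>?d. ?p k * ?E k)"
    using summation_by_parts[of ?p ?E ?d] phid by simp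
  also have "\<dots> = (\<Sum>k\<le>?d. ?p k * (fps_exp (1/2) ^ (?d - k) * fps_exp (-1/2) ^ k))"
    by (intro sum.cong refl) (simp only: AB atMost_iff)
  also have "\<dots> = (\<Prod>b\<leftarrow>\<beta>. fps_exp (1/2) ^ b - fps_exp (- 1/2) ^ b)"
    using beta_poly_homogeneous[of \<beta> "fps_exp (1/2) :: rat fps" "fps_exp (-1/2)"] by blast
  finally show ?thesis unfolding fps_exp_power_mult by simp
qed

text \<open>The \<open>n\<close> hyperbolic sines contribute \<open>fps_X ^ n\<close> and the
  denominator cancels one \<open>fps_X\<close>, hence the shift by \<open>n - 1\<close> and the
  vanishing of the lower moments.\<close>

lemma phi_moments:
  assumes "\<forall>b\<in>set \<beta>. b > 0" "\<beta> \<noteq> []" "length \<beta> = n"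
  shows "(\<Sum>k<sum_list \<beta>. of_int (phi_beta \<beta> k) * center (sum_list \<beta>) k ^ J)
    = of_nat (prod_list \<beta>) * (fact J * (if J < n - 1 then 0 else gcoef n (\<lambda>i. of_nat (\<beta> ! i)) (J - (n - 1))))"
proof -
  let ?d = "sum_list \<beta>"
  let ?M = "\<Sum>k<?d. fps_const (of_int (phi_beta \<beta> k)) * fps_exp (center ?d k)"
  let ?S = "\<Prod>i<n. sinc_fps (of_nat (\<beta> ! i))"
  have pl: "(\<Prod>b\<leftarrow>\<beta>. f b) = (\<Prod>i<n. f (\<beta> ! i))" for f :: "nat \<Rightarrow> rat fps"
    unfolding assms(3)[symmetric] by (simp add: prod.list_conv_set_nth atLeast0LessThan)
  have pl': "of_nat (prod_list \<beta>) = (\<Prod>i<n. of_nat (\<beta> ! i) :: rat)"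
    unfolding assms(3)[symmetric] by (simp add: prod.list_conv_set_nth atLeast0LessThan)
  have fc: "(\<Prod>i<m. fps_const (f i)) = fps_const (\<Prod>i<m. f i)" for f :: "nat \<Rightarrow> rat" and m :: nat
    by (induction m) auto
  obtain n' where n': "n = Suc n'" using assms by (cases n) auto
  have "?M * (fps_X * sinc_fps 1) = (\<Prod>b\<leftarrow>\<beta>. fps_const (of_nat b) * fps_X * sinc_fps (of_nat b))"
    using phi_generating_function[OF assms(1,2)] exp_diff_sinc[of 1]
    unfolding exp_diff_sinc[of "of_nat _"] by simp
  also have "\<dots> = fps_const (of_nat (prod_list \<beta>)) * fps_X ^ n * ?S"
    unfolding pl pl' by (simp add: prod.distrib fc)
  finally have "fps_X * (?M * sinc_fps 1) = fps_X * (fps_const (of_nat (prod_list \<beta>)) * fps_X ^ n' * ?S)"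
    unfolding n' by (simp add: mult_ac)
  hence "?M * sinc_fps 1 = fps_const (of_nat (prod_list \<beta>)) * fps_X ^ n' * ?S" by simp
  hence "?M * (sinc_fps 1 * sinc_inv) = fps_const (of_nat (prod_list \<beta>)) * (fps_X ^ n' * (?S * sinc_inv))"
    by (simp add: mult.assoc[symmetric])
  hence "?M $ J = (fps_const (of_nat (prod_list \<beta>)) * (fps_X ^ n' * (?S * sinc_inv))) $ J"
    unfolding sinc_fps_mult_inv by simp
  also have "\<dots> = of_nat (prod_list \<beta>) * (if J < n - 1 then 0 else gcoef n (\<lambda>i. of_nat (\<beta> ! i)) (J - (n - 1)))"
    unfolding n' gcoef_def by (simp add: fps_X_power_mult_nth del: prod.lessThan_Suc)
  finally have "?M $ J = of_nat (prod_list \<beta>) * (if J < n - 1 then 0 else gcoef n (\<lambda>i. of_nat (\<beta> ! i)) (J - (n - 1)))" .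
  moreover have "?M $ J = (\<Sum>k<?d. of_int (phi_beta \<beta> k) * center ?d k ^ J) / fact J"
    by (simp add: fps_sum_nth sum_divide_distrib)
  ultimately show ?thesis by (simp add: field_simps)
qed

section \<open>Elementary symmetric functions of hook contents\<close>

definition esym_fps :: "nat \<Rightarrow> nat \<Rightarrow> rat fps" where
  "esym_fps d k = (\<Prod>j<d. 1 + fps_const (of_nat j - of_nat k) * fps_X)"

text \<open>The series is the reversed polynomial \<open>rprod d k\<close>. The second conjunct is
  needed for the leading coefficient in the induction step.\<close>

lemma esym_fps_nth_aux:
  "(\<forall>q. esym_fps d k $ q = (if q \<le> d then of_int (ecoef d k (d - q)) else 0)) \<and> (\<forall>i>d. ecoef d k i = 0)"
proof (induction d)
  case 0
  show ?case by (auto simp: esym_fps_def ecoef_def rprod_def)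
next
  case (Suc d)
  let ?c = "int d - int k"
  have r: "rprod (Suc d) k [:0, 1:] = rprod d k [:0, 1:] * [:?c, 1:]"
    by (simp add: rprod_def of_nat_poly)
  have e: "ecoef (Suc d) k i = ?c * ecoef d k i + (if i = 0 then 0 else ecoef d k (i - 1))" for i
    unfolding ecoef_def r by (cases i) (simp_all add: mult.commute[of _ "[:_, _:]"])
  have f: "esym_fps (Suc d) k $ q = esym_fps d k $ q + of_int ?c * (if q = 0 then 0 else esym_fps d k $ (q - 1))" for q
  proof -
    have "esym_fps (Suc d) k = esym_fps d k + fps_const (of_int ?c) * (fps_X * esym_fps d k)"
      by (simp add: esym_fps_def algebra_simps)
    thus ?thesis by (cases q) simp_all
  qed
  have IH: "esym_fps d k $ q = (if q \<le> d then of_int (ecoef d k (d - q)) else 0)" "i > d \<Longrightarrow> ecoef d k i = 0" for q i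
    using Suc by blast+
  have "esym_fps (Suc d) k $ q = (if q \<le> Suc d then of_int (ecoef (Suc d) k (Suc d - q)) else 0)" for q
  proof (cases q)
    case 0
    thus ?thesis unfolding f e by (simp add: IH)
  next
    case (Suc q')
    consider "q' < d" | "q' = d" | "q' > d" by linarith
    thus ?thesis
    proof cases
      case 1
      hence "d - q' \<noteq> 0" "d - Suc q' = d - q' - 1" by auto
      thus ?thesis using 1 Suc unfolding f e by (simp add: IH)
    qed (use Suc in \<open>simp_all add: f e IH\<close>)
  qed
  moreover have "ecoef (Suc d) k i = 0" if "i > Suc d" for i
    unfolding e using that IH(2) by simp
  ultimately show ?case by blast
qed

lemma ecoef_conv_esym:
  assumes "q \<le> d"
  shows "of_int (ecoef d k (d - q)) = esym_fps d k $ q"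
  using esym_fps_nth_aux[of d k] assms by simp

section \<open>Power sums of the contents and Newton's identities\<close>

definition psum :: "nat \<Rightarrow> nat \<Rightarrow> nat \<Rightarrow> rat" where
  "psum d k m = (\<Sum>j<d. (of_nat j - of_nat k) ^ m)"

lemma geometric_fps: "(1 + fps_const c * fps_X) * Abs_fps (\<lambda>i. (- c) ^ i) = (1 :: 'a::comm_ring_1 fps)"
proof (rule fps_ext)
  fix i
  show "((1 + fps_const c * fps_X) * Abs_fps (\<lambda>i. (- c) ^ i)) $ i = (1 :: 'a fps) $ i"
    by (cases i) (simp_all add: distrib_right mult.assoc)
qed

text \<open>Logarithmic derivative: a factor \<open>1 + c * X\<close> contributes
  \<open>c / (1 + c * X)\<close>, with the reciprocal written as a geometric series.\<close>

lemma esym_fps_deriv: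
  "fps_deriv (esym_fps d k) = esym_fps d k *
    (\<Sum>j<d. fps_const (of_nat j - of_nat k) * Abs_fps (\<lambda>i. (- (of_nat j - of_nat k)) ^ i))"
proof (induction d)
  case 0
  show ?case by (simp add: esym_fps_def)
next
  case (Suc d)
  let ?c = "of_nat d - of_nat k :: rat"
  let ?l = "1 + fps_const ?c * fps_X"
  let ?g = "Abs_fps (\<lambda>i. (- ?c) ^ i)"
  let ?G = "\<Sum>j<d. fps_const (of_nat j - of_nat k) * Abs_fps (\<lambda>i. (- (of_nat j - of_nat k)) ^ i) :: rat fps"
  have ring: "e * G * l + e * (c * (l * h)) = (e * l) * (G + c * h)" for e G l c h :: "rat fps"
    by (simp add: algebra_simps)
  have lg: "?l * ?g = 1" by (rule geometric_fps)
  have s: "esym_fps (Suc d) k = esym_fps d k * ?l" by (simp add: esym_fps_def)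
  have "fps_deriv (esym_fps (Suc d) k) = esym_fps d k * ?G * ?l + esym_fps d k * fps_const ?c"
    unfolding s using Suc by (simp add: algebra_simps)
  also have "\<dots> = esym_fps d k * ?G * ?l + esym_fps d k * (fps_const ?c * (?l * ?g))"
    unfolding lg by simp
  also have "\<dots> = (esym_fps d k * ?l) * (?G + fps_const ?c * ?g)"
    by (rule ring)
  finally show ?case unfolding s by simp
qed

lemma newton_identity:
  "of_nat (Suc q) * esym_fps d k $ Suc q =
    (\<Sum>i\<le>q. esym_fps d k $ i * ((-1) ^ (q - i) * psum d k (Suc (q - i))))"
proof -
  let ?G = "\<Sum>j<d. fps_const (of_nat j - of_nat k) * Abs_fps (\<lambda>i. (- (of_nat j - of_nat k)) ^ i) :: rat fps"
  have c: "c * (- c) ^ i = (-1) ^ i * c ^ Suc i" for c :: rat and i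
    by (simp add: power_minus[of c])
  have G: "?G $ i = (-1) ^ i * psum d k (Suc i)" for i
    unfolding psum_def sum_distrib_left fps_sum_nth
    by (intro sum.cong refl) (simp only: fps_mult_left_const_nth fps_nth_Abs_fps c)
  have "of_nat (Suc q) * esym_fps d k $ Suc q = fps_deriv (esym_fps d k) $ q" by simp
  also have "\<dots> = (\<Sum>i=0..q. esym_fps d k $ i * ?G $ (q - i))"
    unfolding esym_fps_deriv fps_mult_nth ..
  finally show ?thesis unfolding G by (simp add: atLeast0AtMost)
qed

text \<open>The power sum of the contents divided by \<open>d\<close>. The exponentials of the
  contents sum to \<open>exp (c * u) * sinh (d * u / 2) / sinh (u / 2)\<close> with \<open>c\<close>
  the mean content, and the factor \<open>d\<close> has been taken out. This yields both the
  polynomiality in \<open>c\<close> and \<open>d\<close> and the divisibility by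
  \<open>d\<close>.\<close>

definition phat :: "nat \<Rightarrow> rat \<Rightarrow> rat \<Rightarrow> rat" where
  "phat m s c = fact m * (fps_exp s * (sinc_fps c * sinc_inv)) $ m"

lemma psum_conv_phat: "psum d k m = of_nat d * phat m (center d k) (of_nat d)"
proof -
  let ?P = "\<Sum>j<d. fps_exp (of_nat j - of_nat k) :: rat fps"
  have tele: "?P * (fps_exp (1/2) - fps_exp (- 1/2))
      = fps_exp (of_nat d - of_nat k - 1/2) - fps_exp (- of_nat k - 1/2)"
  proof (induction d)
    case (Suc d)
    have "fps_exp (of_nat d - of_nat k) * (fps_exp (1/2) - fps_exp (- 1/2))
       = fps_exp (of_nat (Suc d) - of_nat k - 1/2) - (fps_exp (of_nat d - of_nat k - 1/2) :: rat fps)"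
      unfolding right_diff_distrib fps_exp_add_mult[symmetric] by (simp add: field_simps)
    thus ?case using Suc by (simp only: sum.lessThan_Suc distrib_right) simp
  qed simp
  also have "\<dots> = fps_exp (center d k) * (fps_exp (of_nat d / 2) - fps_exp (- of_nat d / 2))"
    unfolding right_diff_distrib fps_exp_add_mult[symmetric] center_def by (simp add: field_simps)
  finally have "?P * (fps_X * sinc_fps 1) = fps_exp (center d k) * (fps_const (of_nat d) * fps_X * sinc_fps (of_nat d))"
    using exp_diff_sinc[of 1] unfolding exp_diff_sinc[of "of_nat d"] by simp
  hence "fps_X * (?P * sinc_fps 1) = fps_X * (fps_const (of_nat d) * (fps_exp (center d k) * sinc_fps (of_nat d)))"
    by (simp only: mult_ac)
  hence "?P * sinc_fps 1 = fps_const (of_nat d) * (fps_exp (center d k) * sinc_fps (of_nat d))" by simp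
  hence "?P * (sinc_fps 1 * sinc_inv) = fps_const (of_nat d) * (fps_exp (center d k) * (sinc_fps (of_nat d) * sinc_inv))"
    by (simp add: mult.assoc[symmetric])
  hence "?P $ m = of_nat d * (fps_exp (center d k) * (sinc_fps (of_nat d) * sinc_inv)) $ m"
    unfolding sinc_fps_mult_inv by simp
  moreover have "?P $ m = psum d k m / fact m"
    by (simp add: psum_def fps_sum_nth sum_divide_distrib)
  ultimately show ?thesis unfolding phat_def by (simp add: field_simps)
qed

lemma phat_1: "phat 1 s c = s"
  using sinc_inv_1 by (simp add: phat_def fps_mult_nth sinc_fps_def)

lemma polyfun_phat: "polyfun 2 0 (int m) (\<lambda>x. phat m (x 0) (x 1))"
proof -
  have E: "polyfun 2 0 (int i) (\<lambda>x. fps_exp (x 0) $ i)" for i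
  proof -
    have "polyfun 2 (int i * 1) (int i * 1) (\<lambda>x. 1 / fact i * x 0 ^ i)"
      by (intro polyfun_cmult polyfun_power polyfun_var) simp
    thus ?thesis by (auto intro: polyfun_mono)
  qed
  have S: "polyfun 2 0 (int j) (\<lambda>x. (sinc_fps (x 1) * sinc_inv) $ j)" for j
    unfolding fps_mult_nth
  proof (rule polyfun_sum)
    fix i assume "i \<in> {0..j}"
    hence "polyfun 2 0 (int j) (\<lambda>x. sinc_inv $ (j - i) * sinc_fps (x 1) $ i)"
      by (intro polyfun_cmult polyfun_mono[OF polyfun_sinc_nth]) auto
    thus "polyfun 2 0 (int j) (\<lambda>x. sinc_fps (x 1) $ i * sinc_inv $ (j - i))" by (simp only: mult.commute)
  qed
  have "polyfun 2 0 (int m) (\<lambda>x. \<Sum>i=0..m. fps_exp (x 0) $ i * (sinc_fps (x 1) * sinc_inv) $ (m - i))"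
  proof (rule polyfun_sum)
    fix i assume "i \<in> {0..m}"
    hence "int i + int (m - i) = int m" by simp
    thus "polyfun 2 0 (int m) (\<lambda>x. fps_exp (x 0) $ i * (sinc_fps (x 1) * sinc_inv) $ (m - i))"
      using polyfun_mult[OF E[of i] S[of "m - i"]] by simp
  qed
  from polyfun_cmult[OF this, of "fact m"] show ?thesis
    unfolding phat_def fps_mult_nth[of "fps_exp _"] .
qed

definition pt :: "nat \<Rightarrow> nat \<Rightarrow> nat \<Rightarrow> rat" where
  "pt d k i = (if i = 0 then center d k else of_nat d)"

lemma pt_simps [simp]: "pt d k 0 = center d k" "pt d k (Suc i) = of_nat d"
  by (simp_all add: pt_def)

text \<open>The displayed main term is the contribution of the first power sum,
  \<open>(d * c) ^ q / fact q\<close>, with one \<open>d\<close> taken out. It has degree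
  \<open>2 * q - 1\<close> inside the bracket, so \<open>R\<close> is of strictly smaller degree.
  \<open>R\<close> must not depend on \<open>d\<close> and \<open>k\<close>.\<close>

definition esym_rest :: "nat \<Rightarrow> ((nat \<Rightarrow> rat) \<Rightarrow> rat) \<Rightarrow> bool" where
  "esym_rest q R \<longleftrightarrow> polyfun 2 0 (2 * int q - 2) R \<and>
    (\<forall>d k. esym_fps d k $ q = of_nat d * (center d k ^ q * of_nat d ^ (q - 1) / fact q + R (pt d k)))"

lemma esym_fps_0: "esym_fps d k $ 0 = 1"
  by (induction d) (simp_all add: esym_fps_def)

lemma esym_rest_polyfun:
  assumes "q > 0 \<Longrightarrow> \<exists>R. esym_rest q R"
  shows "\<exists>f. polyfun 2 0 (2 * int q) f \<and> (\<forall>d k. esym_fps d k $ q = f (pt d k))"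
proof (cases "q = 0")
  case True
  show ?thesis
    by (rule exI[of _ "\<lambda>_. 1"]) (use True esym_fps_0 in \<open>simp add: polyfun_const\<close>)
next
  case False
  then obtain R where R: "polyfun 2 0 (2 * int q - 2) R"
    "\<And>d k. esym_fps d k $ q = of_nat d * (center d k ^ q * of_nat d ^ (q - 1) / fact q + R (pt d k))"
    using assms unfolding esym_rest_def by blast
  have v: "polyfun 2 0 1 (\<lambda>x. x 0)" "polyfun 2 0 1 (\<lambda>x. x 1)"
    by (rule polyfun_mono[OF polyfun_var]; simp)+
  have "polyfun 2 (int q * 0 + int (q - 1) * 0) (int q * 1 + int (q - 1) * 1) (\<lambda>x. x 0 ^ q * x 1 ^ (q - 1))"
    by (intro polyfun_mult polyfun_power v)
  hence "polyfun 2 0 (2 * int q - 1) (\<lambda>x. x 0 ^ q * x 1 ^ (q - 1))"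
    by (rule polyfun_mono) (use False in auto)
  from polyfun_cmult[OF this, of "1 / fact q"]
  have "polyfun 2 0 (2 * int q - 1) (\<lambda>x. 1 / fact q * (x 0 ^ q * x 1 ^ (q - 1)) + R x)"
    by (rule polyfun_add) (rule polyfun_mono[OF R(1)], auto)
  from polyfun_mult[OF v(2) this]
  have "polyfun 2 0 (2 * int q) (\<lambda>x. x 1 * (1 / fact q * (x 0 ^ q * x 1 ^ (q - 1)) + R x))" by simp
  thus ?thesis using R(2) by (intro exI conjI) (auto simp: pt_def)
qed

text \<open>In Newton's identity every power sum carries a factor \<open>d\<close>. Only the first
  one raises the degree by two per index and so feeds the main term; the \<open>m\<close>-th with
  \<open>m \<ge> 2\<close>, divided by \<open>d\<close>, has degree at most
  \<open>m \<le> 2 * m - 2\<close> and goes into the remainder.\<close>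

lemma esym_rest_exists: "q > 0 \<Longrightarrow> \<exists>R. esym_rest q R"
proof (induction q rule: less_induct)
  case (less q)
  then obtain q' where q: "q = Suc q'" using gr0_implies_Suc by blast
  have "\<exists>f. polyfun 2 0 (2 * int i) f \<and> (\<forall>d k. esym_fps d k $ i = f (pt d k))" if "i < q" for i
    by (rule esym_rest_polyfun) (rule less(1)[OF that])
  hence "\<forall>i. \<exists>f. i < q \<longrightarrow> polyfun 2 0 (2 * int i) f \<and> (\<forall>d k. esym_fps d k $ i = f (pt d k))" by simp
  from choice[OF this] obtain f where f: "\<And>i. i < q \<Longrightarrow> polyfun 2 0 (2 * int i) (f i)"
    "\<And>i d k. i < q \<Longrightarrow> esym_fps d k $ i = f i (pt d k)" by auto
  let ?T = "\<lambda>x. \<Sum>i<q'. f i x * ((-1) ^ (q' - i) * phat (Suc (q' - i)) (x 0) (x 1))"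
  have T: "polyfun 2 0 (2 * int q') ?T"
  proof (rule polyfun_sum)
    fix i assume i: "i \<in> {..<q'}"
    have "polyfun 2 (0 + 0) (2 * int i + int (Suc (q' - i))) (\<lambda>x. f i x * ((-1) ^ (q' - i) * phat (Suc (q' - i)) (x 0) (x 1)))"
      by (intro polyfun_mult polyfun_cmult polyfun_phat f) (use i q in auto)
    thus "polyfun 2 0 (2 * int q') (\<lambda>x. f i x * ((-1) ^ (q' - i) * phat (Suc (q' - i)) (x 0) (x 1)))"
      by (rule polyfun_mono) (use i in auto)
  qed
  have newton: "of_nat q * esym_fps d k $ q = of_nat d * (esym_fps d k $ q' * center d k + ?T (pt d k))" for d k
  proof -
    have "of_nat q * esym_fps d k $ q = (\<Sum>i<q'. esym_fps d k $ i * ((-1) ^ (q' - i) * psum d k (Suc (q' - i))))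
       + esym_fps d k $ q' * psum d k 1"
      unfolding q newton_identity lessThan_Suc_atMost[symmetric] by simp
    also have "(\<Sum>i<q'. esym_fps d k $ i * ((-1) ^ (q' - i) * psum d k (Suc (q' - i)))) = of_nat d * ?T (pt d k)"
      unfolding sum_distrib_left psum_conv_phat
      by (intro sum.cong refl) (use q f(2) in \<open>simp add: pt_def mult_ac\<close>)
    finally show ?thesis unfolding psum_conv_phat[of d k 1] phat_1 by (simp add: algebra_simps)
  qed
  show ?case
  proof (cases "q' = 0")
    case True
    hence "esym_rest q (\<lambda>_. 0)"
      unfolding esym_rest_def using newton q esym_fps_0 by (auto intro: polyfun.zero)
    thus ?thesis by blast
  next
    case False
    then obtain R where R: "polyfun 2 0 (2 * int q' - 2) R"
      "\<And>d k. esym_fps d k $ q' = of_nat d * (center d k ^ q' * of_nat d ^ (q' - 1) / fact q' + R (pt d k))"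
      using less(1)[of q'] q unfolding esym_rest_def by auto
    let ?R = "\<lambda>x. 1 / of_nat q * (x 1 * x 0 * R x + ?T x)"
    have v: "polyfun 2 0 1 (\<lambda>x. x 0)" "polyfun 2 0 1 (\<lambda>x. x 1)"
      by (rule polyfun_mono[OF polyfun_var]; simp)+
    have "polyfun 2 0 (2 * int q') (\<lambda>x. x 1 * x 0 * R x)"
      using polyfun_mult[OF polyfun_mult[OF v(2,1)] R(1)] by simp
    hence "polyfun 2 0 (2 * int q - 2) ?R"
      using T by (intro polyfun_cmult polyfun_add) (simp_all add: q)
    moreover have "esym_fps d k $ q = of_nat d * (center d k ^ q * of_nat d ^ (q - 1) / fact q + ?R (pt d k))" for d k
    proof -
      have dq: "of_nat d ^ q' = of_nat d * (of_nat d ^ (q' - 1) :: rat)" using False by (cases q') auto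
      have "of_nat q * esym_fps d k $ q
         = of_nat d * (of_nat d * (center d k ^ q' * of_nat d ^ (q' - 1) / fact q' + R (pt d k)) * center d k + ?T (pt d k))"
        unfolding newton R(2) ..
      also have "\<dots> = of_nat d * (center d k ^ q * of_nat d ^ (q - 1) / fact q' + (of_nat d * center d k * R (pt d k) + ?T (pt d k)))"
        unfolding q by (simp add: dq algebra_simps)
      also have "\<dots> = of_nat q * (of_nat d * (center d k ^ q * of_nat d ^ (q - 1) / fact q + ?R (pt d k)))"
      proof -
        have gen: "D * (a / F + b) = N * (D * (a / (N * F) + 1 / N * b))" if "N \<noteq> 0" "F \<noteq> 0" for D a F b N :: rat
          using that by (simp add: field_simps)
        have "fact q = of_nat q * (fact q' :: rat)" unfolding q by (simp only: fact_Suc)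
        moreover have "pt d k 1 = of_nat d" "pt d k 0 = center d k" by simp_all
        ultimately show ?thesis by (simp only:) (rule gen, use q in auto)
      qed
      finally show ?thesis using q by simp
    qed
    ultimately have "esym_rest q ?R" unfolding esym_rest_def by blast
    thus ?thesis by blast
  qed
qed

text \<open>A monomial in the mean content and \<open>d\<close> turns into a higher moment times a
  power of the sum of the parts. Both exponents count with weight one, and taking the moment lowers
  the degree by \<open>n - 1\<close>, independently of the monomial.\<close>

lemma polyfun_moment_transfer:
  fixes n t :: nat
  assumes "polyfun 2 lo w R" "n > 0"
  shows "\<exists>F. polyfun n 0 (w + int t - (int n - 1)) F \<and>
    (\<forall>\<beta>. length \<beta> = n \<longrightarrow> (\<forall>b\<in>set \<beta>. b > 0) \<longrightarrow>
      (\<Sum>k<sum_list \<beta>. of_int (phi_beta \<beta> k) * center (sum_list \<beta>) k ^ t * R (pt (sum_list \<beta>) k))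
        = of_nat (prod_list \<beta>) * F (\<lambda>i. of_nat (\<beta> ! i)))"
  using assms(1)
proof (induction rule: polyfun.induct)
  case zero
  show ?case by (rule exI[of _ "\<lambda>_. 0"]) (simp add: polyfun.zero)
next
  case (add_monom f e a)
  let ?w = "w + int t - (int n - 1)"
  from add_monom obtain F where F: "polyfun n 0 ?w F"
    "\<And>\<beta>. length \<beta> = n \<Longrightarrow> \<forall>b\<in>set \<beta>. b > 0 \<Longrightarrow>
      (\<Sum>k<sum_list \<beta>. of_int (phi_beta \<beta> k) * center (sum_list \<beta>) k ^ t * f (pt (sum_list \<beta>) k))
        = of_nat (prod_list \<beta>) * F (\<lambda>i. of_nat (\<beta> ! i))" by blast
  let ?J = "t + e 0"
  let ?g = "\<lambda>x. fact ?J * (if ?J < n - 1 then 0 else gcoef n x (?J - (n - 1)))"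
  let ?F = "\<lambda>x. a * ((\<Sum>i<n. x i) ^ e 1 * ?g x) + F x"
  have deg: "mono_deg 2 e = e 0 + e 1" by (simp add: mono_deg_def numeral_2_eq_2)
  have "polyfun n 0 ?w (\<lambda>x. (\<Sum>i<n. x i) ^ e 1 * ?g x)"
  proof (cases "?J < n - 1")
    case True
    thus ?thesis by (simp add: polyfun.zero)
  next
    case False
    have "polyfun n (int (e 1) * 1 + 0) (int (e 1) * 1 + int (?J - (n - 1)))
       (\<lambda>x. (\<Sum>i<n. x i) ^ e 1 * (fact ?J * gcoef n x (?J - (n - 1))))"
      by (intro polyfun_mult polyfun_power polyfun_sum polyfun_cmult polyfun_gcoef polyfun_var) auto
    hence "polyfun n 0 ?w (\<lambda>x. (\<Sum>i<n. x i) ^ e 1 * (fact ?J * gcoef n x (?J - (n - 1))))"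
      by (rule polyfun_mono) (use add_monom(4) deg False assms(2) in auto)
    thus ?thesis using False by simp
  qed
  hence "polyfun n 0 ?w ?F" by (intro polyfun_add polyfun_cmult F(1))
  moreover have "(\<Sum>k<sum_list \<beta>. of_int (phi_beta \<beta> k) * center (sum_list \<beta>) k ^ t *
       (a * (\<Prod>i<2. pt (sum_list \<beta>) k i ^ e i) + f (pt (sum_list \<beta>) k)))
        = of_nat (prod_list \<beta>) * ?F (\<lambda>i. of_nat (\<beta> ! i))"
    if \<beta>: "length \<beta> = n" "\<forall>b\<in>set \<beta>. b > 0" for \<beta>
  proof -
    let ?d = "sum_list \<beta>"
    have ne: "\<beta> \<noteq> []" using \<beta> assms(2) by auto
    have d: "(\<Sum>i<n. of_nat (\<beta> ! i)) = (of_nat ?d :: rat)"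
      using \<beta>(1) by (simp add: sum_list_sum_nth atLeast0LessThan)
    have "(\<Sum>k<?d. of_int (phi_beta \<beta> k) * center ?d k ^ t * (a * (\<Prod>i<2. pt ?d k i ^ e i) + f (pt ?d k)))
       = a * of_nat ?d ^ e 1 * (\<Sum>k<?d. of_int (phi_beta \<beta> k) * center ?d k ^ ?J)
        + (\<Sum>k<?d. of_int (phi_beta \<beta> k) * center ?d k ^ t * f (pt ?d k))"
      unfolding sum_distrib_left sum.distrib[symmetric]
      by (intro sum.cong refl) (simp add: numeral_2_eq_2 power_add algebra_simps)
    thus ?thesis unfolding F(2)[OF \<beta>] phi_moments[OF \<beta>(2) ne \<beta>(1)] d by (simp add: algebra_simps)
  qed
  ultimately show ?case by blast
qed

section \<open>Assembly: from the count to the polynomial\<close>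

lemma hurwitz_H_formula:
  assumes "\<forall>b\<in>set \<beta>. b > 0" "\<beta> \<noteq> []" "sum_list \<beta> > q" "int t = 2 * int g - 1 + int (length \<beta>) - int q"
  shows "hurwitz_H g (sum_list \<beta> - q) \<beta> = of_nat (sum_list \<beta>) ^ t / (of_nat (sum_list \<beta>) * of_nat (prod_list \<beta>)) *
    (\<Sum>k<sum_list \<beta>. of_int (phi_beta \<beta> k) * center (sum_list \<beta>) k ^ t * esym_fps (sum_list \<beta>) k $ q)"
proof -
  let ?d = "sum_list \<beta>"
  let ?C = "{p. p permutes {0..<?d} \<and> ctype {0..<?d} p = mset \<beta>}"
  let ?N = "card (hurwitz_tuples ?d t (?d - q) \<beta>)"
  let ?S = "\<Sum>k<?d. of_int (phi_beta \<beta> k) * center ?d k ^ t * esym_fps ?d k $ q"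
  have d: "?d > 0" using assms(3) by simp
  have t: "nat (2 * int g - 1 + int (length \<beta>) + int (?d - q) - int ?d) = t"
    using assms(3,4) by simp
  have H: "hurwitz_H g (?d - q) \<beta> = of_nat (aut_partition \<beta>) / fact ?d * of_nat ?N"
    unfolding hurwitz_H_def Let_def t ..
  \<comment> \<open>The eigenvalue of the sum of all transpositions is the sum of the
    contents.\<close>
  have e1: "of_int (ecoef ?d k (?d - 1)) = of_nat ?d * center ?d k" for k
  proof -
    have "of_nat (Suc 0) * esym_fps ?d k $ Suc 0 = psum ?d k 1"
      unfolding newton_identity by (simp add: esym_fps_0)
    thus ?thesis using ecoef_conv_esym[of 1 ?d k] d psum_conv_phat[of ?d k 1] phat_1 by simp
  qed
  have eq: "of_int (ecoef ?d k (?d - q)) = esym_fps ?d k $ q" for k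
    using assms(3) by (intro ecoef_conv_esym) simp
  have "of_int (int ?d * int ?N) = (of_int (int (card ?C) * (\<Sum>k<?d. ecoef ?d k (?d - q) * (ecoef ?d k (?d - 1) ^ t * phi_beta \<beta> k))) :: rat)"
    unfolding card_hurwitz_tuples[OF d] ..
  also have "\<dots> = of_nat (card ?C) * (\<Sum>k<?d. esym_fps ?d k $ q * ((of_nat ?d * center ?d k) ^ t * of_int (phi_beta \<beta> k)))"
    by (simp only: of_int_mult of_int_of_nat_eq of_int_sum of_int_power eq e1)
  also have "\<dots> = of_nat (card ?C) * (of_nat ?d ^ t * ?S)"
    by (simp add: sum_distrib_left power_mult_distrib mult_ac)
  finally have N: "of_nat ?d * of_nat ?N = of_nat (card ?C) * (of_nat ?d ^ t * ?S)" by simp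
  have "of_nat (card ?C * (aut_partition \<beta> * prod_list \<beta>)) = (of_nat (fact (card {0..<?d})) :: rat)"
    by (subst card_cycle_type) (use assms(1) in auto)
  \<comment> \<open>The class size absorbs the normalisation of \<open>hurwitz_H\<close> and leaves
    only \<open>1 / prod_list \<beta>\<close>, which the moments will cancel.\<close>
  hence C: "of_nat (card ?C) * (of_nat (aut_partition \<beta>) * of_nat (prod_list \<beta>)) = (fact ?d :: rat)" by simp
  have p: "of_nat (prod_list \<beta>) \<noteq> (0 :: rat)" using assms(1) by (auto simp: prod_list_zero_iff)
  have d0: "of_nat ?d \<noteq> (0 :: rat)" using d unfolding of_nat_eq_0_iff by linarith
  have gen: "a / f * N = D / (d * p) * S" if "d * N = c * (D * S)" "c * (a * p) = f" "f \<noteq> 0" "p \<noteq> 0" "d \<noteq> 0"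
    for a f N D d p S c :: rat
  proof -
    have "a * N * (d * p) = a * p * (d * N)" by (simp only: mult_ac)
    also have "\<dots> = (c * (a * p)) * (D * S)" unfolding that(1) by (simp only: mult_ac)
    finally have "a * N * (d * p) = f * (D * S)" unfolding that(2) .
    thus ?thesis using that(3-5) by (simp add: field_simps)
  qed
  show ?thesis unfolding H by (rule gen[OF N C _ p d0]) simp
qed

theorem theorem3p6:
  fixes q n g :: nat
  assumes "n > 0" and "2 * int g - int q + int n \<ge> 3"
  shows "\<exists>c. is_mpoly n c
    \<and> (\<forall>\<beta>. length \<beta> = n \<and> (\<forall>b\<in>set \<beta>. b > 0) \<and> sum_list \<beta> > q \<longrightarrow>
         hurwitz_H g (sum_list \<beta> - q) \<beta> / (fact (2 * g + n - 1 - q) * of_nat (sum_list \<beta>))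
           = mpoly_eval n c (\<lambda>i. of_nat (\<beta> ! i)))
    \<and> (\<forall>e. c e \<noteq> 0 \<longrightarrow>
         int (mono_deg n e) \<ge> 2 * int g + int n - 2 - (if q = 0 then 1 else 0) - int q)
    \<and> (\<forall>e. c e \<noteq> 0 \<longrightarrow> mono_deg n e \<le> 4 * g + n - 3)
    \<and> (\<exists>e. c e \<noteq> 0 \<and> mono_deg n e = 4 * g + n - 3)"
proof -
  define t where "t = 2 * g + n - 1 - q"
  have t: "int t = 2 * int g - 1 + int n - int q" "t \<ge> 2" using assms unfolding t_def by auto
  define D where "D = 4 * int g + int n - 3"
  define lo where "lo = 2 * int g + int n - 2 - (if q = 0 then 1 else 0) - int q"
  define ds where "ds = (\<lambda>x :: nat \<Rightarrow> rat. \<Sum>i<n. x i)"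
  \<comment> \<open>\<open>fact (t + q)\<close> comes from the moment of order \<open>t + q\<close>,
    \<open>fact t\<close> from the normalisation and \<open>fact q\<close> from the elementary
    symmetric function.\<close>
  define K where "K = (fact (t + q) / (fact t * fact q) :: rat)"
  \<comment> \<open>The exponent collects \<open>d ^ t\<close> from the transpositions and
    \<open>d ^ q\<close> from the main term of the elementary symmetric function, less two divisions
    by \<open>d\<close>. With \<open>t + q = 2 * g + n - 1\<close>, the degree is
    \<open>t + q - 2 + 2 * g = D\<close>.\<close>
  define T where "T = (\<lambda>x. K * (ds x ^ (t + q - 2) * (\<Prod>i<n. sinc_fps (x i)) $ (2 * g)))"
  define L0 where "L0 = (\<lambda>x. K * (ds x ^ (t + q - 2) *
     (\<Sum>i<2 * g. (\<Prod>i<n. sinc_fps (x i)) $ i * sinc_inv $ (2 * g - i))))"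
  have ds1: "polyfun n 1 1 ds" unfolding ds_def by (intro polyfun_sum polyfun_var) simp
  have dsp: "polyfun n (int j) (int j) (\<lambda>x. ds x ^ j)" for j
    using polyfun_power[OF ds1, of j] by simp
  have "polyfun n (int (t + q - 2) + int (2 * g)) (int (t + q - 2) + int (2 * g)) T"
    unfolding T_def by (intro polyfun_cmult polyfun_mult dsp polyfun_prod_sinc_nth) simp
  hence polyT: "polyfun n D D T"
    by (rule polyfun_mono) (use t in \<open>auto simp: D_def\<close>)
  have "polyfun n (int (t + q - 2) + 0) (int (t + q - 2) + (int (2 * g) - 1)) L0"
    unfolding L0_def by (intro polyfun_cmult polyfun_mult dsp polyfun_gcoef_low)
  hence polyL0: "polyfun n lo (D - 1) L0"
    by (rule polyfun_mono) (use t in \<open>auto simp: D_def lo_def\<close>)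
  have TL0: "T x + L0 x = K * (ds x ^ (t + q - 2) * gcoef n x (2 * g))" for x
    unfolding T_def L0_def gcoef_split by (simp add: algebra_simps)
  have moment: "(\<Sum>k<sum_list \<beta>. of_int (phi_beta \<beta> k) * center (sum_list \<beta>) k ^ (t + q))
      = of_nat (prod_list \<beta>) * (fact (t + q) * gcoef n (\<lambda>i. of_nat (\<beta> ! i)) (2 * g))"
    if \<beta>: "length \<beta> = n" "\<forall>b\<in>set \<beta>. b > 0" for \<beta>
  proof -
    \<comment> \<open>The shift by \<open>n - 1\<close> turns the order of the main moment into
      twice the genus, an even index, as positivity requires.\<close>
    have "t + q - (n - 1) = 2 * g" "\<not> t + q < n - 1" "\<beta> \<noteq> []" using t assms \<beta> by auto
    thus ?thesis using phi_moments[OF \<beta>(2) _ \<beta>(1), of "t + q"] by simp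
  qed
  have "\<exists>L. polyfun n lo (D - 1) L \<and> (\<forall>\<beta>. length \<beta> = n \<and> (\<forall>b\<in>set \<beta>. b > 0) \<and> sum_list \<beta> > q \<longrightarrow>
     hurwitz_H g (sum_list \<beta> - q) \<beta> / (fact t * of_nat (sum_list \<beta>))
       = T (\<lambda>i. of_nat (\<beta> ! i)) + L (\<lambda>i. of_nat (\<beta> ! i)))"
  proof (cases "q = 0")
    case True
    \<comment> \<open>The elementary symmetric function is 1 here, so there is no remainder
      \<open>R\<close>, and no factor \<open>d\<close> offsets the two divisions.\<close>
    have "hurwitz_H g (sum_list \<beta> - q) \<beta> / (fact t * of_nat (sum_list \<beta>))
       = T (\<lambda>i. of_nat (\<beta> ! i)) + L0 (\<lambda>i. of_nat (\<beta> ! i))"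
      if \<beta>: "length \<beta> = n" "\<forall>b\<in>set \<beta>. b > 0" "sum_list \<beta> > q" for \<beta>
    proof -
      let ?d = "sum_list \<beta>"
      have ne: "\<beta> \<noteq> []" using \<beta> assms(1) by auto
      hence nz: "\<not> (\<forall>b\<in>set \<beta>. b = 0)" using \<beta>(2) by (cases \<beta>) auto
      have p: "of_nat (prod_list \<beta>) \<noteq> (0 :: rat)" using \<beta>(2) by (auto simp: prod_list_zero_iff)
      have ds: "ds (\<lambda>i. of_nat (\<beta> ! i)) = of_nat ?d"
        unfolding ds_def using \<beta>(1) by (simp add: sum_list_sum_nth atLeast0LessThan)
      obtain t' where t': "t = Suc (Suc t')" using t(2) by (metis add_2_eq_Suc le_Suc_ex)
      have dt: "of_nat ?d ^ t = of_nat ?d * (of_nat ?d * (of_nat ?d ^ (t - 2) :: rat))"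
        unfolding t' by simp
      have "(\<Sum>k<?d. of_int (phi_beta \<beta> k) * center ?d k ^ t * esym_fps ?d k $ q)
         = of_nat (prod_list \<beta>) * (fact t * gcoef n (\<lambda>i. of_nat (\<beta> ! i)) (2 * g))"
        using moment[OF \<beta>(1,2)] True by (simp add: esym_fps_0)
      thus ?thesis
        unfolding hurwitz_H_formula[OF \<beta>(2) ne \<beta>(3) t(1)[folded \<beta>(1)]] TL0 ds K_def dt
        using p nz True by (simp add: field_simps)
    qed
    thus ?thesis using polyL0 by blast
  next
    case False
    then obtain R where R: "polyfun 2 0 (2 * int q - 2) R"
      "\<And>d k. esym_fps d k $ q = of_nat d * (center d k ^ q * of_nat d ^ (q - 1) / fact q + R (pt d k))"
      using esym_rest_exists[of q] unfolding esym_rest_def by blast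
    obtain F where F: "polyfun n 0 ((2 * int q - 2) + int t - (int n - 1)) F"
      "\<And>\<beta>. length \<beta> = n \<Longrightarrow> \<forall>b\<in>set \<beta>. b > 0 \<Longrightarrow>
        (\<Sum>k<sum_list \<beta>. of_int (phi_beta \<beta> k) * center (sum_list \<beta>) k ^ t * R (pt (sum_list \<beta>) k))
          = of_nat (prod_list \<beta>) * F (\<lambda>i. of_nat (\<beta> ! i))"
      using polyfun_moment_transfer[OF R(1) assms(1), of t] by blast
    define L where "L = (\<lambda>x. L0 x + 1 / fact t * (ds x ^ (t - 1) * F x))"
    have "polyfun n (int (t - 1) + 0) (int (t - 1) + ((2 * int q - 2) + int t - (int n - 1))) (\<lambda>x. 1 / fact t * (ds x ^ (t - 1) * F x))"
      by (intro polyfun_cmult polyfun_mult dsp F(1))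
    \<comment> \<open>The lower bound is \<open>t - 1 = lo\<close>, and the upper one is
      \<open>(t - 1) + (2 * q - 2) + t - (n - 1) = D - 1\<close>.\<close>
    hence "polyfun n lo (D - 1) (\<lambda>x. 1 / fact t * (ds x ^ (t - 1) * F x))"
      by (rule polyfun_mono) (use t False in \<open>auto simp: D_def lo_def\<close>)
    hence "polyfun n lo (D - 1) L" unfolding L_def by (intro polyfun_add polyL0)
    moreover have "hurwitz_H g (sum_list \<beta> - q) \<beta> / (fact t * of_nat (sum_list \<beta>))
       = T (\<lambda>i. of_nat (\<beta> ! i)) + L (\<lambda>i. of_nat (\<beta> ! i))"
      if \<beta>: "length \<beta> = n" "\<forall>b\<in>set \<beta>. b > 0" "sum_list \<beta> > q" for \<beta>
    proof -
      let ?d = "sum_list \<beta>"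
      let ?x = "\<lambda>i. of_nat (\<beta> ! i) :: rat"
      have ne: "\<beta> \<noteq> []" using \<beta> assms(1) by auto
      have p: "of_nat (prod_list \<beta>) \<noteq> (0 :: rat)" using \<beta>(2) by (auto simp: prod_list_zero_iff)
      have ds: "ds ?x = of_nat ?d"
        unfolding ds_def using \<beta>(1) by (simp add: sum_list_sum_nth atLeast0LessThan)
      have dt: "of_nat ?d ^ t = of_nat ?d * (of_nat ?d ^ (t - 1) :: rat)"
        using t(2) by (simp flip: power_Suc)
      have dq: "of_nat ?d ^ (t + q - 2) = of_nat ?d ^ (t - 1) * (of_nat ?d ^ (q - 1) :: rat)"
        using t(2) False unfolding power_add[symmetric] by (intro arg_cong[where f = "power _"]) simp
      have "(\<Sum>k<?d. of_int (phi_beta \<beta> k) * center ?d k ^ t * esym_fps ?d k $ q)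
         = of_nat ?d * (of_nat ?d ^ (q - 1) / fact q * (\<Sum>k<?d. of_int (phi_beta \<beta> k) * center ?d k ^ (t + q))
            + (\<Sum>k<?d. of_int (phi_beta \<beta> k) * center ?d k ^ t * R (pt ?d k)))"
        unfolding R(2) sum_distrib_left sum.distrib[symmetric]
        by (intro sum.cong refl) (simp add: power_add algebra_simps)
      also have "\<dots> = of_nat ?d * (of_nat (prod_list \<beta>) * (of_nat ?d ^ (q - 1) / fact q * (fact (t + q) * gcoef n ?x (2 * g)) + F ?x))"
        unfolding moment[OF \<beta>(1,2)] F(2)[OF \<beta>(1,2)] by (simp add: algebra_simps)
      finally have S: "(\<Sum>k<?d. of_int (phi_beta \<beta> k) * center ?d k ^ t * esym_fps ?d k $ q)
         = of_nat ?d * (of_nat (prod_list \<beta>) * (of_nat ?d ^ (q - 1) / fact q * (fact (t + q) * gcoef n ?x (2 * g)) + F ?x))" .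
      have TL: "T ?x + L ?x = K * (of_nat ?d ^ (t - 1) * of_nat ?d ^ (q - 1) * gcoef n ?x (2 * g)) + 1 / fact t * (of_nat ?d ^ (t - 1) * F ?x)"
        unfolding L_def add.assoc[symmetric] TL0 ds dq ..
      have d0: "of_nat ?d \<noteq> (0 :: rat)" using \<beta>(3) unfolding of_nat_eq_0_iff by linarith
      have gen: "d * u / (d * p) * (d * (p * (v / f * (h * G) + y))) / (e * d) = h / (e * f) * (u * v * G) + 1 / e * (u * y)"
        if "d \<noteq> 0" "p \<noteq> 0" "e \<noteq> 0" "f \<noteq> 0" for d u p v f h G y e :: rat
        using that by (simp add: field_simps)
      show ?thesis
        unfolding hurwitz_H_formula[OF \<beta>(2) ne \<beta>(3) t(1)[folded \<beta>(1)]] S dt TL K_def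
        by (rule gen[OF d0 p]) simp_all
    qed
    ultimately show ?thesis by blast
  qed
  then obtain L where L: "polyfun n lo (D - 1) L"
    "\<And>\<beta>. length \<beta> = n \<and> (\<forall>b\<in>set \<beta>. b > 0) \<and> sum_list \<beta> > q \<Longrightarrow>
     hurwitz_H g (sum_list \<beta> - q) \<beta> / (fact t * of_nat (sum_list \<beta>))
       = T (\<lambda>i. of_nat (\<beta> ! i)) + L (\<lambda>i. of_nat (\<beta> ! i))" by blast
  \<comment> \<open>At the all-ones point no cancellation can occur, so the top component is a
    nonzero polynomial.\<close>
  have "T (\<lambda>_. 1) > 0"
    unfolding T_def K_def ds_def using prod_sinc_one_pos[of "2 * g" n] assms(1)
    by (intro mult_pos_pos) simp_all
  hence Tne: "T (\<lambda>_. 1) \<noteq> 0" by simp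
  have "lo \<le> D" unfolding lo_def D_def by auto
  from polyfun_top_degree[OF polyT L(1) this Tne]
  obtain c where c: "is_mpoly n c" "\<And>x. mpoly_eval n c x = T x + L x"
    "\<And>e. c e \<noteq> 0 \<Longrightarrow> lo \<le> int (mono_deg n e) \<and> int (mono_deg n e) \<le> D"
    "\<exists>e. c e \<noteq> 0 \<and> int (mono_deg n e) = D" by blast
  \<comment> \<open>The hypothesis on \<open>g\<close>, \<open>q\<close> and \<open>n\<close> gives
    \<open>4 * g + n \<ge> 3\<close>, so the subtraction of natural numbers is exact.\<close>
  have D: "D = int (4 * g + n - 3)" unfolding D_def using assms by auto
  show ?thesis
    unfolding t_def[symmetric] lo_def[symmetric]
    using c L(2) unfolding D of_nat_le_iff of_nat_eq_iff by (intro exI[of _ c]) auto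
qed

end
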